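(* Let $n\ge 1$ and let $\varphi:\mathbb C^n\to\mathbb R$ be a plurisubharmonic $\mathcal C^\infty$ function. Let $u=\sum_{j=1}^n u_j\,dz_j\in A^2_{(1,0)}(\mathbb C^n,e^{-\varphi})$ and suppose that $u\in\mathrm{dom}(\partial)\cap\mathrm{dom}(\partial^*_\varphi)$. Then $$\|\partial u\|_\varphi^2+\|\partial_\varphi^*u\|_\varphi^2=\sum_{j,k=1}^n\int_{\mathbb C^n}\left|\frac{\partial u_j}{\partial z_k}\right|^2e^{-\varphi}\,d\lambda+\sum_{j,k=1}^n\int_{\mathbb C^n}\frac{\partial^2\varphi}{\partial z_k\partial\overline z_j}\,u_j\,\overline{u_k}\,e^{-\varphi}\,d\lambda-\sum_{j,k=1}^n\left(\frac{\partial\varphi}{\partial\overline z_j}u_j-P_\varphi\Big(\frac{\partial\varphi}{\partial\overline z_j}u_j\Big),\ \frac{\partial\varphi}{\partial\overline z_k}u_k\right)_\varphi .$$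
   Context: $\lambda$ is Lebesgue measure on $\mathbb C^n$. $L^2(\mathbb C^n,e^{-\varphi})$ has inner product $(f,g)_\varphi=\int_{\mathbb C^n}f\,\overline g\,e^{-\varphi}\,d\lambda$ and norm $\|\cdot\|_\varphi$, and $A^2(\mathbb C^n,e^{-\varphi})$ is its closed subspace of entire functions. It is a reproducing kernel Hilbert space with (Bergman) kernel $K_\varphi(z,w)$, and $P_\varphi:L^2(\mathbb C^n,e^{-\varphi})\to A^2(\mathbb C^n,e^{-\varphi})$ is the orthogonal projection, $P_\varphi F(z)=\int_{\mathbb C^n}K_\varphi(z,w)F(w)e^{-\varphi(w)}\,d\lambda(w)$. $A^2_{(p,0)}(\mathbb C^n,e^{-\varphi})$ is the Hilbert space of $(p,0)$-forms $f=\sum'_{|J|=p}f_J\,dz_J$ (sum over strictly increasing multi-indices $J=(j_1,\dots,j_p)$) with coefficients $f_J\in A^2(\mathbb C^n,e^{-\varphi})$ and $\|f\|^2_\varphi=\sum'_{|J|=p}\|f_J\|^2_\varphi$. The operator $\partial$ is $\partial f=\sum'_{|J|=p}\sum_{j=1}^n\frac{\partial f_J}{\partial z_j}\,dz_j\wedge dz_J$, with $\mathrm{dom}(\partial)=\{f\in A^2_{(p,0)}(\mathbb C^n,e^{-\varphi}):\partial f\in A^2_{(p+1,0)}(\mathbb C^n,e^{-\varphi})\}$, regarded as a densely defined operator. $\partial^*_\varphi$ is the Hilbert space adjoint of $\partial$, with $\mathrm{dom}(\partial_\varphi^* )=\{g\in A^2_{(p+1,0)}(\mathbb C^n,e^{-\varphi}):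 f\mapsto(\partial f,g)_\varphi\text{ is continuous on }\mathrm{dom}(\partial)\}$ (with respect to $\|\cdot\|_\varphi$). For a $(1,0)$-form $u$, $\partial u$ is a $(2,0)$-form and $\partial^*_\varphi u$ is a function in $A^2(\mathbb C^n,e^{-\varphi})$. *)

theory Defs
  imports "HOL-Analysis.Analysis"
begin

text \<open>
  \<open>\<complex>\<^sup>n\<close> is \<^typ>\<open>complex^'n\<close>, a real Euclidean space of dimension \<open>2n\<close>, on which
  \<^term>\<open>lborel\<close> is Lebesgue measure.
\<close>

text \<open>Wirtinger derivatives; the real directions of \<open>x\<^sub>j\<close> and \<open>y\<^sub>j\<close> are
  \<^term>\<open>axis j 1\<close> and \<^term>\<open>axis j \<i>\<close>.\<close>

definition d_z :: "'n \<Rightarrow> (complex^'n \<Rightarrow> complex) \<Rightarrow> complex^'n \<Rightarrow> complex" where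
  "d_z j f z =
     (frechet_derivative f (at z) (axis j 1) - \<i> * frechet_derivative f (at z) (axis j \<i>)) / 2"

definition d_zbar :: "'n \<Rightarrow> (complex^'n \<Rightarrow> complex) \<Rightarrow> complex^'n \<Rightarrow> complex" where
  "d_zbar j f z =
     (frechet_derivative f (at z) (axis j 1) + \<i> * frechet_derivative f (at z) (axis j \<i>)) / 2"

definition entire :: "(complex^'n \<Rightarrow> complex) \<Rightarrow> bool" where
  "entire f \<longleftrightarrow>
     (\<forall>z. \<exists>D. (f has_derivative D) (at z) \<and> (\<forall>c v. D (c *s v) = c * D v))"

primrec C_k :: "nat \<Rightarrow> ('a::real_normed_vector \<Rightarrow> 'b::real_normed_vector) \<Rightarrow> bool" where
  "C_k 0 f \<longleftrightarrow> continuous_on UNIV f"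
| "C_k (Suc k) f \<longleftrightarrow>
     (\<forall>x. f differentiable (at x)) \<and> (\<forall>v. C_k k (\<lambda>x. frechet_derivative f (at x) v))"

definition C_infinity :: "('a::real_normed_vector \<Rightarrow> 'b::real_normed_vector) \<Rightarrow> bool" where
  "C_infinity f \<longleftrightarrow> (\<forall>k. C_k k f)"

text \<open>Upper semicontinuous and subharmonic on every complex line (sub-mean value property on
  circles). Since the functions considered do not take the value \<open>-\<infinity>\<close>, the circular means are
  finite; integrability is demanded because the Bochner integral of a non-integrable function is
  \<open>0\<close>.\<close>

definition plurisubharmonic :: "(complex^'n \<Rightarrow> real) \<Rightarrow> bool" where
  "plurisubharmonic \<phi> \<longleftrightarrow>
     (\<forall>c. open {z. \<phi> z < c}) \<and>
     (\<forall>a w. set_integrable lborel {0..2*pi} (\<lambda>t. \<phi> (a + cis t *s w)) \<and>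
            \<phi> a \<le> (LINT t:{0..2*pi}|lborel. \<phi> (a + cis t *s w)) / (2*pi))"

definition L2 :: "(complex^'n \<Rightarrow> real) \<Rightarrow> (complex^'n \<Rightarrow> complex) set" where
  "L2 \<phi> = {F. F \<in> borel_measurable lborel \<and>
              integrable lborel (\<lambda>z. (cmod (F z))\<^sup>2 * exp (- \<phi> z))}"

definition A2 :: "(complex^'n \<Rightarrow> real) \<Rightarrow> (complex^'n \<Rightarrow> complex) set" where
  "A2 \<phi> = {f \<in> L2 \<phi>. entire f}"

definition inner_w ::
  "(complex^'n \<Rightarrow> real) \<Rightarrow> (complex^'n \<Rightarrow> complex) \<Rightarrow> (complex^'n \<Rightarrow> complex) \<Rightarrow> complex" where
  "inner_w \<phi> f g = (LINT z|lborel. f z * cnj (g z) * of_real (exp (- \<phi> z)))"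

definition norm_w :: "(complex^'n \<Rightarrow> real) \<Rightarrow> (complex^'n \<Rightarrow> complex) \<Rightarrow> real" where
  "norm_w \<phi> f = sqrt (LINT z|lborel. (cmod (f z))\<^sup>2 * exp (- \<phi> z))"

text \<open>Elements of \<^term>\<open>L2 \<phi>\<close> are functions, not classes; the value of the projection is an
  entire function and hence unique as a function. Meaningful only for \<^term>\<open>F \<in> L2 \<phi>\<close>.\<close>

definition bergman_proj ::
  "(complex^'n \<Rightarrow> real) \<Rightarrow> (complex^'n \<Rightarrow> complex) \<Rightarrow> complex^'n \<Rightarrow> complex" where
  "bergman_proj \<phi> F =
     (THE h. h \<in> A2 \<phi> \<and> (\<forall>g\<in>A2 \<phi>. inner_w \<phi> (\<lambda>z. F z - h z) g = 0))"

text \<open>A strictly increasing multi-index is encoded by the set of its entries, and a form by its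
  coefficients \<open>f\<^sub>J\<close>. A \<open>(p,0)\<close>-form vanishes at all \<open>J\<close> with \<open>card J \<noteq> p\<close>, so sums over
  \<open>|J| = p\<close> may be taken over all \<open>J\<close>.\<close>

type_synonym 'n form = "'n set \<Rightarrow> complex^'n \<Rightarrow> complex"

definition A2_form :: "nat \<Rightarrow> (complex^'n \<Rightarrow> real) \<Rightarrow> 'n form set" where
  "A2_form p \<phi> = {f. \<forall>J. if card J = p then f J \<in> A2 \<phi> else f J = (\<lambda>z. 0)}"

definition inner_form :: "(complex^'n \<Rightarrow> real) \<Rightarrow> 'n form \<Rightarrow> 'n form \<Rightarrow> complex" where
  "inner_form \<phi> f g = (\<Sum>J\<in>UNIV. inner_w \<phi> (f J) (g J))"

definition norm_form :: "(complex^'n \<Rightarrow> real) \<Rightarrow> 'n form \<Rightarrow> real" where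
  "norm_form \<phi> f = sqrt (\<Sum>J\<in>UNIV. (norm_w \<phi> (f J))\<^sup>2)"

text \<open>For \<open>j \<notin> J\<close>, moving \<open>dz\<^sub>j\<close> to its place in \<open>dz\<^sub>j \<and> dz\<^sub>J\<close> yields
  \<open>(-1)^m dz\<^sub>K\<close>, where \<open>K = J \<union> {j}\<close> and \<open>m\<close> is the number of \<open>i \<in> J\<close> with \<open>i < j\<close>; for
  \<open>j \<in> J\<close> the product is \<open>0\<close>. Below, the terms contributing to \<open>dz\<^sub>K\<close> are collected.\<close>

definition del :: "('n::{finite,linorder}) form \<Rightarrow> 'n form" where
  "del f K z = (\<Sum>j\<in>K. (-1) ^ card {i\<in>K. i < j} * d_z j (f (K - {j})) z)"

definition dom_del :: "nat \<Rightarrow> (complex^('n::{finite,linorder}) \<Rightarrow> real) \<Rightarrow> 'n form set" where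
  "dom_del p \<phi> = {f \<in> A2_form p \<phi>. del f \<in> A2_form (Suc p) \<phi>}"

definition densely_defined_del ::
  "nat \<Rightarrow> (complex^('n::{finite,linorder}) \<Rightarrow> real) \<Rightarrow> bool" where
  "densely_defined_del p \<phi> \<longleftrightarrow>
     (\<forall>f\<in>A2_form p \<phi>. \<forall>\<epsilon>>0. \<exists>g\<in>dom_del p \<phi>. norm_form \<phi> (\<lambda>J z. f J z - g J z) < \<epsilon>)"

definition dom_del_adj :: "nat \<Rightarrow> (complex^('n::{finite,linorder}) \<Rightarrow> real) \<Rightarrow> 'n form set" where
  "dom_del_adj p \<phi> = {g \<in> A2_form (Suc p) \<phi>.
     \<forall>f\<in>dom_del p \<phi>. \<forall>\<epsilon>>0. \<exists>\<delta>>0. \<forall>f'\<in>dom_del p \<phi>.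
       norm_form \<phi> (\<lambda>J z. f' J z - f J z) < \<delta> \<longrightarrow>
       cmod (inner_form \<phi> (del f') g - inner_form \<phi> (del f) g) < \<epsilon>}"

text \<open>The adjoint on \<open>(p+1,0)\<close>-forms, with values in \<open>(p,0)\<close>-forms; it is determined by this
  only if \<open>\<partial>\<close> is densely defined.\<close>

definition del_adj ::
  "nat \<Rightarrow> (complex^('n::{finite,linorder}) \<Rightarrow> real) \<Rightarrow> 'n form \<Rightarrow> 'n form" where
  "del_adj p \<phi> g =
     (THE h. h \<in> A2_form p \<phi> \<and> (\<forall>f\<in>dom_del p \<phi>. inner_form \<phi> (del f) g = inner_form \<phi> f h))"

end

theory Submission
  imports Defs "HOL-Complex_Analysis.Cauchy_Integral_Formula"
begin

text \<open>
  Write \<open>a\<^sub>j\<^sub>k\<close> for \<open>\<partial>u\<^sub>j/\<partial>z\<^sub>k\<close> and \<open>F\<^sub>j\<close> for the product of \<open>u\<^sub>j\<close> with the \<open>z\<^sub>j\<close>-bar derivative of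
  \<open>\<phi>\<close>. Integrating by parts twice, first in \<open>z\<^sub>k\<close> and then in \<open>z\<^sub>j\<close>-bar, gives for all \<open>j, k\<close>
  \<open>(F\<^sub>j, F\<^sub>k) = (Levi term) + (a\<^sub>j\<^sub>k, a\<^sub>k\<^sub>j)\<close>. Integrating by parts once identifies the adjoint as
  \<open>\<partial>\<^sup>*u = \<Sum>\<^sub>j P F\<^sub>j\<close>, whence \<open>\<parallel>\<partial>\<^sup>*u\<parallel>\<^sup>2 = \<Sum>\<^sub>j\<^sub>k (P F\<^sub>j, F\<^sub>k)\<close>, while
  \<open>\<parallel>\<partial>u\<parallel>\<^sup>2 = \<Sum>\<^sub>j\<^sub>k \<parallel>a\<^sub>j\<^sub>k\<parallel>\<^sup>2 - \<Sum>\<^sub>j\<^sub>k (a\<^sub>j\<^sub>k, a\<^sub>k\<^sub>j)\<close>; adding up proves the identity.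

  The integrations by parts use cutoffs, and all terms must be shown to be integrable. For
  \<open>j = k\<close> both terms produced by \<open>(F\<^sub>j, F\<^sub>j)\<close> are nonnegative, so the diagonal Levi terms are
  integrable; positivity of the Levi form then dominates the other Levi terms, and
  \<open>2 Re (a\<^sub>j\<^sub>k, a\<^sub>k\<^sub>j) = \<parallel>a\<^sub>j\<^sub>k\<parallel>\<^sup>2 + \<parallel>a\<^sub>k\<^sub>j\<parallel>\<^sup>2 - \<parallel>a\<^sub>j\<^sub>k - a\<^sub>k\<^sub>j\<parallel>\<^sup>2\<close> together with
  \<open>a\<^sub>j\<^sub>k - a\<^sub>k\<^sub>j \<in> L\<^sup>2\<close> gives \<open>a\<^sub>j\<^sub>k \<in> L\<^sup>2\<close>.
\<close>

text \<open>The obstacle is circularity: letting the cutoffs go in the double integration by parts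
  requires \<open>a\<^sub>j\<^sub>k\<close> in L^2, which is what that very computation has to
  yield. It is broken by an inequality that holds before the limit: the cutoff is a square whose
  derivative is controlled by its square root, so the one error term containing
  \<open>a\<^sub>j\<^sub>k\<close> can be absorbed. Hence the estimate precedes the exact identity,
  and the Levi terms have to be settled in between. That each \<open>F\<^sub>j\<close> is in L^2
  both bounds the remaining terms and gives \<open>P F\<^sub>j\<close> a meaning. That the sum of
  the \<open>P F\<^sub>j\<close> is the value of the adjoint, and not merely one solution of its
  equation, rests on density of the domain. The projection itself needs bounded point evaluations;
  these come from a mean value property, which is one more integration by parts against a compactly
  supported radial function.\<close>

unbundle no fps_syntax

section \<open>Entire functions\<close>

lemma axis_ii: "axis k \<i> = \<i> *s axis k (1::complex)"
  by (vector axis_def)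

lemma norm_axis: "norm (axis k c :: complex^'n) = cmod c"
  by (simp add: norm_eq_sqrt_inner inner_axis_axis)

lemma axis_cmult: "axis k c = c *s axis k (1::complex)"
  by (vector axis_def)

lemma linear_vec_smult_left: "linear (\<lambda>c::complex. c *s (w::complex^'n))"
  by (rule linearI) (vector distrib_right, vector)

lemma sum_axis_mult:
  fixes g :: "'n::finite \<Rightarrow> complex"
  shows "(\<Sum>k\<in>UNIV. axis j c $ k * g k) = c * g j"
proof -
  have "(\<Sum>k\<in>UNIV. axis j c $ k * g k) = (\<Sum>k\<in>UNIV. if k = j then c * g k else 0)"
    by (rule sum.cong) (auto simp: axis_def)
  then show ?thesis by simp
qed

text \<open>The definition of \<open>entire\<close> supplies a complex-homogeneous derivative.
  Expanding a vector along the \<open>axis k 1\<close> gives the coefficients \<open>d_z k\<close>,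
  because homogeneity makes the derivative along \<open>axis k \<i>\<close> equal to \<i> times the
  one along \<open>axis k 1\<close>.\<close>

lemma entire_has_derivative:
  fixes f :: "complex^'n \<Rightarrow> complex"
  assumes "entire f"
  shows "(f has_derivative (\<lambda>v. \<Sum>k\<in>UNIV. v $ k * d_z k f z)) (at z)"
proof -
  obtain D where D: "(f has_derivative D) (at z)" and h: "\<And>c v. D (c *s v) = c * D v"
    using assms unfolding entire_def by blast
  have fr: "frechet_derivative f (at z) = D"
    using frechet_derivative_at[OF D] by simp
  have dz: "d_z k f z = D (axis k 1)" for k
    unfolding d_z_def fr axis_ii h by (simp add: field_simps)
  have "D v = (\<Sum>k\<in>UNIV. v $ k * d_z k f z)" for v
  proof -
    have lin: "linear D" using D has_derivative_linear by blast
    have "D v = D (\<Sum>k\<in>UNIV. v $ k *s axis k 1)" by (simp add: basis_expansion)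
    also have "\<dots> = (\<Sum>k\<in>UNIV. v $ k * d_z k f z)"
      by (simp add: linear_sum[OF lin] h dz)
    finally show ?thesis .
  qed
  then show ?thesis using D by (metis (no_types, lifting) ext)
qed

text \<open>The candidates \<open>g k\<close> become the partial derivatives, so each closure
  property below delivers its derivative formula by the same argument.\<close>

lemma entireI:
  fixes f :: "complex^'n \<Rightarrow> complex"
  assumes "\<And>z. (f has_derivative (\<lambda>v. \<Sum>k\<in>UNIV. v $ k * g k z)) (at z)"
  shows "entire f" "d_z k f z = g k z"
proof -
  show ent: "entire f"
    unfolding entire_def
  proof (intro allI exI conjI)
    fix z show "(f has_derivative (\<lambda>v. \<Sum>k\<in>UNIV. v $ k * g k z)) (at z)" by (rule assms)
  qed (simp add: sum_distrib_left mult.assoc)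
  have "(\<lambda>v. \<Sum>k\<in>UNIV. v $ k * d_z k f z) = (\<lambda>v. \<Sum>k\<in>UNIV. v $ k * g k z)"
    using entire_has_derivative[OF ent] assms has_derivative_unique by blast
  from fun_cong[OF this, of "axis k 1"] show "d_z k f z = g k z"
    by (simp add: sum_axis_mult)
qed

lemma frechet_derivative_entire:
  "entire f \<Longrightarrow> frechet_derivative f (at z) v = (\<Sum>k\<in>UNIV. v $ k * d_z k f z)"
  using fun_cong[OF frechet_derivative_at[OF entire_has_derivative, symmetric], of f z v] by simp

lemma d_zbar_entire: "entire f \<Longrightarrow> d_zbar k f z = 0"
proof -
  assume f: "entire f"
  have "frechet_derivative f (at z) (axis k c) = c * d_z k f z" for c
    unfolding frechet_derivative_entire[OF f] by (rule sum_axis_mult)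
  then show ?thesis unfolding d_zbar_def by simp
qed

lemma entire_continuous: "entire f \<Longrightarrow> continuous_on S f"
  by (meson entire_has_derivative has_derivative_continuous continuous_at_imp_continuous_on)

lemma entire_zero [simp]: "entire (\<lambda>z. 0)"
  by (rule entireI(1)[where g="\<lambda>_ _. 0"]) simp

lemma entire_cmult:
  assumes "entire f" shows "entire (\<lambda>z. c * f z)" "d_z k (\<lambda>z. c * f z) z = c * d_z k f z"
proof -
  have "((\<lambda>z. c * f z) has_derivative (\<lambda>v. \<Sum>k\<in>UNIV. v $ k * (c * d_z k f z))) (at z)" for z
    using has_derivative_mult_right[OF entire_has_derivative[OF assms], of c]
    by (simp add: sum_distrib_left mult_ac)
  then show "entire (\<lambda>z. c * f z)" "d_z k (\<lambda>z. c * f z) z = c * d_z k f z"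
    by (rule entireI)+
qed

lemma entire_add:
  assumes "entire f" "entire g"
  shows "entire (\<lambda>z. f z + g z)" "d_z k (\<lambda>z. f z + g z) z = d_z k f z + d_z k g z"
proof -
  have "((\<lambda>z. f z + g z) has_derivative (\<lambda>v. \<Sum>k\<in>UNIV. v $ k * (d_z k f z + d_z k g z))) (at z)" for z
    using has_derivative_add[OF entire_has_derivative[OF assms(1)] entire_has_derivative[OF assms(2)]]
    by (simp add: sum.distrib algebra_simps)
  then show "entire (\<lambda>z. f z + g z)" "d_z k (\<lambda>z. f z + g z) z = d_z k f z + d_z k g z"
    by (rule entireI)+
qed

lemma entire_diff:
  assumes "entire f" "entire g"
  shows "entire (\<lambda>z. f z - g z)" "d_z k (\<lambda>z. f z - g z) z = d_z k f z - d_z k g z"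
  using entire_add[OF assms(1) entire_cmult(1)[OF assms(2), of "-1"]] entire_cmult(2)[OF assms(2), of k "-1"]
  by auto

lemma entire_shift:
  assumes "entire f"
  shows "entire (\<lambda>z. f (a + z))" "d_z k (\<lambda>z. f (a + z)) z = d_z k f (a + z)"
proof -
  have "((\<lambda>z. f (a + z)) has_derivative (\<lambda>v. \<Sum>k\<in>UNIV. v $ k * d_z k f (a + z))) (at z)" for z
    by (rule has_derivative_compose[OF _ entire_has_derivative[OF assms]])
       (auto intro!: derivative_eq_intros)
  then show "entire (\<lambda>z. f (a + z))" "d_z k (\<lambda>z. f (a + z)) z = d_z k f (a + z)"
    by (rule entireI)+
qed

section \<open>Slices in one complex variable, Cauchy estimates, holomorphy of derivatives\<close>

lemma entire_slice:
  fixes f :: "complex^'n \<Rightarrow> complex"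
  assumes "entire f"
  shows "((\<lambda>c. f (z + c *s w)) has_field_derivative (\<Sum>k\<in>UNIV. w $ k * d_z k f (z + c *s w))) (at c within S)"
proof -
  have "((\<lambda>c. c *s w) has_derivative (\<lambda>c. c *s w)) (at c within S)"
    using linear_vec_smult_left[of w] by (intro bounded_linear_imp_has_derivative) (simp add: linear_conv_bounded_linear)
  then have 1: "((\<lambda>c. z + c *s w) has_derivative (\<lambda>c. c *s w)) (at c within S)"
    using has_derivative_add[OF has_derivative_const, of _ _ _ z] by force
  have "((\<lambda>c. f (z + c *s w)) has_derivative (\<lambda>x. \<Sum>k\<in>UNIV. (x *s w) $ k * d_z k f (z + c *s w))) (at c within S)"
    by (rule has_derivative_compose[OF 1 entire_has_derivative[OF assms]])
  then show ?thesis
    unfolding has_field_derivative_def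
    by (rule has_derivative_eq_rhs) (auto simp: sum_distrib_left sum_distrib_right mult_ac)
qed

text \<open>Cauchy's inequality on the slice through \<open>z\<close> in direction
  \<open>axis k 1\<close>, a function of one complex variable. The radius is 1, so the constant is 1
  as well.\<close>

lemma entire_Cauchy_estimate:
  fixes f :: "complex^'n \<Rightarrow> complex"
  assumes f: "entire f" and B: "\<And>w. w \<in> cball z 1 \<Longrightarrow> cmod (f w) \<le> B"
  shows "cmod (d_z k f z) \<le> B"
proof -
  define g where "g = (\<lambda>c. f (z + c *s axis k 1))"
  have der: "(g has_field_derivative d_z k f (z + c *s axis k 1)) (at c within S)" for c S
    using entire_slice[OF f, of z "axis k 1" c S] unfolding g_def
    by (simp add: sum_axis_mult)
  have "norm ((deriv ^^ 1) g 0) \<le> fact 1 * B / 1 ^ 1"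
  proof (rule Cauchy_inequality)
    show "g holomorphic_on ball 0 1" unfolding holomorphic_on_def field_differentiable_def using der by blast
    show "continuous_on (cball 0 1) g" by (rule DERIV_continuous_on[OF der])
    show "cmod (g x) \<le> B" if "cmod (0 - x) = 1" for x
      unfolding g_def
    proof (rule B)
      show "z + x *s axis k 1 \<in> cball z 1"
        using that unfolding axis_cmult[symmetric] by (simp add: dist_norm norm_axis)
    qed
  qed simp
  moreover have "deriv g 0 = d_z k f z" using DERIV_imp_deriv[OF der[of 0]] by simp
  ultimately show ?thesis by simp
qed

text \<open>\<open>entire\<close> asks for no continuity of the derivative. It is gained from the
  Cauchy estimate: the change of \<open>d_z k f\<close> from \<open>z\<close> to \<open>y\<close> is
  the derivative at \<open>z\<close> of a single entire function, the difference of a translate of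
  \<open>f\<close> and \<open>f\<close>, which is small near \<open>z\<close>.\<close>

lemma continuous_on_d_z_entire:
  fixes f :: "complex^'n \<Rightarrow> complex"
  assumes f: "entire f"
  shows "continuous_on S (d_z k f)"
proof -
  have "isCont (d_z k f) z" for z
    unfolding continuous_at_eps_delta
  proof (intro allI impI)
    fix e :: real assume e: "e > 0"
    \<comment> \<open>Radius 2 leaves room for the unit ball of the Cauchy estimate and a
      translation by less than 1.\<close>
    have "uniformly_continuous_on (cball z 2) f"
      by (intro compact_uniformly_continuous entire_continuous f) simp
    then obtain d where d: "d > 0" and ud: "\<And>x y. x \<in> cball z 2 \<Longrightarrow> y \<in> cball z 2 \<Longrightarrow> dist y x < d \<Longrightarrow> dist (f y) (f x) < e/2"
      unfolding uniformly_continuous_on_def using half_gt_zero[OF e] by metis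
    have "dist (d_z k f y) (d_z k f z) < e" if y: "dist y z < min d 1" for y
    proof -
      have en: "entire (\<lambda>x. f ((y - z) + x))" using entire_shift(1)[OF f] .
      have "cmod (d_z k (\<lambda>x. f ((y - z) + x) - f x) z) \<le> e/2"
      proof (rule entire_Cauchy_estimate)
        show "entire (\<lambda>x. f ((y - z) + x) - f x)" by (rule entire_diff(1)[OF en f])
        fix w assume w: "w \<in> cball z 1"
        have n: "norm (y - z) < d" "norm (y - z) < 1" using y by (auto simp: dist_norm)
        have nw: "norm (w - z) \<le> 1" using w by (simp add: dist_norm norm_minus_commute)
        have "norm ((y - z) + w - z) \<le> 2" using norm_triangle_ineq[of "y-z" "w-z"] n nw
          by (simp add: algebra_simps)
        then have "dist (f ((y - z) + w)) (f w) < e/2"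
          using n nw by (intro ud) (auto simp: dist_norm norm_minus_commute algebra_simps)
        then show "cmod (f ((y - z) + w) - f w) \<le> e/2" by (simp add: dist_norm)
      qed
      then have "cmod (d_z k f y - d_z k f z) \<le> e/2"
        by (simp add: entire_diff(2)[OF en f] entire_shift(2)[OF f])
      then show ?thesis using e by (simp add: dist_norm)
    qed
    then show "\<exists>d>0. \<forall>x'. dist x' z < d \<longrightarrow> dist (d_z k f x') (d_z k f z) < e"
      using d by (intro exI[of _ "min d 1"]) auto
  qed
  then show ?thesis using continuous_at_imp_continuous_on by blast
qed

text \<open>Weierstrass: by the Cauchy estimate, locally uniform convergence passes to the
  derivatives, at the price of enlarging the radius by 1; then the sequence may be differentiated
  termwise.\<close>

lemma entire_uniform_limit:
  fixes f :: "nat \<Rightarrow> complex^'n \<Rightarrow> complex"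
  assumes f: "\<And>n. entire (f n)"
    and lim: "\<And>R. uniform_limit (cball 0 R) f g sequentially"
  shows "entire g"
proof -
  have "uniformly_convergent_on (cball 0 R) (\<lambda>n. d_z k (f n))" for k R
  proof (rule Cauchy_uniformly_convergent)
    show "uniformly_Cauchy_on (cball 0 R) (\<lambda>n. d_z k (f n))"
      unfolding uniformly_Cauchy_on_def
    proof (intro allI impI)
      fix e :: real assume e: "e > 0"
      have "uniformly_convergent_on (cball 0 (R+1)) f" using lim uniformly_convergent_on_def by blast
      then have "uniformly_Cauchy_on (cball 0 (R+1)) f" by (rule uniformly_convergent_Cauchy)
      then obtain M where M: "\<And>x m n. x \<in> cball 0 (R+1) \<Longrightarrow> m \<ge> M \<Longrightarrow> n \<ge> M \<Longrightarrow> dist (f m x) (f n x) < e/2"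
        unfolding uniformly_Cauchy_on_def using half_gt_zero[OF e] by metis
      have "dist (d_z k (f m) x) (d_z k (f n) x) < e" if "x \<in> cball 0 R" "m \<ge> M" "n \<ge> M" for x m n
      proof -
        have "cmod (d_z k (\<lambda>z. f m z - f n z) x) \<le> e/2"
        proof (rule entire_Cauchy_estimate)
          show "entire (\<lambda>z. f m z - f n z)" by (intro entire_diff f)
          fix w assume w: "w \<in> cball x 1"
          have "norm w \<le> norm x + norm (w - x)" by (metis add.commute diff_add_cancel norm_triangle_ineq)
          then have "w \<in> cball 0 (R+1)" using w that(1) by (auto simp: dist_norm norm_minus_commute)
          from M[OF this that(2,3)] show "cmod (f m w - f n w) \<le> e/2" by (simp add: dist_norm)
        qed
        then show ?thesis using e by (simp add: entire_diff(2)[OF f f] dist_norm)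
      qed
      then show "\<exists>M. \<forall>x\<in>cball 0 R. \<forall>m\<ge>M. \<forall>n\<ge>M. dist (d_z k (f m) x) (d_z k (f n) x) < e" by blast
    qed
  qed
  then have ex: "\<exists>l. uniform_limit (cball 0 R) (\<lambda>n. d_z k (f n)) l sequentially" for k R
    unfolding uniformly_convergent_on_def .
  define G where "G k z = lim (\<lambda>n. d_z k (f n) z)" for k z
  have uG: "uniform_limit (cball 0 R) (\<lambda>n. d_z k (f n)) (G k) sequentially" for k R
  proof -
    obtain l where l: "uniform_limit (cball 0 R) (\<lambda>n. d_z k (f n)) l sequentially" using ex by blast
    have "l z = G k z" if "z \<in> cball 0 R" for z
      unfolding G_def using tendsto_uniform_limitI[OF l that] limI by metis
    then show ?thesis using l uniform_limit_cong'[of "cball 0 R" "\<lambda>n. d_z k (f n)" "\<lambda>n. d_z k (f n)" l "G k"]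
      by metis
  qed
  have "(g has_derivative (\<lambda>v. \<Sum>k\<in>UNIV. v $ k * G k z)) (at z)" for z
  proof -
    define S where "S = ball (0::complex^'n) (norm z + 1)"
    have zS: "z \<in> S" "open S" "convex S" by (auto simp: S_def)
    have nle: "\<forall>\<^sub>F n in sequentially. \<forall>x\<in>S. \<forall>h. norm ((\<Sum>k\<in>UNIV. h $ k * d_z k (f n) x) - (\<Sum>k\<in>UNIV. h $ k * G k x)) \<le> e * norm h"
      if e: "e > 0" for e
    proof -
      \<comment> \<open>The derivative is a sum over the coordinates, so each gets an equal share of
        the error.\<close>
      define e' where "e' = e / (real CARD('n))"
      have e': "e' > 0" using e by (simp add: e'_def)
      have "\<forall>\<^sub>F n in sequentially. \<forall>k\<in>UNIV. \<forall>x\<in>cball 0 (norm z + 1). dist (d_z k (f n) x) (G k x) < e'"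
        by (rule eventually_ball_finite) (use uG e' in \<open>auto simp: uniform_limit_iff\<close>)
      then show ?thesis
      proof eventually_elim
        case (elim n)
        show ?case
        proof (intro ballI allI)
          fix x h assume "x \<in> S"
          have "norm ((\<Sum>k\<in>UNIV. h $ k * d_z k (f n) x) - (\<Sum>k\<in>UNIV. h $ k * G k x)) =
             norm (\<Sum>k\<in>UNIV. h $ k * (d_z k (f n) x - G k x))"
            by (simp add: sum_subtractf algebra_simps)
          also have "\<dots> \<le> (\<Sum>k\<in>(UNIV::'n set). norm h * e')"
          proof (rule sum_norm_le)
            fix k
            have "cmod (d_z k (f n) x - G k x) \<le> e'" using elim \<open>x \<in> S\<close>
              by (auto simp: S_def dist_norm intro!: less_imp_le)
            then show "cmod (h $ k * (d_z k (f n) x - G k x)) \<le> norm h * e'"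
              unfolding norm_mult by (intro mult_mono Finite_Cartesian_Product.norm_nth_le) auto
          qed
          also have "\<dots> = e * norm h" by (simp add: e'_def)
          finally show "norm ((\<Sum>k\<in>UNIV. h $ k * d_z k (f n) x) - (\<Sum>k\<in>UNIV. h $ k * G k x)) \<le> e * norm h" .
        qed
      qed
    qed
    have lz: "(\<lambda>n. f n x) \<longlonglongrightarrow> g x" for x
      using tendsto_uniform_limitI[OF lim[of "norm x"], of x] by simp
    have "\<exists>g2. \<forall>x\<in>S. (\<lambda>n. f n x) \<longlonglongrightarrow> g2 x \<and>
        (g2 has_derivative (\<lambda>v. \<Sum>k\<in>UNIV. v $ k * G k x)) (at x within S)"
    proof (rule has_derivative_sequence[OF zS(3)])
      show "(f n has_derivative (\<lambda>v. \<Sum>k\<in>UNIV. v $ k * d_z k (f n) x)) (at x within S)" for n x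
        by (rule has_derivative_at_withinI[OF entire_has_derivative[OF f]])
      show "\<forall>\<^sub>F n in sequentially. \<forall>x\<in>S. \<forall>h. norm ((\<Sum>k\<in>UNIV. h $ k * d_z k (f n) x) - (\<Sum>k\<in>UNIV. h $ k * G k x)) \<le> e * norm h"
        if "e > 0" for e by (rule nle[OF that])
    qed (rule zS(1), rule lz)
    then obtain g2 where g2: "\<And>x. x \<in> S \<Longrightarrow> (\<lambda>n. f n x) \<longlonglongrightarrow> g2 x"
       "\<And>x. x \<in> S \<Longrightarrow> (g2 has_derivative (\<lambda>v. \<Sum>k\<in>UNIV. v $ k * G k x)) (at x within S)"
      by blast
    have eq: "g2 x = g x" if "x \<in> S" for x using g2(1)[OF that] lz LIMSEQ_unique by blast
    have "(g2 has_derivative (\<lambda>v. \<Sum>k\<in>UNIV. v $ k * G k z)) (at z)"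
      using g2(2)[OF zS(1)] unfolding at_within_open[OF zS(1,2)] .
    then show ?thesis
      by (rule has_derivative_transform_within_open[OF _ zS(2,1)]) (simp add: eq)
  qed
  then show ?thesis by (rule entireI(1))
qed

text \<open>Difference quotients in a fixed direction are entire and converge locally uniformly to
  \<open>d_z k f\<close>.\<close>

lemma entire_d_z:
  fixes f :: "complex^'n \<Rightarrow> complex"
  assumes f: "entire f"
  shows "entire (d_z k f)"
proof (rule entire_uniform_limit)
  let ?q = "\<lambda>n z. of_nat (Suc n) * (f (inverse (of_nat (Suc n)) *s axis k 1 + z) - f z)"
  show "entire (?q n)" for n by (intro entire_cmult entire_diff entire_shift f)
  show "uniform_limit (cball 0 R) ?q (d_z k f) sequentially" for R
    unfolding uniform_limit_iff
  proof (intro allI impI)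
    fix e :: real assume e: "e > 0"
    have "uniformly_continuous_on (cball 0 (R+1)) (d_z k f)"
      by (intro compact_uniformly_continuous continuous_on_d_z_entire f) simp
    then obtain d where d: "d > 0" and ud: "\<And>x y. x \<in> cball 0 (R+1) \<Longrightarrow> y \<in> cball 0 (R+1) \<Longrightarrow> dist y x < d \<Longrightarrow> dist (d_z k f y) (d_z k f x) < e/2"
      unfolding uniformly_continuous_on_def using half_gt_zero[OF e] by metis
    have "\<forall>\<^sub>F n in sequentially. inverse (real (Suc n)) < min d 1"
      using LIMSEQ_inverse_real_of_nat d by (intro order_tendstoD) auto
    then show "\<forall>\<^sub>F n in sequentially. \<forall>x\<in>cball 0 R. dist (?q n x) (d_z k f x) < e"
    proof eventually_elim
      case (elim n)
      show ?case
      proof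
        fix x :: "complex^'n" assume x: "x \<in> cball 0 R"
        define t where "t = (inverse (of_nat (Suc n)) :: complex)"
        have nt: "cmod t < min d 1" "t \<noteq> 0" and tn: "of_nat (Suc n) * t = 1"
          using elim unfolding t_def by (auto simp del: of_nat_Suc simp: norm_inverse)
        \<comment> \<open>Subtracting the linear part makes the derivative of \<open>g\<close> the
          oscillation of \<open>d_z k f\<close> on a small disc, which uniform continuity bounds by
          \<open>e/2\<close>.\<close>
        define g where "g = (\<lambda>c. f (x + c *s axis k 1) - c * d_z k f x)"
        have "norm (g t - g 0) \<le> e/2 * norm (t - 0)"
        proof (rule field_differentiable_bound)
          show "(g has_field_derivative (d_z k f (x + c *s axis k 1) - d_z k f x)) (at c within cball 0 (cmod t))" for c
            using entire_slice[OF f, of x "axis k 1" c "cball 0 (cmod t)"] unfolding g_def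
            by (auto intro!: derivative_eq_intros simp: sum_axis_mult)
          show "norm (d_z k f (x + c *s axis k 1) - d_z k f x) \<le> e/2" if "c \<in> cball 0 (cmod t)" for c
          proof -
            have n: "norm (c *s axis k 1 :: complex^'n) = cmod c"
              unfolding axis_cmult[symmetric] by (simp add: norm_axis)
            have "norm (x + c *s axis k 1) \<le> R + 1"
              using norm_triangle_ineq[of x "c *s axis k 1"] that nt x n by auto
            moreover have "dist (x + c *s axis k 1) x < d" using n that nt by (simp add: dist_norm)
            ultimately have "dist (d_z k f (x + c *s axis k 1)) (d_z k f x) < e/2"
              using x by (intro ud) auto
            then show ?thesis by (simp add: dist_norm)
          qed
        qed auto
        then have "cmod (f (x + t *s axis k 1) - f x - t * d_z k f x) \<le> e/2 * cmod t"
          by (simp add: g_def algebra_simps)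
        then have "cmod (of_nat (Suc n)) * cmod (f (x + t *s axis k 1) - f x - t * d_z k f x) \<le> e/2 * (cmod (of_nat (Suc n)) * cmod t)"
          by (metis (no_types, opaque_lifting) mult.left_commute mult_left_mono norm_ge_zero)
        then have "cmod (of_nat (Suc n) * (f (x + t *s axis k 1) - f x) - of_nat (Suc n) * t * d_z k f x) \<le> e/2 * cmod (of_nat (Suc n) * t)"
          unfolding norm_mult[symmetric] by (simp add: algebra_simps)
        then have "cmod (of_nat (Suc n) * (f (x + t *s axis k 1) - f x) - d_z k f x) \<le> e/2"
          unfolding tn by simp
        then show "dist (?q n x) (d_z k f x) < e" using e
          unfolding dist_norm t_def[symmetric] by (simp add: add.commute del: of_nat_Suc)
      qed
    qed
  qed
qed

section \<open>Integration by parts\<close>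

lemma integrable_compact_support:
  fixes g :: "'a::euclidean_space \<Rightarrow> 'b::{banach, second_countable_topology}"
  assumes "continuous_on UNIV g" "\<And>x. norm x > R \<Longrightarrow> g x = 0"
  shows "integrable lborel g"
proof -
  have "integrable lborel (\<lambda>x. indicator (cball 0 R) x *\<^sub>R g x)"
    by (intro borel_integrable_compact continuous_on_subset[OF assms(1)]) auto
  also have "(\<lambda>x. indicator (cball 0 R) x *\<^sub>R g x) = g"
    using assms(2) by (auto simp: indicator_def)
  finally show ?thesis .
qed

lemma integrable_indicator_cball:
  "integrable lborel (indicator (cball (a::'a::euclidean_space) r) :: 'a \<Rightarrow> real)"
proof (rule integrable_real_indicator)
  show "emeasure lborel (cball a r) < \<infinity>" by (rule emeasure_bounded_finite[OF bounded_cball])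
qed simp

lemma lborel_integral_translate:
  fixes g :: "'a::euclidean_space \<Rightarrow> 'b::{banach, second_countable_topology}"
  assumes [measurable]: "g \<in> borel_measurable borel"
  shows "(LINT x|lborel. g (c + x)) = (LINT x|lborel. g x)"
proof -
  have "(LINT x|lborel. g x) = (LINT x|distr lborel borel ((+) c). g x)"
    by (simp add: lborel_distr_plus)
  also have "\<dots> = (LINT x|lborel. g (c + x))"
    by (subst integral_distr) auto
  finally show ?thesis by simp
qed

lemma C_k_1I:
  assumes "\<And>x. (f has_derivative D x) (at x)" "\<And>v. continuous_on UNIV (\<lambda>x. D x v)"
  shows "C_k 1 f"
proof -
  have "frechet_derivative f (at x) = D x" for x
    using frechet_derivative_at[OF assms(1)] by simp
  then show ?thesis using assms by (auto simp: differentiable_def)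
qed

lemma C_k_1D:
  assumes "C_k 1 f"
  shows "f differentiable (at x)" "(f has_derivative frechet_derivative f (at x)) (at x)"
    "continuous_on S (\<lambda>x. frechet_derivative f (at x) v)" "continuous_on S f"
proof -
  show d: "f differentiable (at x)" for x using assms by simp
  then show "(f has_derivative frechet_derivative f (at x)) (at x)"
    using frechet_derivative_works by blast
  show "continuous_on S (\<lambda>x. frechet_derivative f (at x) v)"
  proof (rule continuous_on_subset[OF _ subset_UNIV])
    show "continuous_on UNIV (\<lambda>x. frechet_derivative f (at x) v)" using assms by simp
  qed
  show "continuous_on S f"
    by (intro continuous_at_imp_continuous_on ballI differentiable_imp_continuous_within d)
qed

text \<open>Translation invariance makes every difference quotient of \<open>g\<close> integrate to
  0, and dominated convergence carries this to the derivative. It plays the role of the divergence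
  theorem in all integrations by parts below.\<close>

lemma integral_frechet_derivative_zero:
  fixes g :: "'a::euclidean_space \<Rightarrow> 'b::euclidean_space"
  assumes C: "C_k 1 g" and z: "\<And>x. norm x > R \<Longrightarrow> g x = 0"
  shows "integrable lborel (\<lambda>x. frechet_derivative g (at x) v)"
    and "(LINT x|lborel. frechet_derivative g (at x) v) = 0"
proof -
  let ?D = "\<lambda>x. frechet_derivative g (at x) v"
  note cD = C_k_1D(3)[OF C] and cg = C_k_1D(4)[OF C]
  have zD: "?D x = 0" if "norm x > R" for x
  proof -
    have op: "open {x::'a. norm x > R}" by (intro open_Collect_less continuous_intros)
    have "(g has_derivative (\<lambda>_. 0)) (at x)"
      by (rule has_derivative_transform_within_open[OF has_derivative_const op]) (use that z in auto)
    then show ?thesis using frechet_derivative_at[OF \<open>(g has_derivative (\<lambda>_. 0)) (at x)\<close>, symmetric] by simp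
  qed
  show intD: "integrable lborel ?D" by (rule integrable_compact_support[OF cD zD])
  have intg: "integrable lborel g" by (rule integrable_compact_support[OF cg z])
  then have [measurable]: "g \<in> borel_measurable borel" by auto
  have "compact (?D ` cball 0 R)" by (intro compact_continuous_image cD) auto
  then have "bounded (?D ` cball 0 R)" by (rule compact_imp_bounded)
  then obtain M0 where "\<forall>y\<in>?D ` cball 0 R. norm y \<le> M0" unfolding bounded_iff by blast
  then have M0: "\<And>x. norm x \<le> R \<Longrightarrow> norm (?D x) \<le> M0" by simp
  define M where "M = max M0 0"
  have M: "norm (?D x) \<le> M" for x
    using M0[of x] zD[of x] by (cases "norm x \<le> R") (auto simp: M_def)
  define t where "t n = inverse (real (Suc n))" for n
  have t: "0 < t n" "t n \<le> 1" for n by (auto simp: t_def field_simps)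
  have t0: "t \<longlonglongrightarrow> 0" unfolding t_def by (rule LIMSEQ_inverse_real_of_nat)
  define q where "q n x = inverse (t n) *\<^sub>R (g (t n *\<^sub>R v + x) - g x)" for n x
  have vd: "((\<lambda>s. g (s *\<^sub>R v + x)) has_vector_derivative ?D (s *\<^sub>R v + x)) (at s within T)" for s x T
  proof -
    have "((\<lambda>s. g (s *\<^sub>R v + x)) has_derivative (\<lambda>h. frechet_derivative g (at (s *\<^sub>R v + x)) (h *\<^sub>R v))) (at s within T)"
      by (rule has_derivative_compose[OF _ C_k_1D(2)[OF C]]) (auto intro!: derivative_eq_intros)
    then show ?thesis unfolding has_vector_derivative_def
      using linear_cmul[OF has_derivative_linear[OF C_k_1D(2)[OF C]]] by simp
  qed
  have q0: "(LINT x|lborel. q n x) = 0" for n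
  proof -
    have "integrable lborel (\<lambda>x. g (t n *\<^sub>R v + x))"
    proof (rule integrable_compact_support)
      show "continuous_on UNIV (\<lambda>x. g (t n *\<^sub>R v + x))"
        by (rule continuous_on_compose2[OF cg]) (auto intro!: continuous_intros)
      fix x :: 'a assume "norm x > R + norm (t n *\<^sub>R v)"
      moreover have "norm x - norm (t n *\<^sub>R v) \<le> norm (x + t n *\<^sub>R v)" by (rule norm_diff_ineq)
      ultimately show "g (t n *\<^sub>R v + x) = 0" by (intro z) (simp add: add.commute)
    qed
    then show ?thesis unfolding q_def
      by (simp add: intg lborel_integral_translate)
  qed
  \<comment> \<open>As \<open>t n \<le> 1\<close>, the translated support stays within radius
    \<open>R + norm v\<close>, where the mean value inequality bounds the quotient by
    \<open>M\<close> for every \<open>n\<close>.\<close>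
  have qb: "norm (q n x) \<le> M * indicator (cball 0 (R + norm v)) x" for n x
  proof (cases "norm x \<le> R + norm v")
    case True
    have "norm (g (t n *\<^sub>R v + x) - g (0 *\<^sub>R v + x)) \<le> M * norm (t n - 0)"
    proof (rule differentiable_bound[where S=UNIV])
      show "((\<lambda>s. g (s *\<^sub>R v + x)) has_derivative (\<lambda>h. h *\<^sub>R ?D (s *\<^sub>R v + x))) (at s within UNIV)" for s
        by (rule vd[unfolded has_vector_derivative_def])
      show "onorm (\<lambda>h. h *\<^sub>R ?D (s *\<^sub>R v + x)) \<le> M" for s
      proof (rule onorm_bound)
        show "norm (h *\<^sub>R ?D (s *\<^sub>R v + x)) \<le> M * norm h" for h
          using mult_left_mono[OF M, of "norm h"] by (simp add: mult.commute)
      qed (simp add: M_def)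
    qed auto
    then show ?thesis using True t(1)[of n]
      by (auto simp: q_def divide_simps mult.commute)
  next
    case False
    have "norm (t n *\<^sub>R v) \<le> norm v" using t[of n] by (simp add: mult_left_le_one_le)
    moreover have "norm x - norm (t n *\<^sub>R v) \<le> norm (t n *\<^sub>R v + x)"
      by (metis add.commute norm_diff_ineq)
    ultimately have "norm (t n *\<^sub>R v + x) > R" using False by linarith
    moreover have "norm x > R" using False by (smt (verit) norm_ge_zero)
    ultimately show ?thesis using False by (simp add: q_def z)
  qed
  have ql: "(\<lambda>n. q n x) \<longlonglongrightarrow> ?D x" for x
  proof -
    have "(\<lambda>h. norm (g (h *\<^sub>R v + x) - g x - h *\<^sub>R ?D x) / norm h) \<midarrow>0\<rightarrow> 0"
      using vd[of x 0 UNIV] unfolding has_vector_derivative_def has_derivative_at by simp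
    then have "(\<lambda>n. norm (g (t n *\<^sub>R v + x) - g x - t n *\<^sub>R ?D x) / norm (t n)) \<longlonglongrightarrow> 0"
      using t0 less_imp_neq[OF t(1), symmetric] unfolding tendsto_at_iff_sequentially comp_def
      by simp
    moreover have "norm (g (t n *\<^sub>R v + x) - g x - t n *\<^sub>R ?D x) / norm (t n) = norm (q n x - ?D x)" for n
    proof -
      have "q n x - ?D x = inverse (t n) *\<^sub>R (g (t n *\<^sub>R v + x) - g x - t n *\<^sub>R ?D x)"
        using t(1)[of n] by (simp add: q_def scaleR_diff_right)
      then show ?thesis using t(1)[of n] by (simp add: divide_inverse mult.commute)
    qed
    ultimately have "(\<lambda>n. norm (q n x - ?D x)) \<longlonglongrightarrow> 0" by simp
    then show ?thesis by (rule LIM_zero_cancel[OF tendsto_norm_zero_cancel])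
  qed
  have "(\<lambda>n. LINT x|lborel. q n x) \<longlonglongrightarrow> (LINT x|lborel. ?D x)"
  proof (rule integral_dominated_convergence[where w="\<lambda>x. M * indicator (cball 0 (R + norm v)) x"])
    show "?D \<in> borel_measurable lborel" using intD by auto
    show "q n \<in> borel_measurable lborel" for n unfolding q_def by measurable
    show "integrable lborel (\<lambda>x. M * indicator (cball 0 (R + norm v)) x :: real)"
      by (intro integrable_mult_right integrable_indicator_cball)
  qed (use ql qb in auto)
  then show "(LINT x|lborel. ?D x) = 0"
    unfolding q0 using LIMSEQ_unique tendsto_const by blast
qed

section \<open>Product and chain rules for Wirtinger derivatives\<close>

lemma frechet_derivative_mult:
  fixes f g :: "'a::real_normed_vector \<Rightarrow> 'b::real_normed_algebra"
  assumes "f differentiable (at x)" "g differentiable (at x)"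
  shows "frechet_derivative (\<lambda>x. f x * g x) (at x) v =
    f x * frechet_derivative g (at x) v + frechet_derivative f (at x) v * g x"
  using frechet_derivative_at[OF has_derivative_mult[OF assms[THEN frechet_derivative_works[THEN iffD1]]], symmetric]
  by simp

lemma C_k_1_mult:
  fixes f g :: "'a::real_normed_vector \<Rightarrow> 'b::real_normed_algebra"
  assumes "C_k 1 f" "C_k 1 g" shows "C_k 1 (\<lambda>x. f x * g x)"
  by (rule C_k_1I[OF has_derivative_mult[OF C_k_1D(2)[OF assms(1)] C_k_1D(2)[OF assms(2)]]])
     (intro continuous_intros C_k_1D assms)

lemma d_z_mult:
  assumes "f differentiable (at z)" "g differentiable (at z)"
  shows "d_z k (\<lambda>z. f z * g z) z = d_z k f z * g z + f z * d_z k g z"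
    "d_zbar k (\<lambda>z. f z * g z) z = d_zbar k f z * g z + f z * d_zbar k g z"
  unfolding d_z_def d_zbar_def frechet_derivative_mult[OF assms] by (simp_all add: field_simps)

lemma frechet_derivative_bounded_linear_compose:
  assumes "bounded_linear L" "f differentiable (at x)"
  shows "frechet_derivative (\<lambda>x. L (f x)) (at x) v = L (frechet_derivative f (at x) v)"
  using frechet_derivative_at[OF bounded_linear.has_derivative[OF assms(1) assms(2)[THEN frechet_derivative_works[THEN iffD1]]], symmetric]
  by simp

lemma C_k_1_bounded_linear_compose:
  assumes "bounded_linear L" "C_k 1 f" shows "C_k 1 (\<lambda>x. L (f x))"
  by (rule C_k_1I[OF bounded_linear.has_derivative[OF assms(1) C_k_1D(2)[OF assms(2)]]])
     (intro continuous_on_compose2[OF linear_continuous_on[OF assms(1), of UNIV]] C_k_1D assms, auto)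

lemma C_k_1_of_real:
  fixes f :: "'a::real_normed_vector \<Rightarrow> real"
  shows "C_k 1 f \<Longrightarrow> C_k 1 (\<lambda>x. complex_of_real (f x))"
  by (rule C_k_1_bounded_linear_compose[OF bounded_linear_of_real])

lemma C_k_1_cnj:
  shows "C_k 1 f \<Longrightarrow> C_k 1 (\<lambda>x. cnj (f x))"
  by (rule C_k_1_bounded_linear_compose[OF bounded_linear_cnj])

lemma d_z_cnj:
  assumes "f differentiable (at z)"
  shows "d_z k (\<lambda>z. cnj (f z)) z = cnj (d_zbar k f z)"
    "d_zbar k (\<lambda>z. cnj (f z)) z = cnj (d_z k f z)"
  unfolding d_z_def d_zbar_def frechet_derivative_bounded_linear_compose[OF bounded_linear_cnj assms]
  by simp_all

lemma d_z_of_real: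
  assumes "f differentiable (at z)"
  shows "cnj (d_zbar k (\<lambda>z. complex_of_real (f z)) z) = d_z k (\<lambda>z. complex_of_real (f z)) z"
  unfolding d_z_def d_zbar_def frechet_derivative_bounded_linear_compose[OF bounded_linear_of_real assms]
  by simp

lemma C_k_1_entire:
  assumes "entire f" shows "C_k 1 f"
  by (rule C_k_1I[OF entire_has_derivative[OF assms]])
     (intro continuous_intros continuous_on_d_z_entire assms)

lemma integral_d_z_zero:
  fixes g :: "complex^'n \<Rightarrow> complex"
  assumes C: "C_k 1 g" and z: "\<And>x. norm x > R \<Longrightarrow> g x = 0"
  shows "integrable lborel (d_z k g)" "(LINT x|lborel. d_z k g x) = 0"
    "integrable lborel (d_zbar k g)" "(LINT x|lborel. d_zbar k g x) = 0"
  using integral_frechet_derivative_zero[OF C z]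
  unfolding d_z_def[abs_def] d_zbar_def[abs_def] by simp_all

lemma weight_derivative:
  fixes \<phi> :: "complex^'n \<Rightarrow> real"
  assumes "C_k 1 \<phi>"
  shows "C_k 1 (\<lambda>z. complex_of_real (exp (- \<phi> z)))"
    "d_z k (\<lambda>z. complex_of_real (exp (- \<phi> z))) z = - d_z k (\<lambda>z. complex_of_real (\<phi> z)) z * of_real (exp (- \<phi> z))"
    "d_zbar k (\<lambda>z. complex_of_real (exp (- \<phi> z))) z = - d_zbar k (\<lambda>z. complex_of_real (\<phi> z)) z * of_real (exp (- \<phi> z))"
proof -
  have d: "((\<lambda>z. exp (- \<phi> z)) has_derivative (\<lambda>v. - frechet_derivative \<phi> (at z) v * exp (- \<phi> z))) (at z)" for z
    by (auto intro!: derivative_eq_intros C_k_1D(2)[OF assms])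
  have "C_k 1 (\<lambda>z. exp (- \<phi> z))"
    by (rule C_k_1I[OF d]) (intro continuous_intros C_k_1D assms)
  then show "C_k 1 (\<lambda>z. complex_of_real (exp (- \<phi> z)))" by (rule C_k_1_of_real)
  have diff: "(\<lambda>z. exp (- \<phi> z)) differentiable (at z)" "\<phi> differentiable (at z)" for z
    using d C_k_1D[OF assms] unfolding differentiable_def by blast+
  have "frechet_derivative (\<lambda>z. exp (- \<phi> z)) (at z) = (\<lambda>v. - frechet_derivative \<phi> (at z) v * exp (- \<phi> z))" for z
    using frechet_derivative_at[OF d] by simp
  then show "d_z k (\<lambda>z. complex_of_real (exp (- \<phi> z))) z = - d_z k (\<lambda>z. complex_of_real (\<phi> z)) z * of_real (exp (- \<phi> z))"
    "d_zbar k (\<lambda>z. complex_of_real (exp (- \<phi> z))) z = - d_zbar k (\<lambda>z. complex_of_real (\<phi> z)) z * of_real (exp (- \<phi> z))"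
    unfolding d_z_def d_zbar_def
      frechet_derivative_bounded_linear_compose[OF bounded_linear_of_real diff(1)]
      frechet_derivative_bounded_linear_compose[OF bounded_linear_of_real diff(2)]
    by (simp_all add: field_simps)
qed

text \<open>Explicit radial cutoffs: for \<open>m > 0\<close>, exponent \<open>m + 1\<close> gives a
  C^1 function, and differentiation lowers the exponent to \<open>m\<close>. Thus
  \<open>bump 1\<close> is both the square root of \<open>bump 2\<close> and the factor in its
  derivative, and \<open>bump 2\<close> is the factor in the derivative of
  \<open>bump 3\<close>.\<close>

definition bump :: "nat \<Rightarrow> real \<Rightarrow> 'a::real_inner \<Rightarrow> real" where
  "bump m R z = max 0 (1 - (z \<bullet> z) / R\<^sup>2) ^ m"

lemma DERIV_max_power:
  assumes "m > 0"
  shows "((\<lambda>s. max 0 s ^ Suc m) has_real_derivative real (Suc m) * max 0 s ^ m) (at s)"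
proof -
  consider "s > 0" | "s < 0" | "s = 0" by linarith
  then show ?thesis
  proof cases
    case 1
    have "((\<lambda>s. s ^ Suc m) has_real_derivative real (Suc m) * max 0 s ^ m) (at s)"
      using 1 DERIV_pow[of "Suc m" s UNIV] by simp
    then show ?thesis
      by (rule has_field_derivative_transform_within_open[where S="{0<..}"]) (use 1 in auto)
  next
    case 2
    have "((\<lambda>s. 0) has_real_derivative real (Suc m) * max 0 s ^ m) (at s)"
      using 2 assms by (simp add: zero_power)
    then show ?thesis
      by (rule has_field_derivative_transform_within_open[where S="{..<0}"]) (use 2 in auto)
  next
    case 3
    have "((\<lambda>h. max 0 h ^ m :: real) \<longlongrightarrow> max 0 0 ^ m) (at 0)"
      by (intro tendsto_intros)
    moreover have "max 0 0 ^ m = (0::real)" using assms by (simp add: zero_power)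
    ultimately have l: "((\<lambda>h. max 0 h ^ m :: real) \<longlongrightarrow> 0) (at 0)" by metis
    \<comment> \<open>At 0 the quotient is \<open>h ^ m\<close> or 0, and \<open>m > 0\<close> makes
      it vanish in the limit.\<close>
    have "((\<lambda>h. (max 0 (s + h) ^ Suc m - max 0 s ^ Suc m) / h) \<longlongrightarrow> 0) (at 0)"
      by (rule Lim_null_comparison[OF _ l]) (auto simp: 3 eventually_at_filter max_def)
    then show ?thesis using 3 assms by (simp only: DERIV_def) (simp add: zero_power)
  qed
qed

lemma bump_range: "0 \<le> bump m R z" "bump m R z \<le> 1"
  by (auto simp: bump_def power_le_one)

lemma bump_zero: "R > 0 \<Longrightarrow> m > 0 \<Longrightarrow> norm z > R \<Longrightarrow> bump m R z = 0"
  by (simp add: bump_def dot_square_norm max_def field_simps)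

lemma bump_has_derivative:
  assumes "m > 0"
  shows "(bump (Suc m) R has_derivative (\<lambda>v. - (2 * (real (Suc m) * bump m R z * (z \<bullet> v) / R\<^sup>2)))) (at z)"
proof -
  have "((\<lambda>z. 1 - (z \<bullet> z) / R\<^sup>2) has_derivative (\<lambda>v. - (2 * (z \<bullet> v) / R\<^sup>2))) (at z)"
    unfolding divide_inverse
    by (auto intro!: derivative_eq_intros simp: inner_commute algebra_simps)
  from has_derivative_compose[OF this DERIV_max_power[OF assms, unfolded has_field_derivative_def]]
  show ?thesis unfolding bump_def[abs_def]
    by (rule has_derivative_eq_rhs) (auto simp: algebra_simps add_divide_distrib)
qed

lemma continuous_on_bump: "continuous_on S (bump m R)"
  unfolding bump_def[abs_def] divide_inverse by (intro continuous_intros)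

lemma C_k_1_bump: "m > 0 \<Longrightarrow> C_k 1 (bump (Suc m) R)"
  by (rule C_k_1I[OF bump_has_derivative])
     (auto simp: divide_inverse intro!: continuous_intros continuous_on_bump)

text \<open>The factor \<open>z $ k\<close> is the conjugate derivative of the squared norm; thanks
  to it, the first moments of \<open>bump 2 1\<close> against entire functions are integrals of
  derivatives.\<close>

lemma d_zbar_bump:
  assumes "m > 0"
  shows "d_zbar k (\<lambda>z. complex_of_real (bump (Suc m) R z)) z = - of_nat (Suc m) * of_real (bump m R z) * z $ k / of_real (R\<^sup>2)"
    and "d_z k (\<lambda>z. complex_of_real (bump (Suc m) R z)) z = - of_nat (Suc m) * of_real (bump m R z) * cnj (z $ k) / of_real (R\<^sup>2)"
proof -
  have diff: "bump (Suc m) R differentiable (at z)" using bump_has_derivative[OF assms] differentiable_def by blast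
  have "frechet_derivative (bump (Suc m) R) (at z) = (\<lambda>v. - (2 * (real (Suc m) * bump m R z * (z \<bullet> v) / R\<^sup>2)))"
    using frechet_derivative_at[OF bump_has_derivative[OF assms], symmetric] .
  then have fr: "frechet_derivative (\<lambda>z. complex_of_real (bump (Suc m) R z)) (at z) v =
      of_real (- (2 * (real (Suc m) * bump m R z * (z \<bullet> v) / R\<^sup>2)))" for v
    by (simp only: frechet_derivative_bounded_linear_compose[OF bounded_linear_of_real diff])
  have ip: "z \<bullet> axis k 1 = Re (z $ k)" "z \<bullet> axis k \<i> = Im (z $ k)"
    by (simp_all add: inner_axis inner_complex_def)
  show 1: "d_zbar k (\<lambda>z. complex_of_real (bump (Suc m) R z)) z = - of_nat (Suc m) * of_real (bump m R z) * z $ k / of_real (R\<^sup>2)"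
  proof -
    have half: "(complex_of_real (- (2 * a)) + \<i> * complex_of_real (- (2 * b))) / 2 = - (of_real a + \<i> * of_real b)" for a b
      by simp
    have "complex_of_real (a * b * x / r) + \<i> * complex_of_real (a * b * y / r) =
        of_real a * of_real b * (of_real x + \<i> * of_real y) / complex_of_real r" for a b x y r
      unfolding of_real_mult of_real_divide divide_inverse of_real_inverse by algebra
    from this[of "real (Suc m)" "bump m R z" "Re (z $ k)" "R\<^sup>2" "Im (z $ k)"] show ?thesis
      unfolding d_zbar_def fr ip complex_eq[symmetric] half of_real_of_nat_eq by (simp del: of_nat_Suc)
  qed
  show "d_z k (\<lambda>z. complex_of_real (bump (Suc m) R z)) z = - of_nat (Suc m) * of_real (bump m R z) * cnj (z $ k) / of_real (R\<^sup>2)"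
    unfolding d_z_of_real[OF diff, symmetric] 1 by simp
qed

section \<open>Mean values of entire functions\<close>

lemma entire_affine:
  assumes "entire f"
  shows "entire (\<lambda>w. f (a + t *\<^sub>R w))"
proof (rule entireI(1))
  fix z
  have "((\<lambda>w. a + t *\<^sub>R w) has_derivative (\<lambda>v. t *\<^sub>R v)) (at z)"
    by (auto intro!: derivative_eq_intros)
  from has_derivative_compose[OF this entire_has_derivative[OF assms]]
  show "((\<lambda>w. f (a + t *\<^sub>R w)) has_derivative (\<lambda>v. \<Sum>k\<in>UNIV. v $ k * (t *\<^sub>R d_z k f (a + t *\<^sub>R z)))) (at z)"
    by (rule has_derivative_eq_rhs) simp
qed

lemma integral_bump_orthogonal:
  fixes g :: "complex^'n \<Rightarrow> complex"
  assumes g: "entire g"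
  shows "integrable lborel (\<lambda>w. of_real (bump 2 1 w) * w $ k * g w)"
    and "(LINT w|lborel. of_real (bump 2 1 w) * w $ k * g w) = 0"
proof -
  let ?h = "\<lambda>w. complex_of_real (bump 3 1 w) * g w"
  have C: "C_k 1 (\<lambda>w::complex^'n. complex_of_real (bump 3 1 w))"
    using C_k_1_of_real[OF C_k_1_bump[of 2 1]] by simp
  have h: "C_k 1 ?h" by (intro C_k_1_mult C C_k_1_entire g)
  have z: "?h w = 0" if "norm w > 1" for w using bump_zero[of 1 3 w] that by simp
  \<comment> \<open>The 3 is the exponent of \<open>bump 3 1\<close>; the entire factor
    \<open>g\<close> contributes nothing to a conjugate derivative.\<close>
  have eq: "d_zbar k ?h w = - 3 * (of_real (bump 2 1 w) * w $ k * g w)" for w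
    using d_z_mult(2)[OF C_k_1D(1)[OF C] C_k_1D(1)[OF C_k_1_entire[OF g]], of k w] d_zbar_bump(1)[where m=2 and R=1 and k=k and z=w]
    by (simp add: d_zbar_entire[OF g])
  have "integrable lborel (\<lambda>w. (-1/3) * d_zbar k ?h w)" "(LINT w|lborel. (-1/3) * d_zbar k ?h w) = 0"
    using integral_d_z_zero(3,4)[where k=k, OF h z] by simp_all
  then show "integrable lborel (\<lambda>w. of_real (bump 2 1 w) * w $ k * g w)"
    "(LINT w|lborel. of_real (bump 2 1 w) * w $ k * g w) = 0"
    unfolding eq by simp_all
qed

text \<open>Differentiation under the integral sign is done for the gauge integral over a box,
  everything else for \<open>lborel\<close>; compact support reconciles the two.\<close>

lemma integral_cbox_eq_lborel:
  fixes g :: "'a::euclidean_space \<Rightarrow> 'b::euclidean_space"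
  assumes "continuous_on UNIV g" "\<And>x. x \<notin> cbox a b \<Longrightarrow> g x = 0"
  shows "integrable lborel g" "integral (cbox a b) g = (LINT x|lborel. g x)"
proof -
  have "integrable lborel (\<lambda>x. indicator (cbox a b) x *\<^sub>R g x)"
    by (intro borel_integrable_compact continuous_on_subset[OF assms(1)]) auto
  also have eq: "(\<lambda>x. indicator (cbox a b) x *\<^sub>R g x) = g"
    using assms(2) by (auto simp: indicator_def)
  finally show int: "integrable lborel g" .
  have "integral (cbox a b) g = integral UNIV (\<lambda>x. if x \<in> cbox a b then g x else 0)"
    by (simp add: integral_restrict_UNIV)
  also have "(\<lambda>x. if x \<in> cbox a b then g x else 0) = g" using assms(2) by auto
  finally show "integral (cbox a b) g = (LINT x|lborel. g x)"
    using integral_lborel[OF int] by simp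
qed

text \<open>The mean of \<open>w \<mapsto> f (z + t w)\<close> against \<open>bump 2 1\<close> does not depend on \<open>t\<close>: the function \<open>bump 2 1 w * w\<^sub>k\<close> is up to a factor the \<open>w\<^sub>k\<close>-bar derivative of \<open>bump 3 1\<close>, so its integral against the entire function \<open>\<partial>f/\<partial>z\<^sub>k (z + t w)\<close> vanishes.\<close>

lemma entire_mean_value:
  fixes f :: "complex^'n \<Rightarrow> complex"
  assumes f: "entire f"
  shows "(LINT w|lborel. of_real (bump 2 1 w) * f (z + w)) = f z * of_real (LINT w|lborel. bump 2 1 (w::complex^'n))"
proof -
  obtain a :: "complex^'n" where a: "cball 0 1 \<subseteq> cbox (-a) a"
    using bounded_subset_cbox_symmetric[OF bounded_cball] by blast
  have out: "bump 2 1 w = 0" if "w \<notin> cbox (-a) a" for w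
  proof -
    have "norm w > 1" using that a by (metis mem_cball_0 not_le subsetD)
    then show ?thesis by (simp add: bump_zero)
  qed
  define m where "m t = integral (cbox (-a) a) (\<lambda>w. of_real (bump 2 1 w) * f (z + t *\<^sub>R w))" for t :: real
  define D where "D t w = of_real (bump 2 1 w) * (\<Sum>k\<in>UNIV. w $ k * d_z k f (z + t *\<^sub>R w))" for t :: real and w
  have cf: "continuous_on S (\<lambda>w. f (z + t *\<^sub>R w))" for S t
    by (rule entire_continuous[OF entire_affine[OF f]])
  have cint: "continuous_on S (\<lambda>w. complex_of_real (bump 2 1 w) * f (z + t *\<^sub>R w))" for S t
    by (intro continuous_intros cf continuous_on_bump)
  have "(m has_vector_derivative 0) (at t within UNIV)" for t
  proof -
    have vd: "((\<lambda>t. complex_of_real (bump 2 1 w) * f (z + t *\<^sub>R w)) has_vector_derivative D t w) (at t within UNIV)" for t w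
    proof -
      have "((\<lambda>t. z + t *\<^sub>R w) has_derivative (\<lambda>h. h *\<^sub>R w)) (at t)"
        by (auto intro!: derivative_eq_intros)
      from has_derivative_mult_right[OF has_derivative_compose[OF this entire_has_derivative[OF f]]]
      show ?thesis unfolding has_vector_derivative_def D_def
        by (rule has_derivative_eq_rhs) (simp add: scaleR_right.sum sum_distrib_left)
    qed
    have cdz: "continuous_on S (\<lambda>(t, w). d_z k f (z + t *\<^sub>R w))" for S :: "(real \<times> (complex^'n)) set" and k
      unfolding split_beta
      by (rule continuous_on_compose2[OF continuous_on_d_z_entire[OF f, of UNIV]]) (auto intro!: continuous_intros)
    have "(m has_vector_derivative integral (cbox (-a) a) (D t)) (at t within UNIV)"
      unfolding m_def
    proof (rule leibniz_rule_vector_derivative)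
      show "continuous_on (UNIV \<times> cbox (-a) a) (\<lambda>(t, w). D t w)"
        unfolding D_def split_beta using cdz[unfolded split_beta]
        by (intro continuous_intros continuous_on_compose2[OF continuous_on_bump[of UNIV], of _ snd]) auto
      show "(\<lambda>w. complex_of_real (bump 2 1 w) * f (z + t *\<^sub>R w)) integrable_on cbox (- a) a" for t
        by (intro integrable_continuous cint)
    qed (use vd in auto)
    moreover have "integral (cbox (-a) a) (D t) = 0"
    proof -
      have g: "entire (\<lambda>w. d_z k f (z + t *\<^sub>R w))" for k by (intro entire_affine entire_d_z f)
      have Deq: "D t = (\<lambda>w. \<Sum>k\<in>UNIV. of_real (bump 2 1 w) * w $ k * d_z k f (z + t *\<^sub>R w))"
        by (rule ext) (simp add: D_def sum_distrib_left mult.assoc)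
      have "integral (cbox (-a) a) (D t) = (LINT w|lborel. D t w)"
      proof (rule integral_cbox_eq_lborel(2))
        show "continuous_on UNIV (D t)" unfolding Deq
          by (intro continuous_intros continuous_on_bump entire_continuous[OF g])
      qed (simp add: D_def out)
      also have "\<dots> = 0" unfolding Deq
        by (subst Bochner_Integration.integral_sum) (use integral_bump_orthogonal[OF g] in auto)
      finally show ?thesis .
    qed
    ultimately show ?thesis by simp
  qed
  then obtain c where "\<And>t. m t = c"
    using has_vector_derivative_zero_constant[of UNIV m] by auto
  then have "m 1 = m 0" by simp
  moreover have "m 1 = (LINT w|lborel. of_real (bump 2 1 w) * f (z + w))"
    unfolding m_def by (subst integral_cbox_eq_lborel(2)[OF cint]) (auto simp: out)
  moreover have "m 0 = f z * of_real (LINT w|lborel. bump 2 1 (w::complex^'n))"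
  proof -
    have "m 0 = (LINT w|lborel. of_real (bump 2 1 (w::complex^'n)) * f (z + 0 *\<^sub>R w))"
      unfolding m_def by (subst integral_cbox_eq_lborel(2)[OF cint]) (auto simp: out)
    then show ?thesis by (simp add: mult.commute)
  qed
  ultimately show ?thesis by simp
qed

lemma integrable_bump: "m > 0 \<Longrightarrow> R > 0 \<Longrightarrow> integrable lborel (bump m R :: 'a::euclidean_space \<Rightarrow> real)"
  by (rule integrable_compact_support[of _ R]) (auto intro: continuous_on_bump bump_zero)

lemma integral_bump_pos: "(LINT w|lborel. bump 2 1 (w::'a::euclidean_space)) > 0"
proof -
  \<comment> \<open>On the ball of radius 1/2 the bump is at least
    \<open>(1 - 1/4)\<^sup>2 = 9/16\<close>.\<close>
  have "0 < 9/16 * measure lborel (cball (0::'a) (1/2))"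
    using content_ball_pos[of "1/2" "0::'a"] content_cball_conv_ball[of "0::'a" "1/2"] by simp
  also have "\<dots> = (LINT w|lborel. 9/16 * indicator (cball (0::'a) (1/2)) w)"
    by simp
  also have "\<dots> \<le> (LINT w|lborel. bump 2 1 (w::'a))"
  proof (rule integral_mono)
    show "integrable lborel (\<lambda>w. 9/16 * indicator (cball (0::'a) (1/2)) w :: real)"
      by (intro integrable_mult_right integrable_indicator_cball)
    show "integrable lborel (bump 2 1 :: 'a \<Rightarrow> real)" by (rule integrable_bump) auto
    show "9/16 * indicator (cball (0::'a) (1/2)) w \<le> bump 2 1 w" for w :: 'a
    proof (cases "norm w \<le> 1/2")
      case True
      have "w \<bullet> w \<le> (1/2)\<^sup>2" unfolding dot_square_norm by (rule power_mono[OF True]) simp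
      then have "(3/4)\<^sup>2 \<le> (max 0 (1 - (w \<bullet> w) / 1\<^sup>2))\<^sup>2"
        by (intro power_mono) (auto simp: power2_eq_square)
      then show ?thesis by (auto simp: bump_def power2_eq_square indicator_def)
    qed (simp add: bump_range)
  qed
  finally show ?thesis .
qed

text \<open>Point evaluations are bounded, uniformly on compact sets: \<open>f z\<close> is an
  average of \<open>f\<close> over a unit ball, and AM-GM splits \<open>cmod (f x)\<close> between
  the weighted square and the inverse weight, which is integrable there. The bound is phrased with
  any \<open>\<delta> > 0\<close> above the norm, since AM-GM divides by \<open>\<delta>\<close> and
  the norm may be 0.\<close>

lemma A2_local_bound:
  fixes \<phi> :: "complex^'n \<Rightarrow> real"
  assumes c: "continuous_on UNIV \<phi>"
  obtains C where "C \<ge> 0" "\<And>f \<delta> z. f \<in> A2 \<phi> \<Longrightarrow> \<delta> > 0 \<Longrightarrow> norm_w \<phi> f \<le> \<delta> \<Longrightarrow> z \<in> cball 0 R \<Longrightarrow> cmod (f z) \<le> C * \<delta>"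
proof -
  define V where "V = (LINT x|lborel. indicator (cball 0 (R+1)) x * exp (\<phi> x))"
  define I where "I = (LINT w|lborel. bump 2 1 (w::complex^'n))"
  have I: "I > 0" unfolding I_def by (rule integral_bump_pos)
  have Vint: "integrable lborel (\<lambda>x. indicator (cball 0 (R+1)) x * exp (\<phi> x))"
    using borel_integrable_compact[of "cball 0 (R+1)" "\<lambda>x. exp (\<phi> x)"] continuous_on_subset[OF c]
    by (auto intro!: continuous_intros)
  have V: "V \<ge> 0" unfolding V_def by (rule Bochner_Integration.integral_nonneg) simp
  show thesis
  \<comment> \<open>Averaging costs \<open>1/I\<close>; AM-GM contributes half of
    \<open>N / \<delta> + \<delta> * V\<close>, at most half of
    \<open>\<delta> * (1 + V)\<close>.\<close>
  proof (rule that[of "(1 + V) / (2 * I)"])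
    show "(1 + V) / (2 * I) \<ge> 0" using I V by simp
    fix f \<delta> and z :: "complex^'n"
    assume f: "f \<in> A2 \<phi>" and d: "\<delta> > 0" and n: "norm_w \<phi> f \<le> \<delta>" and z: "z \<in> cball 0 R"
    have ent: "entire f" and fint: "integrable lborel (\<lambda>z. (cmod (f z))\<^sup>2 * exp (- \<phi> z))"
      using f by (auto simp: A2_def L2_def)
    define N where "N = (LINT z|lborel. (cmod (f z))\<^sup>2 * exp (- \<phi> z))"
    have N0: "N \<ge> 0" unfolding N_def by (rule Bochner_Integration.integral_nonneg) simp
    have "sqrt N \<le> \<delta>" using n unfolding norm_w_def N_def .
    then have N: "N \<le> \<delta>\<^sup>2" using N0 d by (metis real_sqrt_le_iff real_sqrt_abs abs_of_pos)
    let ?h = "\<lambda>x. bump 2 1 (x - z) * cmod (f x)"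
    have hint: "integrable lborel ?h"
    proof (rule integrable_compact_support)
      show "continuous_on UNIV ?h"
        by (intro continuous_intros entire_continuous[OF ent] continuous_on_compose2[OF continuous_on_bump, of UNIV]) auto
      fix x :: "complex^'n" assume "norm x > 1 + norm z"
      then have "norm (x - z) > 1" using norm_triangle_ineq2[of x z] by linarith
      then show "?h x = 0" by (simp add: bump_zero)
    qed
    have "cmod (f z) * I = cmod (LINT w|lborel. of_real (bump 2 1 w) * f (z + w))"
      unfolding entire_mean_value[OF ent] norm_mult I_def[symmetric] using I by simp
    also have "\<dots> \<le> (LINT w|lborel. cmod (of_real (bump 2 1 w) * f (z + w)))"
      by (rule integral_norm_bound)
    also have "\<dots> = (LINT w|lborel. ?h (z + w))"
      by (simp add: norm_mult bump_range)
    also have "\<dots> = (LINT x|lborel. ?h x)"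
      using hint by (intro lborel_integral_translate) auto
    also have "\<dots> \<le> (LINT x|lborel. ((cmod (f x))\<^sup>2 * exp (- \<phi> x) / \<delta> + \<delta> * (indicator (cball 0 (R+1)) x * exp (\<phi> x))) / 2)"
    proof (rule integral_mono[OF hint])
      show "integrable lborel (\<lambda>x. ((cmod (f x))\<^sup>2 * exp (- \<phi> x) / \<delta> + \<delta> * (indicator (cball 0 (R+1)) x * exp (\<phi> x))) / 2)"
        by (intro integrable_divide Bochner_Integration.integrable_add integrable_mult_right fint Vint)
      fix x
      show "?h x \<le> ((cmod (f x))\<^sup>2 * exp (- \<phi> x) / \<delta> + \<delta> * (indicator (cball 0 (R+1)) x * exp (\<phi> x))) / 2"
      proof (cases "norm x \<le> R + 1")
        case True
        \<comment> \<open>AM-GM written as a square; expanding it leaves \<open>- cmod (f x)\<close>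
          as the cross term.\<close>
        have "0 \<le> (cmod (f x) * exp (- \<phi> x) - \<delta>)\<^sup>2 * (exp (\<phi> x) / (2 * \<delta>))"
          using d by simp
        also have "\<dots> = ((cmod (f x))\<^sup>2 * exp (- \<phi> x) / \<delta> + \<delta> * exp (\<phi> x)) / 2 - cmod (f x)"
          using d by (simp add: exp_minus field_simps power2_eq_square)
        finally have "cmod (f x) \<le> ((cmod (f x))\<^sup>2 * exp (- \<phi> x) / \<delta> + \<delta> * exp (\<phi> x)) / 2" by simp
        moreover have "?h x \<le> 1 * cmod (f x)" by (intro mult_right_mono bump_range) simp
        ultimately show ?thesis using True by simp
      next
        case False
        then have "norm (x - z) > 1" using norm_triangle_ineq2[of x z] z by auto
        then have "bump 2 1 (x - z) = 0" by (simp add: bump_zero)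
        then show ?thesis using False d by simp
      qed
    qed
    also have "\<dots> = (N / \<delta> + \<delta> * V) / 2"
      unfolding N_def V_def
      by (subst integral_divide_zero, subst Bochner_Integration.integral_add)
        (auto intro: fint Vint)
    also have "\<dots> \<le> (\<delta> + \<delta> * V) / 2"
    proof -
      have "N / \<delta> \<le> \<delta>" using N d by (simp add: divide_simps power2_eq_square)
      then show ?thesis by (intro divide_right_mono add_right_mono) simp_all
    qed
    finally show "cmod (f z) \<le> (1 + V) / (2 * I) * \<delta>"
      using I by (simp add: field_simps)
  qed
qed

section \<open>The Bergman projection\<close>

text \<open>It serves two purposes: bounding the norm of a limit of a minimizing sequence, and
  removing cutoffs from nonnegative integrands. In both, integrability of the limit is part of what
  is wanted.\<close>

lemma integral_Fatou:
  fixes f :: "nat \<Rightarrow> 'a \<Rightarrow> real"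
  assumes f: "\<And>n. integrable M (f n)" "\<And>n x. 0 \<le> f n x"
    and lim: "\<And>x. (\<lambda>n. f n x) \<longlonglongrightarrow> u x"
    and C: "\<forall>\<^sub>F n in sequentially. (LINT x|M. f n x) \<le> C"
  shows "integrable M u" "(LINT x|M. u x) \<le> C"
proof -
  have [measurable]: "f n \<in> borel_measurable M" for n using f(1) by auto
  have u0: "0 \<le> u x" for x using LIMSEQ_le_const[OF lim] f(2) by blast
  have um [measurable]: "u \<in> borel_measurable M" by (rule borel_measurable_LIMSEQ_real[OF lim]) auto
  obtain n where "(LINT x|M. f n x) \<le> C" using C by (auto simp: eventually_sequentially)
  moreover have "(LINT x|M. f n x) \<ge> 0" by (rule Bochner_Integration.integral_nonneg) (rule f(2))
  ultimately have C0: "C \<ge> 0" by linarith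
  have "(\<integral>\<^sup>+x. ennreal (u x) \<partial>M) = (\<integral>\<^sup>+x. liminf (\<lambda>n. ennreal (f n x)) \<partial>M)"
    by (intro nn_integral_cong lim_imp_Liminf[symmetric] tendsto_ennrealI lim) simp
  also have "\<dots> \<le> liminf (\<lambda>n. \<integral>\<^sup>+x. ennreal (f n x) \<partial>M)"
    by (rule nn_integral_liminf) simp
  also have "\<dots> \<le> liminf (\<lambda>n. ennreal C)"
  proof (rule Liminf_mono)
    show "\<forall>\<^sub>F n in sequentially. (\<integral>\<^sup>+x. ennreal (f n x) \<partial>M) \<le> ennreal C"
      using C by eventually_elim (simp add: nn_integral_eq_integral f ennreal_leI)
  qed
  also have "\<dots> = ennreal C" by (simp add: Liminf_const)
  finally have le: "(\<integral>\<^sup>+x. ennreal (u x) \<partial>M) \<le> ennreal C" .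
  then have "(\<integral>\<^sup>+x. ennreal (u x) \<partial>M) < \<infinity>" by (metis ennreal_less_top infinity_ennreal_def order.strict_trans1)
  then show int: "integrable M u" using u0 by (intro integrableI_nonneg) auto
  show "(LINT x|M. u x) \<le> C"
    using le C0 u0 by (simp add: nn_integral_eq_integral[OF int])
qed

lemma L2_I:
  assumes "continuous_on UNIV f" "integrable lborel (\<lambda>z. (cmod (f z))\<^sup>2 * exp (- \<phi> z))"
  shows "f \<in> L2 \<phi>"
  using assms borel_measurable_continuous_onI[OF assms(1)] by (auto simp: L2_def)

lemma L2_D:
  assumes "f \<in> L2 \<phi>"
  shows "f \<in> borel_measurable borel" "integrable lborel (\<lambda>z. (cmod (f z))\<^sup>2 * exp (- \<phi> z))"
  using assms by (auto simp: L2_def)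

lemma cmod_mult_le: "cmod a * cmod b \<le> ((cmod a)\<^sup>2 + (cmod b)\<^sup>2) / 2"
  using sum_squares_bound[of "cmod a" "cmod b"] by simp

section \<open>The weighted inner product on L^2\<close>

context
  fixes \<phi> :: "complex^'n \<Rightarrow> real"
  assumes cont: "continuous_on UNIV \<phi>"
begin

lemma weight_measurable: "\<phi> \<in> borel_measurable borel"
  by (rule borel_measurable_continuous_onI[OF cont])

lemma L2_integrable_mult:
  assumes f: "f \<in> L2 \<phi>" and g: "g \<in> L2 \<phi>"
  shows "integrable lborel (\<lambda>z. f z * cnj (g z) * of_real (exp (- \<phi> z)))"
proof -
  note [measurable] = L2_D(1)[OF f] L2_D(1)[OF g] weight_measurable
  have m: "(\<lambda>z. cnj (g z)) \<in> borel_measurable borel"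
    by (rule measurable_compose[OF L2_D(1)[OF g] borel_measurable_continuous_onI]) (intro continuous_intros)
  show ?thesis
  proof (rule Bochner_Integration.integrable_bound)
    show "integrable lborel (\<lambda>z. ((cmod (f z))\<^sup>2 * exp (- \<phi> z) + (cmod (g z))\<^sup>2 * exp (- \<phi> z)) / 2)"
      by (intro integrable_divide Bochner_Integration.integrable_add L2_D f g)
    show "(\<lambda>z. f z * cnj (g z) * of_real (exp (- \<phi> z))) \<in> borel_measurable lborel"
      using m by measurable
    show "AE z in lborel. norm (f z * cnj (g z) * of_real (exp (- \<phi> z))) \<le>
        norm (((cmod (f z))\<^sup>2 * exp (- \<phi> z) + (cmod (g z))\<^sup>2 * exp (- \<phi> z)) / 2)"
    proof (rule AE_I2)
      fix z
      have "norm (f z * cnj (g z) * of_real (exp (- \<phi> z))) = cmod (f z) * cmod (g z) * exp (- \<phi> z)"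
        by (simp add: norm_mult)
      also have "\<dots> \<le> ((cmod (f z))\<^sup>2 + (cmod (g z))\<^sup>2) / 2 * exp (- \<phi> z)"
        by (intro mult_right_mono cmod_mult_le) simp
      also have "\<dots> = norm (((cmod (f z))\<^sup>2 * exp (- \<phi> z) + (cmod (g z))\<^sup>2 * exp (- \<phi> z)) / 2)"
        by (simp add: algebra_simps)
      finally show "norm (f z * cnj (g z) * of_real (exp (- \<phi> z))) \<le> \<dots>" .
    qed
  qed
qed

lemma L2_cmult:
  assumes f: "f \<in> L2 \<phi>" shows "(\<lambda>z. c * f z) \<in> L2 \<phi>"
proof -
  have "integrable lborel (\<lambda>z. (cmod c)\<^sup>2 * ((cmod (f z))\<^sup>2 * exp (- \<phi> z)))"
    by (intro integrable_mult_right L2_D f)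
  then show ?thesis using L2_D(1)[OF f] by (simp add: L2_def norm_mult power_mult_distrib mult.assoc)
qed

lemma L2_add:
  assumes f: "f \<in> L2 \<phi>" and g: "g \<in> L2 \<phi>" shows "(\<lambda>z. f z + g z) \<in> L2 \<phi>"
proof -
  note [measurable] = L2_D(1)[OF f] L2_D(1)[OF g] weight_measurable
  have "integrable lborel (\<lambda>z. (cmod (f z + g z))\<^sup>2 * exp (- \<phi> z))"
  proof (rule Bochner_Integration.integrable_bound)
    show "integrable lborel (\<lambda>z. 2 * ((cmod (f z))\<^sup>2 * exp (- \<phi> z)) + 2 * ((cmod (g z))\<^sup>2 * exp (- \<phi> z)))"
      by (intro integrable_mult_right Bochner_Integration.integrable_add L2_D f g)
    show "AE z in lborel. norm ((cmod (f z + g z))\<^sup>2 * exp (- \<phi> z)) \<le>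
      norm (2 * ((cmod (f z))\<^sup>2 * exp (- \<phi> z)) + 2 * ((cmod (g z))\<^sup>2 * exp (- \<phi> z)))"
    proof (rule AE_I2)
      fix z
      have "(cmod (f z + g z))\<^sup>2 \<le> (cmod (f z) + cmod (g z))\<^sup>2"
        by (intro power_mono norm_triangle_ineq) simp
      also have "\<dots> \<le> 2 * (cmod (f z))\<^sup>2 + 2 * (cmod (g z))\<^sup>2"
        using sum_squares_bound[of "cmod (f z)" "cmod (g z)"] by (simp add: power2_sum)
      finally have "(cmod (f z + g z))\<^sup>2 * exp (- \<phi> z) \<le> (2 * (cmod (f z))\<^sup>2 + 2 * (cmod (g z))\<^sup>2) * exp (- \<phi> z)"
        by (rule mult_right_mono) simp
      then show "norm ((cmod (f z + g z))\<^sup>2 * exp (- \<phi> z)) \<le>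
          norm (2 * ((cmod (f z))\<^sup>2 * exp (- \<phi> z)) + 2 * ((cmod (g z))\<^sup>2 * exp (- \<phi> z)))"
        by (simp add: algebra_simps)
    qed
  qed measurable
  then show ?thesis by (simp add: L2_def)
qed

lemma L2_diff:
  assumes f: "f \<in> L2 \<phi>" and g: "g \<in> L2 \<phi>" shows "(\<lambda>z. f z - g z) \<in> L2 \<phi>"
  using L2_add[OF f L2_cmult[OF g, of "-1"]] by simp

lemma inner_w_add_left:
  assumes "f \<in> L2 \<phi>" "g \<in> L2 \<phi>" "h \<in> L2 \<phi>"
  shows "inner_w \<phi> (\<lambda>z. f z + g z) h = inner_w \<phi> f h + inner_w \<phi> g h"
  unfolding inner_w_def
  by (simp add: distrib_right Bochner_Integration.integral_add L2_integrable_mult assms)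

lemma inner_w_cmult_left: "inner_w \<phi> (\<lambda>z. c * f z) h = c * inner_w \<phi> f h"
  unfolding inner_w_def by (simp add: mult.assoc)

lemma inner_w_cnj: "inner_w \<phi> f g = cnj (inner_w \<phi> g f)"
proof -
  have "cnj (inner_w \<phi> g f) = (LINT z|lborel. cnj (g z * cnj (f z) * of_real (exp (- \<phi> z))))"
    unfolding inner_w_def by (rule Bochner_Integration.integral_cnj[symmetric])
  then show ?thesis unfolding inner_w_def by (simp add: mult_ac)
qed

lemma inner_w_diff_left:
  assumes "f \<in> L2 \<phi>" "g \<in> L2 \<phi>" "h \<in> L2 \<phi>"
  shows "inner_w \<phi> (\<lambda>z. f z - g z) h = inner_w \<phi> f h - inner_w \<phi> g h"
  using inner_w_add_left[OF assms(1) L2_cmult[OF assms(2), of "-1"] assms(3)] inner_w_cmult_left[of "-1" g h]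
  by simp

lemma inner_w_diff_right:
  assumes "f \<in> L2 \<phi>" "g \<in> L2 \<phi>" "h \<in> L2 \<phi>"
  shows "inner_w \<phi> h (\<lambda>z. f z - g z) = inner_w \<phi> h f - inner_w \<phi> h g"
  using inner_w_diff_left[OF assms] inner_w_cnj[of h] by (simp add: inner_w_cnj[of h])

lemma inner_w_cmult_right: "inner_w \<phi> h (\<lambda>z. c * f z) = cnj c * inner_w \<phi> h f"
  using inner_w_cmult_left[of c f h] by (simp add: inner_w_cnj[of h])

lemma L2_sum:
  assumes "\<And>i. i \<in> I \<Longrightarrow> f i \<in> L2 \<phi>" shows "(\<lambda>z. \<Sum>i\<in>I. f i z) \<in> L2 \<phi>"
  using assms
proof (induction I rule: infinite_finite_induct)
  case (insert i I)
  then show ?case using L2_add[of "f i" "\<lambda>z. \<Sum>i\<in>I. f i z"] by simp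
qed (auto simp: L2_def)

lemma inner_w_sum_left:
  assumes "\<And>i. i \<in> I \<Longrightarrow> f i \<in> L2 \<phi>" "h \<in> L2 \<phi>"
  shows "inner_w \<phi> (\<lambda>z. \<Sum>i\<in>I. f i z) h = (\<Sum>i\<in>I. inner_w \<phi> (f i) h)"
  using assms(1)
proof (induction I rule: infinite_finite_induct)
  case (insert i I)
  then show ?case using inner_w_add_left[of "f i" "\<lambda>z. \<Sum>i\<in>I. f i z", OF _ L2_sum assms(2)] by simp
qed (auto simp: inner_w_def)

lemma inner_w_sum_right:
  assumes "\<And>i. i \<in> I \<Longrightarrow> f i \<in> L2 \<phi>" "h \<in> L2 \<phi>"
  shows "inner_w \<phi> h (\<lambda>z. \<Sum>i\<in>I. f i z) = (\<Sum>i\<in>I. inner_w \<phi> h (f i))"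
proof -
  have "inner_w \<phi> (\<lambda>z. \<Sum>i\<in>I. f i z) h = (\<Sum>i\<in>I. inner_w \<phi> (f i) h)"
    using assms by (rule inner_w_sum_left)
  then show ?thesis by (simp add: inner_w_cnj[of h])
qed

lemma norm_w_nonneg: "norm_w \<phi> f \<ge> 0"
  unfolding norm_w_def by (intro real_sqrt_ge_zero Bochner_Integration.integral_nonneg) simp

lemma norm_w_sq: "(norm_w \<phi> f)\<^sup>2 = (LINT z|lborel. (cmod (f z))\<^sup>2 * exp (- \<phi> z))"
  unfolding norm_w_def by (intro real_sqrt_pow2 Bochner_Integration.integral_nonneg) simp

lemma norm_w_sq_cmult: "(norm_w \<phi> (\<lambda>z. c * f z))\<^sup>2 = (cmod c)\<^sup>2 * (norm_w \<phi> f)\<^sup>2"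
  unfolding norm_w_sq by (simp add: norm_mult power_mult_distrib mult.assoc)

lemma inner_w_self: "inner_w \<phi> f f = of_real ((norm_w \<phi> f)\<^sup>2)"
  unfolding norm_w_sq inner_w_def
  by (simp only: complex_norm_square[symmetric] of_real_mult[symmetric] of_real_power[symmetric] integral_complex_of_real)

text \<open>\<open>c = 1\<close> and \<open>c = -1\<close> give the parallelogram law, a small
  multiple of an inner product gives the variational argument for the projection, and
  \<open>c = 1\<close> also gives Pythagoras and the expansion of the coefficients of
  \<open>\<partial>u\<close>.\<close>

lemma norm_w_sq_diff:
  assumes "f \<in> L2 \<phi>" "g \<in> L2 \<phi>"
  shows "(norm_w \<phi> (\<lambda>z. f z - c * g z))\<^sup>2 =
    (norm_w \<phi> f)\<^sup>2 - 2 * Re (cnj c * inner_w \<phi> f g) + (cmod c)\<^sup>2 * (norm_w \<phi> g)\<^sup>2"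
proof -
  note cg = L2_cmult[OF assms(2), of c]
  have "complex_of_real ((norm_w \<phi> (\<lambda>z. f z - c * g z))\<^sup>2) =
    of_real ((norm_w \<phi> f)\<^sup>2) - (cnj c * inner_w \<phi> f g + cnj (cnj c * inner_w \<phi> f g)) + (c * cnj c) * of_real ((norm_w \<phi> g)\<^sup>2)"
    unfolding inner_w_self[symmetric]
    by (simp add: inner_w_diff_left[OF assms(1) cg L2_diff[OF assms(1) cg]]
      inner_w_diff_right[OF assms(1) cg assms(1)] inner_w_diff_right[OF assms(1) cg cg]
      inner_w_cmult_left inner_w_cmult_right inner_w_cnj[of g f] algebra_simps)
  also have "\<dots> = of_real ((norm_w \<phi> f)\<^sup>2 - 2 * Re (cnj c * inner_w \<phi> f g) + (cmod c)\<^sup>2 * (norm_w \<phi> g)\<^sup>2)"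
    unfolding complex_add_cnj complex_norm_square[symmetric] by simp
  finally show ?thesis unfolding of_real_eq_iff .
qed

section \<open>Square-integrable entire functions and the projection onto them\<close>

lemma A2_zero: "(\<lambda>z. 0) \<in> A2 \<phi>"
  by (simp add: A2_def L2_def)

lemma A2_L2: "f \<in> A2 \<phi> \<Longrightarrow> f \<in> L2 \<phi>" and A2_entire: "f \<in> A2 \<phi> \<Longrightarrow> entire f"
  by (simp_all add: A2_def)

lemma A2_cmult: "f \<in> A2 \<phi> \<Longrightarrow> (\<lambda>z. c * f z) \<in> A2 \<phi>"
  by (simp add: A2_def L2_cmult entire_cmult)

lemma A2_add: "f \<in> A2 \<phi> \<Longrightarrow> g \<in> A2 \<phi> \<Longrightarrow> (\<lambda>z. f z + g z) \<in> A2 \<phi>"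
  by (simp add: A2_def L2_add entire_add)

lemma A2_diff: "f \<in> A2 \<phi> \<Longrightarrow> g \<in> A2 \<phi> \<Longrightarrow> (\<lambda>z. f z - g z) \<in> A2 \<phi>"
  by (simp add: A2_def L2_diff entire_diff)

lemma A2_sum:
  assumes "\<And>i. i \<in> I \<Longrightarrow> f i \<in> A2 \<phi>" shows "(\<lambda>z. \<Sum>i\<in>I. f i z) \<in> A2 \<phi>"
  using assms
proof (induction I rule: infinite_finite_induct)
  case (insert i I)
  then show ?case using A2_add[of "f i" "\<lambda>z. \<Sum>i\<in>I. f i z"] by simp
qed (auto simp: A2_zero)

text \<open>Elements are functions rather than classes, so vanishing has to hold at every point;
  bounded point evaluations give this.\<close>

lemma A2_norm_zero:
  assumes f: "f \<in> A2 \<phi>" and "norm_w \<phi> f = 0" shows "f = (\<lambda>z. 0)"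
proof
  fix z :: "complex^'n"
  obtain C where C: "C \<ge> 0" "\<And>f \<delta> w. f \<in> A2 \<phi> \<Longrightarrow> \<delta> > 0 \<Longrightarrow> norm_w \<phi> f \<le> \<delta> \<Longrightarrow> w \<in> cball 0 (norm z) \<Longrightarrow> cmod (f w) \<le> C * \<delta>"
    using A2_local_bound[OF cont] by metis
  have "cmod (f z) \<le> 0 + e" if "e > 0" for e
  proof -
    have "cmod (f z) \<le> C * (e / (C + 1))" using C(1) that assms by (intro C(2)) auto
    also have "\<dots> \<le> e" using C(1) that by (simp add: field_simps)
    finally show ?thesis by simp
  qed
  then have "cmod (f z) \<le> 0" by (rule field_le_epsilon)
  then show "f z = 0" by simp
qed

text \<open>The nearest-point argument with completeness built in: a minimizing sequence is Cauchy
  in norm by the parallelogram law, hence locally uniformly Cauchy by \<open>A2_local_bound\<close>;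
  its limit is entire, and Fatou shows that the limit attains the infimum.\<close>

lemma bergman_proj_exists:
  assumes F: "F \<in> L2 \<phi>"
  shows "\<exists>h\<in>A2 \<phi>. \<forall>g\<in>A2 \<phi>. inner_w \<phi> (\<lambda>z. F z - h z) g = 0"
proof -
  define Q where "Q h = (norm_w \<phi> (\<lambda>z. F z - h z))\<^sup>2" for h
  define d where "d = Inf (Q ` A2 \<phi>)"
  have bdd: "bdd_below (Q ` A2 \<phi>)" by (rule bdd_belowI[of _ 0]) (auto simp: Q_def)
  have dle: "d \<le> Q h" if "h \<in> A2 \<phi>" for h unfolding d_def using bdd that by (intro cInf_lower) auto
  have "\<exists>h\<in>A2 \<phi>. Q h < d + inverse (real (Suc n))" for n
    using cInf_lessD[of "Q ` A2 \<phi>" "d + inverse (real (Suc n))"] A2_zero unfolding d_def by fastforce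
  then obtain h where h: "\<And>n. h n \<in> A2 \<phi>" "\<And>n. Q (h n) < d + inverse (real (Suc n))" by metis
  have hdiff: "(norm_w \<phi> (\<lambda>z. h m z - h n z))\<^sup>2 \<le> 2 * inverse (real (Suc m)) + 2 * inverse (real (Suc n))" for m n
  proof -
    define a where "a = (\<lambda>z. F z - h m z)"
    define b where "b = (\<lambda>z. F z - h n z)"
    have ab: "a \<in> L2 \<phi>" "b \<in> L2 \<phi>" unfolding a_def b_def by (intro L2_diff F A2_L2 h)+
    \<comment> \<open>The sum of \<open>a\<close> and \<open>b\<close> is twice the error at the
      midpoint of \<open>h m\<close> and \<open>h n\<close>. The midpoint lies in
      \<open>A2 \<phi>\<close>, so its \<open>Q\<close> is at least \<open>d\<close>.\<close>
    have f: "(\<lambda>z. a z - 1 * b z) = (\<lambda>z. h n z - h m z)"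
      "(\<lambda>z. a z - (-1) * b z) = (\<lambda>z. 2 * (F z - (1/2) * (h m z + h n z)))"
      by (auto simp: a_def b_def field_simps)
    have "(norm_w \<phi> (\<lambda>z. a z - 1 * b z))\<^sup>2 + (norm_w \<phi> (\<lambda>z. a z - (-1) * b z))\<^sup>2 = 2 * (norm_w \<phi> a)\<^sup>2 + 2 * (norm_w \<phi> b)\<^sup>2"
      unfolding norm_w_sq_diff[OF ab] by simp
    note this[unfolded f]
    moreover have "(norm_w \<phi> (\<lambda>z. h n z - h m z))\<^sup>2 = (norm_w \<phi> (\<lambda>z. h m z - h n z))\<^sup>2"
      unfolding norm_w_sq by (simp add: norm_minus_commute)
    moreover have "(norm_w \<phi> (\<lambda>z. 2 * (F z - (1/2) * (h m z + h n z))))\<^sup>2 = 4 * Q (\<lambda>z. (1/2) * (h m z + h n z))"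
      unfolding Q_def norm_w_sq_cmult by simp
    moreover have "d \<le> Q (\<lambda>z. (1/2) * (h m z + h n z))" by (intro dle A2_cmult A2_add h)
    moreover have "(norm_w \<phi> a)\<^sup>2 = Q (h m)" "(norm_w \<phi> b)\<^sup>2 = Q (h n)" by (simp_all add: Q_def a_def b_def)
    ultimately show ?thesis using h(2)[of m] h(2)[of n] by linarith
  qed
  have "uniformly_convergent_on (cball 0 R) h" for R
  proof (rule Cauchy_uniformly_convergent)
    show "uniformly_Cauchy_on (cball 0 R) h"
      unfolding uniformly_Cauchy_on_def
    proof (intro allI impI)
      fix e :: real assume e: "e > 0"
      obtain C where C: "C \<ge> 0" "\<And>f \<delta> w. f \<in> A2 \<phi> \<Longrightarrow> \<delta> > 0 \<Longrightarrow> norm_w \<phi> f \<le> \<delta> \<Longrightarrow> w \<in> cball 0 R \<Longrightarrow> cmod (f w) \<le> C * \<delta>"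
        using A2_local_bound[OF cont] by metis
      define \<delta> where "\<delta> = e / (C + 1)"
      have \<delta>: "\<delta> > 0" "C * \<delta> < e" using e C(1) by (auto simp: \<delta>_def field_simps)
      \<comment> \<open>Each of the two terms of \<open>hdiff\<close> then stays below
        \<open>\<delta>\<^sup>2 / 2\<close>.\<close>
      obtain M where M: "inverse (real (Suc M)) < \<delta>\<^sup>2 / 4" using reals_Archimedean[of "\<delta>\<^sup>2 / 4"] \<delta>(1) by auto
      have "dist (h m x) (h n x) < e" if "x \<in> cball 0 R" "m \<ge> M" "n \<ge> M" for x m n
      proof -
        have "inverse (real (Suc m)) \<le> inverse (real (Suc M))" "inverse (real (Suc n)) \<le> inverse (real (Suc M))"
          using that by (auto intro!: le_imp_inverse_le)
        then have "(norm_w \<phi> (\<lambda>z. h m z - h n z))\<^sup>2 \<le> \<delta>\<^sup>2" using hdiff[of m n] M by linarith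
        then have "norm_w \<phi> (\<lambda>z. h m z - h n z) \<le> \<delta>" by (rule power2_le_imp_le) (use \<delta>(1) in simp)
        then have "cmod (h m x - h n x) \<le> C * \<delta>" 
            by (rule C(2)[OF A2_diff[OF h(1) h(1)] \<delta>(1) _ that(1)])
        then show ?thesis using \<delta>(2) by (simp add: dist_norm)
      qed
      then show "\<exists>M. \<forall>x\<in>cball 0 R. \<forall>m\<ge>M. \<forall>n\<ge>M. dist (h m x) (h n x) < e" by blast
    qed
  qed
  then have ex: "\<exists>l. uniform_limit (cball 0 R) h l sequentially" for R
    unfolding uniformly_convergent_on_def .
  define g where "g z = lim (\<lambda>n. h n z)" for z
  have ug: "uniform_limit (cball 0 R) h g sequentially" for R
  proof -
    obtain l where l: "uniform_limit (cball 0 R) h l sequentially" using ex by blast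
    have "l z = g z" if "z \<in> cball 0 R" for z
      unfolding g_def using tendsto_uniform_limitI[OF l that] limI by metis
    then show ?thesis using l uniform_limit_cong'[of "cball 0 R" h h l g] by metis
  qed
  have ent: "entire g" by (rule entire_uniform_limit[OF A2_entire[OF h(1)] ug])
  have lim: "(\<lambda>n. h n z) \<longlonglongrightarrow> g z" for z
    using tendsto_uniform_limitI[OF ug[of "norm z"], of z] by simp
  have FF: "integrable lborel (\<lambda>z. (cmod (F z - g z))\<^sup>2 * exp (- \<phi> z)) \<and> (norm_w \<phi> (\<lambda>z. F z - g z))\<^sup>2 \<le> d + e" if "e > 0" for e
  proof -
    note L = L2_diff[OF F A2_L2[OF h(1)]]
    have l: "(\<lambda>n. (cmod (F z - h n z))\<^sup>2 * exp (- \<phi> z)) \<longlonglongrightarrow> (cmod (F z - g z))\<^sup>2 * exp (- \<phi> z)" for z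
      by (intro tendsto_intros lim)
    have ev: "\<forall>\<^sub>F n in sequentially. (LINT z|lborel. (cmod (F z - h n z))\<^sup>2 * exp (- \<phi> z)) \<le> d + e"
    proof -
      have "\<forall>\<^sub>F n in sequentially. inverse (real (Suc n)) < e"
        using LIMSEQ_inverse_real_of_nat that by (rule order_tendstoD)
      then show ?thesis
      proof eventually_elim
        case (elim n)
        then show ?case using h(2)[of n] unfolding Q_def norm_w_sq by linarith
      qed
    qed
    show ?thesis unfolding norm_w_sq
      using integral_Fatou[OF L2_D(2)[OF L] _ l ev] by simp
  qed
  have FgL: "(\<lambda>z. F z - g z) \<in> L2 \<phi>"
    using FF[of 1] L2_D(1)[OF F] borel_measurable_continuous_onI[OF entire_continuous[OF ent]]
    by (auto simp: L2_def)
  \<comment> \<open>So far only \<open>F - g\<close> is known to be in \<open>L2 \<phi>\<close>;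
    subtracting it from \<open>F\<close> recovers \<open>g\<close>.\<close>
  have "(\<lambda>z. F z - (F z - g z)) \<in> L2 \<phi>" by (rule L2_diff[OF F FgL])
  then have gA: "g \<in> A2 \<phi>" using ent by (simp add: A2_def)
  have Qg: "(norm_w \<phi> (\<lambda>z. F z - g z))\<^sup>2 \<le> d" by (rule field_le_epsilon) (use FF in auto)
  have "inner_w \<phi> (\<lambda>z. F z - g z) k = 0" if k: "k \<in> A2 \<phi>" for k
  proof (rule ccontr)
    define w where "w = inner_w \<phi> (\<lambda>z. F z - g z) k"
    assume "inner_w \<phi> (\<lambda>z. F z - g z) k \<noteq> 0"
    then have w: "(cmod w)\<^sup>2 > 0" by (simp add: w_def)
    \<comment> \<open>Moving from \<open>g\<close> to \<open>g + s * w * k\<close> would lower the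
      squared distance by at least \<open>s * (cmod w)\<^sup>2\<close>: this \<open>s\<close> keeps
      the quadratic term below half of the linear gain. The added 1 covers
      \<open>norm_w \<phi> k = 0\<close>.\<close>
    define s where "s = 1 / ((norm_w \<phi> k)\<^sup>2 + 1)"
    have s: "s > 0" "s * (norm_w \<phi> k)\<^sup>2 \<le> 1" by (auto simp: s_def field_simps add_pos_nonneg)
    define c where "c = of_real s * w"
    have "d \<le> Q (\<lambda>z. g z + c * k z)" by (intro dle A2_add A2_cmult gA k)
    also have "\<dots> = (norm_w \<phi> (\<lambda>z. (F z - g z) - c * k z))\<^sup>2" unfolding Q_def by (simp add: algebra_simps)
    also have "\<dots> = (norm_w \<phi> (\<lambda>z. F z - g z))\<^sup>2 - 2 * Re (cnj c * w) + (cmod c)\<^sup>2 * (norm_w \<phi> k)\<^sup>2"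
      unfolding norm_w_sq_diff[OF FgL A2_L2[OF k]] w_def ..
    also have "Re (cnj c * w) = s * (cmod w)\<^sup>2"
    proof -
      have "cnj c * w = of_real s * (w * cnj w)" by (simp add: c_def mult_ac)
      also have "\<dots> = of_real (s * (cmod w)\<^sup>2)" unfolding complex_norm_square[symmetric] by simp
      finally show ?thesis by (metis Re_complex_of_real)
    qed
    also have "(cmod c)\<^sup>2 * (norm_w \<phi> k)\<^sup>2 = s * (cmod w)\<^sup>2 * (s * (norm_w \<phi> k)\<^sup>2)"
      using s by (simp add: c_def norm_mult power2_eq_square)
    also have "\<dots> \<le> s * (cmod w)\<^sup>2 * 1" using s w by (intro mult_left_mono) auto
    finally have "s * (cmod w)\<^sup>2 \<le> 0" using Qg by linarith
    then show False using s w by (metis mult_pos_pos not_le)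
  qed
  then show ?thesis using gA by blast
qed

text \<open>Uniqueness settles the definite description: the difference of two candidates lies in
  \<open>A2 \<phi>\<close> and is orthogonal to itself.\<close>

lemma bergman_proj:
  assumes F: "F \<in> L2 \<phi>"
  shows "bergman_proj \<phi> F \<in> A2 \<phi>"
    and "g \<in> A2 \<phi> \<Longrightarrow> inner_w \<phi> (\<lambda>z. F z - bergman_proj \<phi> F z) g = 0"
proof -
  have "\<exists>!h. h \<in> A2 \<phi> \<and> (\<forall>g\<in>A2 \<phi>. inner_w \<phi> (\<lambda>z. F z - h z) g = 0)"
  proof (rule ex_ex1I)
    show "\<exists>h. h \<in> A2 \<phi> \<and> (\<forall>g\<in>A2 \<phi>. inner_w \<phi> (\<lambda>z. F z - h z) g = 0)"
      using bergman_proj_exists[OF F] by blast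
    fix h k
    assume h: "h \<in> A2 \<phi> \<and> (\<forall>g\<in>A2 \<phi>. inner_w \<phi> (\<lambda>z. F z - h z) g = 0)"
      and k: "k \<in> A2 \<phi> \<and> (\<forall>g\<in>A2 \<phi>. inner_w \<phi> (\<lambda>z. F z - k z) g = 0)"
    define v where "v = (\<lambda>z. h z - k z)"
    have v: "v \<in> A2 \<phi>" unfolding v_def using h k by (intro A2_diff) auto
    have "inner_w \<phi> v v = inner_w \<phi> (\<lambda>z. (F z - k z) - (F z - h z)) v" by (simp add: v_def)
    also have "\<dots> = inner_w \<phi> (\<lambda>z. F z - k z) v - inner_w \<phi> (\<lambda>z. F z - h z) v"
      using h k by (intro inner_w_diff_left L2_diff F A2_L2 v) auto
    also have "\<dots> = 0" using h k v by auto
    finally have "norm_w \<phi> v = 0" unfolding inner_w_self by simp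
    then have "v = (\<lambda>z. 0)" by (rule A2_norm_zero[OF v])
    then show "h = k" by (auto simp: v_def fun_eq_iff)
  qed
  from theI'[OF this, folded bergman_proj_def]
  show "bergman_proj \<phi> F \<in> A2 \<phi>" "g \<in> A2 \<phi> \<Longrightarrow> inner_w \<phi> (\<lambda>z. F z - bergman_proj \<phi> F z) g = 0"
    by auto
qed

end

section \<open>The Levi form\<close>

text \<open>Cauchy-Schwarz for a positive Hermitian form, kept in real terms: \<open>S\<close> is
  its real part, invariance under multiplication by \<i> encodes the complex structure, and
  \<open>H\<close> is the complex value at \<open>v\<close> and \<open>w\<close>. Positivity is
  tested on a combination in which \<open>v\<close> is rotated by the phase of
  \<open>H\<close>.\<close>

lemma hermitian_form_bound:
  fixes S :: "complex^'n \<Rightarrow> complex^'n \<Rightarrow> real"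
  assumes add: "\<And>u v w. S (u + v) w = S u w + S v w" and scale: "\<And>c v w. S (c *\<^sub>R v) w = c * S v w"
    and sym: "\<And>v w. S v w = S w v" and J: "\<And>v w. S (\<i> *s v) (\<i> *s w) = S v w"
    and pos: "\<And>v. S v v \<ge> 0" and H: "H = Complex (S v w) (S (\<i> *s v) w)"
    and xy: "x \<ge> 0" "y \<ge> 0"
  shows "2 * cmod H * x * y \<le> S v v * x\<^sup>2 + S w w * y\<^sup>2"
proof (cases "H = 0")
  case True
  then show ?thesis using pos[of v] pos[of w] by simp
next
  case False
  have add': "S w (u + v) = S w u + S w v" for u v w using add sym by metis
  have scale': "S w (c *\<^sub>R v) = c * S w v" for c v w using scale sym by metis
  have ii: "\<i> *s (\<i> *s v) = (-1) *\<^sub>R v" for v :: "complex^'n" by vector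
  have "S (\<i> *s v) v = S ((-1) *\<^sub>R v) (\<i> *s v)" using J[of "\<i> *s v" v] unfolding ii by simp
  then have zero: "S (\<i> *s v) v = 0" "S v (\<i> *s v) = 0" unfolding scale using sym[of v "\<i> *s v"] by simp_all
  \<comment> \<open>\<open>a + b * \<i>\<close> is \<open>x * H / cmod H\<close>, with modulus
    \<open>x\<close> and the phase of \<open>H\<close>.\<close>
  define a b where "a = x * (Re H / cmod H)" and "b = x * (Im H / cmod H)"
  have h: "(cmod H)\<^sup>2 = (Re H)\<^sup>2 + (Im H)\<^sup>2" by (rule cmod_power2)
  have ab: "a\<^sup>2 + b\<^sup>2 = x\<^sup>2"
  proof -
    have "a\<^sup>2 + b\<^sup>2 = x\<^sup>2 * (((Re H)\<^sup>2 + (Im H)\<^sup>2) / (cmod H)\<^sup>2)"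
      unfolding a_def b_def by (simp add: power_mult_distrib power_divide add_divide_distrib algebra_simps)
    then show ?thesis unfolding h[symmetric] using False by simp
  qed
  have aH: "a * S v w + b * S (\<i> *s v) w = x * cmod H"
  proof -
    have "a * S v w + b * S (\<i> *s v) w = x * (((Re H)\<^sup>2 + (Im H)\<^sup>2) / cmod H)"
      unfolding a_def b_def H by (simp add: power2_eq_square add_divide_distrib algebra_simps)
    then show ?thesis unfolding h[symmetric] using False by (simp add: power2_eq_square)
  qed
  have "0 \<le> S (a *\<^sub>R v + b *\<^sub>R (\<i> *s v) + (-y) *\<^sub>R w) (a *\<^sub>R v + b *\<^sub>R (\<i> *s v) + (-y) *\<^sub>R w)"
    by (rule pos)
  also have "\<dots> = (a\<^sup>2 + b\<^sup>2) * S v v + y\<^sup>2 * S w w - 2 * y * (a * S v w + b * S (\<i> *s v) w)"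
    unfolding add add' scale scale' zero J sym[of w v] sym[of w "\<i> *s v"]
    by (simp add: power2_eq_square algebra_simps)
  finally show ?thesis unfolding ab aH by (simp add: algebra_simps)
qed

lemma mean_value_difference:
  fixes f :: "'a::real_normed_vector \<Rightarrow> real"
  assumes f: "\<And>x. f differentiable (at x)" and h: "h > 0"
  obtains \<xi> where "0 < \<xi>" "\<xi> < h" "f (a + h *\<^sub>R v) - f a = h * frechet_derivative f (at (a + \<xi> *\<^sub>R v)) v"
proof -
  have der: "((\<lambda>t. f (a + t *\<^sub>R v)) has_real_derivative frechet_derivative f (at (a + t *\<^sub>R v)) v) (at t)" for t
  proof -
    have "((\<lambda>t. a + t *\<^sub>R v) has_derivative (\<lambda>h. h *\<^sub>R v)) (at t)"
      by (auto intro!: derivative_eq_intros)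
    from has_derivative_compose[OF this f[THEN frechet_derivative_works[THEN iffD1]]]
    show ?thesis unfolding has_field_derivative_def
      by (rule has_derivative_eq_rhs)
        (simp add: linear_cmul[OF linear_frechet_derivative[OF f]] mult.commute fun_eq_iff)
  qed
  obtain \<xi> where "0 < \<xi>" "\<xi> < h" "f (a + h *\<^sub>R v) - f (a + 0 *\<^sub>R v) = (h - 0) * frechet_derivative f (at (a + \<xi> *\<^sub>R v)) v"
    using MVT2[OF h der] by auto
  then show thesis using that by simp
qed

section \<open>Second derivatives of the weight function and their positivity\<close>

context
  fixes \<phi> :: "complex^'n \<Rightarrow> real"
  assumes smooth: "C_infinity \<phi>"
begin

abbreviation (input) "D1 v x \<equiv> frechet_derivative \<phi> (at x) v"
abbreviation (input) "D2 v w x \<equiv> frechet_derivative (D1 v) (at x) w"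

lemma smooth_C_k_1: "C_k 1 \<phi>" and D1_C_k_1: "C_k 1 (D1 v)"
proof -
  have "C_k (Suc 1) \<phi>" using smooth C_infinity_def by blast
  then show "C_k 1 (D1 v)" by (simp only: C_k.simps)
  show "C_k 1 \<phi>" using smooth C_infinity_def by blast
qed

lemma D1_linear: "linear (\<lambda>v. D1 v x)" and D2_linear: "linear (\<lambda>w. D2 v w x)"
  by (rule linear_frechet_derivative C_k_1D smooth_C_k_1 D1_C_k_1)+

lemma D2_add_left: "D2 (u + v) w x = D2 u w x + D2 v w x"
proof -
  have "D1 (u + v) = (\<lambda>x. D1 u x + D1 v x)" by (rule ext) (rule linear_add[OF D1_linear])
  moreover have der: "((\<lambda>x. D1 u x + D1 v x) has_derivative (\<lambda>w. D2 u w x + D2 v w x)) (at x)"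
    by (intro has_derivative_add C_k_1D D1_C_k_1)
  ultimately show ?thesis using fun_cong[OF frechet_derivative_at[OF der], of w] by simp
qed

lemma D2_scale_left: "D2 (c *\<^sub>R v) w x = c * D2 v w x"
proof -
  have "D1 (c *\<^sub>R v) = (\<lambda>x. c * D1 v x)" by (rule ext) (simp add: linear_cmul[OF D1_linear])
  moreover have der: "((\<lambda>x. c * D1 v x) has_derivative (\<lambda>w. c * D2 v w x)) (at x)"
    by (intro has_derivative_mult_right C_k_1D D1_C_k_1)
  ultimately show ?thesis using fun_cong[OF frechet_derivative_at[OF der], of w] by simp
qed

text \<open>The second difference is symmetric in \<open>v\<close> and \<open>w\<close>, while two
  applications of the mean value theorem express it by \<open>D2 v w\<close> at a nearby point.
  Exchanging the roles gives \<open>D2_sym\<close>.\<close>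

lemma D2_second_difference:
  assumes h: "h > 0"
  obtains s t where "0 < s" "s < h" "0 < t" "t < h"
    "\<phi> (a + h *\<^sub>R v + h *\<^sub>R w) - \<phi> (a + h *\<^sub>R v) - \<phi> (a + h *\<^sub>R w) + \<phi> a = h\<^sup>2 * D2 v w (a + s *\<^sub>R v + t *\<^sub>R w)"
proof -
  define g where "g x = \<phi> (h *\<^sub>R w + x) - \<phi> x" for x
  have gd: "(g has_derivative (\<lambda>v. D1 v (h *\<^sub>R w + x) - D1 v x)) (at x)" for x
    unfolding g_def
    by (intro has_derivative_diff has_derivative_compose[OF _ C_k_1D(2)[OF smooth_C_k_1]] C_k_1D(2)[OF smooth_C_k_1])
       (auto intro!: derivative_eq_intros)
  then have gdiff: "g differentiable (at x)" for x unfolding differentiable_def by blast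
  have gfr: "frechet_derivative g (at x) v = D1 v (h *\<^sub>R w + x) - D1 v x" for x
    using fun_cong[OF frechet_derivative_at[OF gd, symmetric], of x v] .
  obtain s where s: "0 < s" "s < h" "g (a + h *\<^sub>R v) - g a = h * frechet_derivative g (at (a + s *\<^sub>R v)) v"
    by (rule mean_value_difference[OF gdiff h])
  obtain t where t: "0 < t" "t < h" "D1 v (a + s *\<^sub>R v + h *\<^sub>R w) - D1 v (a + s *\<^sub>R v) = h * D2 v w (a + s *\<^sub>R v + t *\<^sub>R w)"
    by (rule mean_value_difference[OF C_k_1D(1)[OF D1_C_k_1] h])
  have "g (a + h *\<^sub>R v) - g a = h * (h * D2 v w (a + s *\<^sub>R v + t *\<^sub>R w))"
    unfolding s(3) gfr t(3)[symmetric] by (simp add: add_ac)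
  then have "\<phi> (a + h *\<^sub>R v + h *\<^sub>R w) - \<phi> (a + h *\<^sub>R v) - \<phi> (a + h *\<^sub>R w) + \<phi> a = h\<^sup>2 * D2 v w (a + s *\<^sub>R v + t *\<^sub>R w)"
    unfolding g_def by (simp add: add_ac power2_eq_square)
  then show thesis using that s t by blast
qed

lemma D2_continuous: "continuous_on S (D2 v w)"
  by (rule C_k_1D(3)[OF D1_C_k_1])

lemma D2_near:
  assumes "e > 0"
  obtains d where "d > 0" "\<And>x. dist x a < d \<Longrightarrow> \<bar>D2 v w x - D2 v w a\<bar> < e"
proof -
  have "\<exists>d>0. \<forall>x\<in>UNIV. dist x a < d \<longrightarrow> dist (D2 v w x) (D2 v w a) < e"
    using D2_continuous[of UNIV v w] assms unfolding continuous_on_iff by blast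
  then show thesis using that by (auto simp: dist_real_def)
qed

lemma D2_sym: "D2 v w a = D2 w v a"
proof (rule ccontr)
  assume ne: "D2 v w a \<noteq> D2 w v a"
  define e where "e = \<bar>D2 v w a - D2 w v a\<bar> / 2"
  have e: "e > 0" using ne by (simp add: e_def)
  obtain d1 where d1: "d1 > 0" "\<And>x. dist x a < d1 \<Longrightarrow> \<bar>D2 v w x - D2 v w a\<bar> < e"
      using D2_near[OF e, where v="v" and w="w" and a=a] by blast
  obtain d2 where d2: "d2 > 0" "\<And>x. dist x a < d2 \<Longrightarrow> \<bar>D2 w v x - D2 w v a\<bar> < e"
      using D2_near[OF e, where v="w" and w="v" and a=a] by blast
  \<comment> \<open>So small that all intermediate points lie within both radii; the added 1 keeps
    the denominator positive.\<close>
  define h where "h = min d1 d2 / (norm v + norm w + 1)"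
  have h: "h > 0" using d1 d2 by (simp add: h_def add_nonneg_pos)
  have near: "dist (a + s *\<^sub>R x + t *\<^sub>R y) a < min d1 d2"
    if "0 < s" "s < h" "0 < t" "t < h" "norm x + norm y = norm v + norm w" for s t x y
  proof -
    have "dist (a + s *\<^sub>R x + t *\<^sub>R y) a \<le> norm (s *\<^sub>R x) + norm (t *\<^sub>R y)"
      using norm_triangle_ineq[of "s *\<^sub>R x" "t *\<^sub>R y"] by (simp add: dist_norm add.assoc)
    also have "\<dots> \<le> h * norm x + h * norm y"
      using that by (intro add_mono) (auto intro: mult_right_mono)
    also have "\<dots> = h * (norm v + norm w)" using that(5) by (simp add: distrib_left[symmetric])
    also have "\<dots> < h * (norm v + norm w + 1)" using h by simp
    also have "\<dots> = min d1 d2" unfolding h_def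
      by (simp add: add_nonneg_pos less_imp_neq[symmetric])
    finally show ?thesis .
  qed
  obtain s t where st: "0 < s" "s < h" "0 < t" "t < h"
    "\<phi> (a + h *\<^sub>R v + h *\<^sub>R w) - \<phi> (a + h *\<^sub>R v) - \<phi> (a + h *\<^sub>R w) + \<phi> a = h\<^sup>2 * D2 v w (a + s *\<^sub>R v + t *\<^sub>R w)"
    by (rule D2_second_difference[OF h])
  obtain s' t' where st': "0 < s'" "s' < h" "0 < t'" "t' < h"
    "\<phi> (a + h *\<^sub>R w + h *\<^sub>R v) - \<phi> (a + h *\<^sub>R w) - \<phi> (a + h *\<^sub>R v) + \<phi> a = h\<^sup>2 * D2 w v (a + s' *\<^sub>R w + t' *\<^sub>R v)"
    by (rule D2_second_difference[OF h])
  have "h\<^sup>2 * D2 v w (a + s *\<^sub>R v + t *\<^sub>R w) = h\<^sup>2 * D2 w v (a + s' *\<^sub>R w + t' *\<^sub>R v)"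
    unfolding st(5)[symmetric] st'(5)[symmetric] by (simp add: add_ac)
  then have "D2 v w (a + s *\<^sub>R v + t *\<^sub>R w) = D2 w v (a + s' *\<^sub>R w + t' *\<^sub>R v)" using h by simp
  moreover have "\<bar>D2 v w (a + s *\<^sub>R v + t *\<^sub>R w) - D2 v w a\<bar> < e" using near[OF st(1-4)] by (intro d1) auto
  moreover have "\<bar>D2 w v (a + s' *\<^sub>R w + t' *\<^sub>R v) - D2 w v a\<bar> < e" using near[OF st'(1-4)] by (intro d2) auto
  ultimately have "\<bar>D2 v w a - D2 w v a\<bar> < 2 * e" by linarith
  then show False unfolding e_def by simp
qed

lemma taylor2:
  assumes r: "r > 0"
  obtains \<xi> where "0 < \<xi>" "\<xi> < r" "\<phi> (a + r *\<^sub>R v) = \<phi> a + r * D1 v a + r\<^sup>2 / 2 * D2 v v (a + \<xi> *\<^sub>R v)"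
proof -
  have line: "((\<lambda>t. a + t *\<^sub>R v) has_derivative (\<lambda>h. h *\<^sub>R v)) (at t)" for t
    by (auto intro!: derivative_eq_intros)
  have d0: "((\<lambda>t. \<phi> (a + t *\<^sub>R v)) has_real_derivative D1 v (a + t *\<^sub>R v)) (at t)" for t
    using has_derivative_compose[OF line C_k_1D(2)[OF smooth_C_k_1]] unfolding has_field_derivative_def
    by (rule has_derivative_eq_rhs) (simp add: linear_cmul[OF D1_linear] mult.commute fun_eq_iff)
  have d1: "((\<lambda>t. D1 v (a + t *\<^sub>R v)) has_real_derivative D2 v v (a + t *\<^sub>R v)) (at t)" for t
    using has_derivative_compose[OF line C_k_1D(2)[OF D1_C_k_1]] unfolding has_field_derivative_def
    by (rule has_derivative_eq_rhs) (simp add: linear_cmul[OF D2_linear] mult.commute fun_eq_iff)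
  define df where "df m = (if m = 0 then (\<lambda>t. \<phi> (a + t *\<^sub>R v)) else if m = 1 then (\<lambda>t. D1 v (a + t *\<^sub>R v))
     else (\<lambda>t. D2 v v (a + t *\<^sub>R v)))" for m :: nat
  have "\<forall>m t. m < 2 \<and> 0 \<le> t \<and> t \<le> r \<longrightarrow> DERIV (df m) t :> df (Suc m) t"
    using d0 d1 by (auto simp: df_def less_2_cases_iff)
  from Maclaurin[OF r _ _ this, of "\<lambda>t. \<phi> (a + t *\<^sub>R v)"]
  obtain \<xi> where "0 < \<xi>" "\<xi> < r" "\<phi> (a + r *\<^sub>R v) = (\<Sum>m<2. df m 0 / fact m * r ^ m) + df 2 \<xi> / fact 2 * r\<^sup>2"
    by (auto simp: df_def)
  then show thesis using that by (simp add: df_def numeral_2_eq_2 mult_ac)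
qed

text \<open>The left side is the Laplacian of \<open>\<phi>\<close> on the complex line in direction
  \<open>w\<close>. By Taylor's formula the mean over a small circle exceeds the value at the centre
  by a positive multiple of it, up to a small error, and the sub-mean value property forbids a
  negative excess.\<close>

lemma levi_nonneg:
  assumes psh: "plurisubharmonic \<phi>"
  shows "D2 w w a + D2 (\<i> *s w) (\<i> *s w) a \<ge> 0"
proof -
  let ?J = "\<i> *s w"
  have "D2 w w a + D2 ?J ?J a \<ge> 0 - e" if e: "e > 0" for e
  proof -
    \<comment> \<open>The errors add up to \<open>8 * \<epsilon>\<close> in the averaged
      inequality.\<close>
    define \<epsilon> where "\<epsilon> = e / 8"
    have \<epsilon>: "\<epsilon> > 0" using e by (simp add: \<epsilon>_def)
    obtain d1 where d1: "d1 > 0" "\<And>x. dist x a < d1 \<Longrightarrow> \<bar>D2 w w x - D2 w w a\<bar> < \<epsilon>"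
      using D2_near[OF \<epsilon>, where v="w" and w="w" and a=a] by blast
    obtain d2 where d2: "d2 > 0" "\<And>x. dist x a < d2 \<Longrightarrow> \<bar>D2 w ?J x - D2 w ?J a\<bar> < \<epsilon>"
      using D2_near[OF \<epsilon>, where v="w" and w="?J" and a=a] by blast
    obtain d3 where d3: "d3 > 0" "\<And>x. dist x a < d3 \<Longrightarrow> \<bar>D2 ?J ?J x - D2 ?J ?J a\<bar> < \<epsilon>"
      using D2_near[OF \<epsilon>, where v="?J" and w="?J" and a=a] by blast
    define d where "d = min d1 (min d2 d3)"
    have d: "d > 0" using d1 d2 d3 by (simp add: d_def)
    define r where "r = d / (norm w + norm ?J + 1)"
    have r: "r > 0" using d by (simp add: r_def add_nonneg_pos)
    define A B C p q where "A = D2 w w a" and "B = 2 * D2 w ?J a" and "C = D2 ?J ?J a" and "p = D1 w a" and "q = D1 ?J a"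
    \<comment> \<open>A majorant of \<open>\<phi>\<close> on the circle: the second derivatives are
      frozen at the centre, and \<open>4 * \<epsilon>\<close> pays for this with \<epsilon>,
      \<open>2 * \<epsilon>\<close> and \<epsilon> for the three terms of the quadratic
      form.\<close>
    define b where "b t = \<phi> a + r * (cos t * p + sin t * q) + r\<^sup>2 / 2 * ((cos t)\<^sup>2 * A + cos t * sin t * B + (sin t)\<^sup>2 * C + 4 * \<epsilon>)" for t
    have bound: "\<phi> (a + cis t *s (r *\<^sub>R w)) \<le> b t" for t
    proof -
      define v where "v = cos t *\<^sub>R w + sin t *\<^sub>R ?J"
      have cv: "cis t *s (r *\<^sub>R w) = r *\<^sub>R v"
        unfolding v_def by (vector cis.code) (auto simp: complex_eq_iff algebra_simps cis.code)
      obtain \<xi> where x: "0 < \<xi>" "\<xi> < r" "\<phi> (a + r *\<^sub>R v) = \<phi> a + r * D1 v a + r\<^sup>2 / 2 * D2 v v (a + \<xi> *\<^sub>R v)"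
        by (rule taylor2[OF r])
      have D1v: "D1 v a = cos t * p + sin t * q"
        unfolding v_def p_def q_def by (simp add: linear_add[OF D1_linear] linear_cmul[OF D1_linear])
      have D2v: "D2 v v x = (cos t)\<^sup>2 * D2 w w x + cos t * sin t * (2 * D2 w ?J x) + (sin t)\<^sup>2 * D2 ?J ?J x" for x
        using D2_sym[of ?J x w]
        unfolding v_def D2_add_left D2_scale_left linear_add[OF D2_linear] linear_cmul[OF D2_linear]
        by (simp add: power2_eq_square algebra_simps)
      have nv: "norm v \<le> norm w + norm ?J"
      proof -
        have "norm v \<le> norm (cos t *\<^sub>R w) + norm (sin t *\<^sub>R ?J)" unfolding v_def by (rule norm_triangle_ineq)
        also have "\<dots> \<le> norm w + norm ?J" by (intro add_mono) (auto simp: mult_left_le_one_le)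
        finally show ?thesis .
      qed
      have "dist (a + \<xi> *\<^sub>R v) a < d"
      proof -
        have "dist (a + \<xi> *\<^sub>R v) a = \<xi> * norm v" using x by (simp add: dist_norm)
        also have "\<dots> \<le> r * (norm w + norm ?J)" using x nv by (intro mult_mono) auto
        also have "\<dots> < r * (norm w + norm ?J + 1)" using r by simp
        also have "\<dots> = d" unfolding r_def by (simp add: add_nonneg_pos less_imp_neq[symmetric])
        finally show ?thesis .
      qed
      then have n: "\<bar>D2 w w (a + \<xi> *\<^sub>R v) - A\<bar> \<le> \<epsilon>" "\<bar>2 * D2 w ?J (a + \<xi> *\<^sub>R v) - B\<bar> \<le> 2 * \<epsilon>" "\<bar>D2 ?J ?J (a + \<xi> *\<^sub>R v) - C\<bar> \<le> \<epsilon>"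
        using d1(2)[of "a + \<xi> *\<^sub>R v"] d2(2)[of "a + \<xi> *\<^sub>R v"] d3(2)[of "a + \<xi> *\<^sub>R v"]
        unfolding d_def A_def B_def C_def by linarith+
      have tle: "c * X \<le> c * Y + k" if "\<bar>X - Y\<bar> \<le> k" "\<bar>c\<bar> \<le> 1" for c X Y k :: real
      proof -
        have "c * (X - Y) \<le> \<bar>c\<bar> * \<bar>X - Y\<bar>" by (metis abs_ge_self abs_mult)
        also have "\<dots> \<le> 1 * k" using that by (intro mult_mono) auto
        finally show ?thesis by (simp add: algebra_simps)
      qed
      have c1: "\<bar>(cos t)\<^sup>2\<bar> \<le> 1" "\<bar>(sin t)\<^sup>2\<bar> \<le> 1" by (simp_all add: abs_square_le_1)
      have c2: "\<bar>cos t * sin t\<bar> \<le> 1" unfolding abs_mult by (intro mult_le_one) auto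
      have "D2 v v (a + \<xi> *\<^sub>R v) \<le> (cos t)\<^sup>2 * A + cos t * sin t * B + (sin t)\<^sup>2 * C + 4 * \<epsilon>"
        unfolding D2v using tle[OF n(1) c1(1)] tle[OF n(2) c2] tle[OF n(3) c1(2)] by linarith
      then have "r\<^sup>2 / 2 * D2 v v (a + \<xi> *\<^sub>R v) \<le> r\<^sup>2 / 2 * ((cos t)\<^sup>2 * A + cos t * sin t * B + (sin t)\<^sup>2 * C + 4 * \<epsilon>)"
        by (rule mult_left_mono) simp
      then show ?thesis unfolding cv x(3) D1v b_def by linarith
    qed
    have bcont: "continuous_on {0..2*pi} b" unfolding b_def by (intro continuous_intros)
    \<comment> \<open>An antiderivative of \<open>b\<close>. Over a full period only the constant,
      the two squares and the error survive.\<close>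
    define U where "U t = (\<phi> a + 2 * r\<^sup>2 * \<epsilon>) * t + r * (sin t * p - cos t * q) +
        r\<^sup>2 / 2 * ((t / 2 + sin t * cos t / 2) * A + (sin t)\<^sup>2 / 2 * B + (t / 2 - sin t * cos t / 2) * C)" for t
    have U: "(U has_real_derivative b t) (at t)" for t
    proof -
      have "(U has_real_derivative ((\<phi> a + 2 * r\<^sup>2 * \<epsilon>) + r * (cos t * p + sin t * q) +
        r\<^sup>2 / 2 * ((1 / 2 + (cos t * cos t - sin t * sin t) / 2) * A + (sin t * cos t) * B + (1 / 2 - (cos t * cos t - sin t * sin t) / 2) * C))) (at t)"
        unfolding U_def by (auto intro!: derivative_eq_intros simp: field_simps)
      moreover have "1 / 2 + (cos t * cos t - sin t * sin t) / 2 = (cos t)\<^sup>2" "1 / 2 - (cos t * cos t - sin t * sin t) / 2 = (sin t)\<^sup>2"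
        using sin_cos_squared_add[of t] by (simp_all add: power2_eq_square field_simps)
      ultimately show ?thesis unfolding b_def by (simp add: algebra_simps)
    qed
    have Ib: "(LINT t:{0..2*pi}|lborel. b t) = U (2 * pi) - U 0"
    proof -
      have "(LBINT t. indicator {0..2*pi} t *\<^sub>R b t) = U (2 * pi) - U 0"
        by (rule integral_FTC_Icc) (use U bcont in \<open>auto intro: has_vector_derivative_at_within simp: has_real_derivative_iff_has_vector_derivative\<close>)
      then show ?thesis by (simp add: set_lebesgue_integral_def)
    qed
    have psh': "set_integrable lborel {0..2*pi} (\<lambda>t. \<phi> (a + cis t *s (r *\<^sub>R w)))"
      "\<phi> a \<le> (LINT t:{0..2*pi}|lborel. \<phi> (a + cis t *s (r *\<^sub>R w))) / (2*pi)"
      using psh unfolding plurisubharmonic_def by blast+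
    have "2 * pi * \<phi> a \<le> (LINT t:{0..2*pi}|lborel. \<phi> (a + cis t *s (r *\<^sub>R w)))"
      using psh'(2) by (simp add: field_simps)
    also have "\<dots> \<le> (LINT t:{0..2*pi}|lborel. b t)"
    proof (rule set_integral_mono[OF psh'(1)])
      show "set_integrable lborel {0..2*pi} b" unfolding set_integrable_def
        by (rule borel_integrable_compact) (auto intro: bcont)
    qed (rule bound)
    also have "\<dots> = 2 * pi * \<phi> a + pi * r\<^sup>2 / 2 * (A + C + 8 * \<epsilon>)"
      unfolding Ib U_def by (simp add: algebra_simps)
    finally have "0 \<le> pi * r\<^sup>2 / 2 * (A + C + 8 * \<epsilon>)" by simp
    moreover have "pi * r\<^sup>2 / 2 > 0" using r by simp
    ultimately have "0 \<le> A + C + 8 * \<epsilon>" by (simp add: zero_le_mult_iff)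
    then show ?thesis unfolding A_def C_def \<epsilon>_def by simp
  qed
  then show ?thesis using field_le_epsilon[of 0 "D2 w w a + D2 ?J ?J a"] by (metis diff_le_eq)
qed

text \<open>The Levi entry is left in terms of \<open>D2\<close>, the imaginary part being the real
  part with \<open>\<i> *s axis j 1\<close> in place of \<open>axis j 1\<close>; this is the shape
  of \<open>H\<close> in \<open>hermitian_form_bound\<close>.\<close>

lemma d_zbar_C_k_1: "C_k 1 (d_zbar j (\<lambda>z. complex_of_real (\<phi> z)))"
  and levi_form: "d_z k (d_zbar j (\<lambda>z. complex_of_real (\<phi> z))) z =
    Complex ((D2 (axis j 1) (axis k 1) z + D2 (\<i> *s axis j 1) (\<i> *s axis k 1) z) / 4)
      ((D2 (\<i> *s axis j 1) (axis k 1) z + D2 (\<i> *s (\<i> *s axis j 1)) (\<i> *s axis k 1) z) / 4)"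
proof -
  have eq: "d_zbar j (\<lambda>z. complex_of_real (\<phi> z)) =
      (\<lambda>z. (of_real (D1 (axis j 1) z) + \<i> * of_real (D1 (axis j \<i>) z)) / 2)"
    unfolding d_zbar_def[abs_def] frechet_derivative_bounded_linear_compose[OF bounded_linear_of_real C_k_1D(1)[OF smooth_C_k_1]] ..
  have der: "((\<lambda>z. (of_real (D1 (axis j 1) z) + \<i> * of_real (D1 (axis j \<i>) z)) / 2) has_derivative
      (\<lambda>w. (of_real (D2 (axis j 1) w z) + \<i> * of_real (D2 (axis j \<i>) w z)) / 2)) (at z)" for z
    by (intro bounded_linear.has_derivative[OF bounded_linear_divide] has_derivative_add has_derivative_mult_right has_derivative_of_real C_k_1D(2) D1_C_k_1)
  show "C_k 1 (d_zbar j (\<lambda>z. complex_of_real (\<phi> z)))" unfolding eq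
    by (rule C_k_1I[OF der]) (intro continuous_intros D2_continuous, simp)
  have fr: "frechet_derivative (d_zbar j (\<lambda>z. complex_of_real (\<phi> z))) (at z) w =
      (of_real (D2 (axis j 1) w z) + \<i> * of_real (D2 (axis j \<i>) w z)) / 2" for w
    unfolding eq using fun_cong[OF frechet_derivative_at[OF der, symmetric]] .
  have ii: "\<i> *s (\<i> *s axis j 1) = ((-1) *\<^sub>R axis j 1 :: complex^'n)" by vector
  show "d_z k (d_zbar j (\<lambda>z. complex_of_real (\<phi> z))) z =
    Complex ((D2 (axis j 1) (axis k 1) z + D2 (\<i> *s axis j 1) (\<i> *s axis k 1) z) / 4)
      ((D2 (\<i> *s axis j 1) (axis k 1) z + D2 (\<i> *s (\<i> *s axis j 1)) (\<i> *s axis k 1) z) / 4)"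
    unfolding d_z_def fr ii D2_scale_left unfolding axis_ii
    by (simp add: complex_eq_iff)
qed

text \<open>With \<open>x\<close> and \<open>y\<close> the moduli of two functions, a mixed Levi
  term is dominated pointwise by two diagonal ones; \<open>x = 1\<close>, \<open>y = 0\<close> shows
  that the diagonal is nonnegative.\<close>

lemma levi_form_bound:
  fixes H
  defines "H \<equiv> \<lambda>j k z. d_z k (d_zbar j (\<lambda>z. complex_of_real (\<phi> z))) z"
  assumes psh: "plurisubharmonic \<phi>" and xy: "x \<ge> 0" "y \<ge> 0"
  shows "2 * cmod (H j k z) * x * y \<le> Re (H j j z) * x\<^sup>2 + Re (H k k z) * y\<^sup>2"
proof -
  define S where "S v w = (D2 v w z + D2 (\<i> *s v) (\<i> *s w) z) / 4" for v w
  have J: "\<i> *s (u + v) = \<i> *s u + \<i> *s v" "\<i> *s (c *\<^sub>R v) = c *\<^sub>R (\<i> *s v)" "\<i> *s (\<i> *s v) = (-1) *\<^sub>R v"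
    for u v :: "complex^'n" and c
    by (vector algebra_simps)+
  have "2 * cmod (H j k z) * x * y \<le> S (axis j 1) (axis j 1) * x\<^sup>2 + S (axis k 1) (axis k 1) * y\<^sup>2"
  proof (rule hermitian_form_bound[where S=S and v="axis j 1" and w="axis k 1"])
    show "S (u + v) w = S u w + S v w" for u v w
      unfolding S_def J D2_add_left by (simp add: field_simps)
    show "S (c *\<^sub>R v) w = c * S v w" for c v w
      unfolding S_def J D2_scale_left by (simp add: field_simps)
    show "S v w = S w v" for v w
      unfolding S_def using D2_sym by simp
    show "S (\<i> *s v) (\<i> *s w) = S v w" for v w
      unfolding S_def J D2_scale_left linear_cmul[OF D2_linear] by simp
    show "S v v \<ge> 0" for v unfolding S_def using levi_nonneg[OF psh] by simp
    show "H j k z = Complex (S (axis j 1) (axis k 1)) (S (\<i> *s axis j 1) (axis k 1))"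
      unfolding H_def levi_form S_def ..
  qed (rule xy)+
  then show ?thesis unfolding H_def levi_form S_def by simp
qed

end

section \<open>Cutoffs and the basic identity\<close>

text \<open>Exponent 2 makes it C^1 with derivative controlled by \<open>bump 1\<close>, its square
  root; the radius \<open>Suc n\<close> is at least 1, which the derivative bounds use.\<close>

definition cutoff :: "nat \<Rightarrow> complex^'n \<Rightarrow> complex" where
  "cutoff n z = of_real (bump 2 (real (Suc n)) z)"

lemma Re_mult_of_real:
  "Re (of_real r * x) = r * Re x" "Re (x * of_real r) = Re x * r"
  by simp_all

lemma C_k_1_cutoff: "C_k 1 (cutoff n)"
  unfolding cutoff_def[abs_def] using C_k_1_of_real[OF C_k_1_bump[of 1]] by (simp add: numeral_2_eq_2)

lemma cutoff_zero: "norm z > real (Suc n) \<Longrightarrow> cutoff n z = 0"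
  by (simp add: cutoff_def bump_zero)

lemma bump_1_le: "R > 0 \<Longrightarrow> bump 1 R z * norm z \<le> R"
proof (cases "norm z > R")
  case False
  assume "R > 0"
  have "bump 1 R z * norm z \<le> 1 * R" using False bump_range[of 1 R z] by (intro mult_mono) auto
  then show ?thesis by simp
qed (simp add: bump_zero)

text \<open>Two kinds of bound for two tasks: decay like \<open>1/R\<close> kills error terms whose
  other factor is integrable, while the bound by \<open>bump 1\<close> permits absorption when
  integrability is not yet known.\<close>

lemma cutoff_derivative_bound:
  "cmod (d_z k (cutoff n) z) \<le> 2 * bump 1 (real (Suc n)) z"
  "cmod (d_zbar k (cutoff n) z) \<le> 2 * bump 1 (real (Suc n)) z"
  "cmod (d_z k (cutoff n) z) \<le> 2 / real (Suc n)"
  "cmod (d_zbar k (cutoff n) z) \<le> 2 / real (Suc n)"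
proof -
  define R where "R = real (Suc n)"
  have R: "R \<ge> 1" by (simp add: R_def)
  define b where "b = bump 1 R z"
  have b: "0 \<le> b" "b * norm z \<le> R" using bump_range[of 1 R z] bump_1_le[of R z] R unfolding b_def by auto
  have "b * cmod (z $ k) \<le> b * norm z" by (intro mult_left_mono Finite_Cartesian_Product.norm_nth_le b)
  also have bz: "\<dots> \<le> R" by (rule b)
  finally have bk: "b * cmod (z $ k) \<le> R" .
  have eq: "cmod (d_z k (cutoff n) z) = 2 * (b * cmod (z $ k)) / R\<^sup>2" "cmod (d_zbar k (cutoff n) z) = 2 * (b * cmod (z $ k)) / R\<^sup>2"
    unfolding cutoff_def[abs_def] R_def[symmetric] b_def numeral_2_eq_2
    using d_zbar_bump[where m=1 and k=k and R=R and z=z] bump_range(1)[of 1 R z]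
    by (simp_all add: norm_mult norm_divide norm_power power2_eq_square)
  \<comment> \<open>On the support, \<open>cmod (z $ k) \<le> R \<le> R\<^sup>2\<close> because
    \<open>R \<ge> 1\<close>.\<close>
  have "b * cmod (z $ k) \<le> b * R\<^sup>2"
  proof (cases "norm z > R")
    case True
    then show ?thesis using R by (simp add: b_def bump_zero)
  next
    case False
    have "cmod (z $ k) \<le> norm z" by (rule Finite_Cartesian_Product.norm_nth_le)
    also have "\<dots> \<le> R * 1" using False by simp
    also have "\<dots> \<le> R * R" using R by (intro mult_left_mono) auto
    finally show ?thesis using b by (intro mult_left_mono) (auto simp: power2_eq_square)
  qed
  then have "2 * (b * cmod (z $ k)) / R\<^sup>2 \<le> 2 * b" using R by (simp add: divide_simps)
  moreover have "2 * (b * cmod (z $ k)) / R\<^sup>2 \<le> 2 / R" using R bk by (simp add: divide_simps power2_eq_square)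
  ultimately show "cmod (d_z k (cutoff n) z) \<le> 2 * bump 1 (real (Suc n)) z"
    "cmod (d_zbar k (cutoff n) z) \<le> 2 * bump 1 (real (Suc n)) z"
    "cmod (d_z k (cutoff n) z) \<le> 2 / real (Suc n)"
    "cmod (d_zbar k (cutoff n) z) \<le> 2 / real (Suc n)"
    unfolding eq b_def R_def by auto
qed

lemma bump_LIMSEQ: "(\<lambda>n. bump m (real (Suc n)) z) \<longlonglongrightarrow> 1"
proof -
  have "(\<lambda>n. max 0 (1 - (z \<bullet> z) * (inverse (real (Suc n)))\<^sup>2) ^ m) \<longlonglongrightarrow> max 0 (1 - (z \<bullet> z) * 0\<^sup>2) ^ m"
    by (intro tendsto_intros LIMSEQ_inverse_real_of_nat)
  then show ?thesis by (simp add: bump_def divide_inverse power_inverse)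
qed

lemma C_k_1_continuous_d_z:
  fixes f :: "complex^'n \<Rightarrow> complex"
  assumes "C_k 1 f"
  shows "continuous_on S (d_z k f)" "continuous_on S (d_zbar k f)"
  unfolding d_z_def[abs_def] d_zbar_def[abs_def] by (intro continuous_intros C_k_1D assms; simp)+

lemma integrable_bounded_mult:
  fixes b h :: "'a::euclidean_space \<Rightarrow> complex"
  assumes b: "continuous_on UNIV b" "\<And>z. cmod (b z) \<le> B" and h: "integrable lborel h"
  shows "integrable lborel (\<lambda>z. b z * h z)"
proof (rule Bochner_Integration.integrable_bound)
  show "integrable lborel (\<lambda>z. of_real B * h z)" using h by simp
  have "b \<in> borel_measurable borel" by (rule borel_measurable_continuous_onI[OF b(1)])
  then show "(\<lambda>z. b z * h z) \<in> borel_measurable lborel" using h by (intro borel_measurable_times) auto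
  have "B \<ge> 0" using b(2) norm_ge_zero order_trans by blast
  then show "AE z in lborel. norm (b z * h z) \<le> norm (of_real B * h z)"
    using b(2) by (intro AE_I2) (auto simp: norm_mult intro: mult_right_mono)
qed

lemma cutoff_bound: "cmod (cutoff n z) \<le> 1"
  unfolding cutoff_def using bump_range[of 2 "real (Suc n)" z] by simp

lemma cutoff_integrable:
  assumes h: "integrable lborel h"
  shows "integrable lborel (\<lambda>z. cutoff n z * h z)" "integrable lborel (\<lambda>z. d_z k (cutoff n) z * h z)"
    "integrable lborel (\<lambda>z. d_zbar k (cutoff n) z * h z)"
  by (rule integrable_bounded_mult[OF _ _ h] C_k_1D(4) C_k_1_continuous_d_z C_k_1_cutoff cutoff_bound cutoff_derivative_bound(3,4))+

lemma cutoff_LIMSEQ: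
  fixes h :: "complex^'n \<Rightarrow> complex"
  assumes h: "integrable lborel h"
  shows "(\<lambda>n. LINT z|lborel. cutoff n z * h z) \<longlonglongrightarrow> (LINT z|lborel. h z)"
    and "(\<lambda>n. LINT z|lborel. d_z k (cutoff n) z * h z) \<longlonglongrightarrow> 0"
    and "(\<lambda>n. LINT z|lborel. d_zbar k (cutoff n) z * h z) \<longlonglongrightarrow> 0"
proof -
  show "(\<lambda>n. LINT z|lborel. cutoff n z * h z) \<longlonglongrightarrow> (LINT z|lborel. h z)"
  proof (rule integral_dominated_convergence[where w="\<lambda>z. cmod (h z)"])
    show "AE z in lborel. (\<lambda>n. cutoff n z * h z) \<longlonglongrightarrow> h z"
    proof (rule AE_I2)
      fix z
      have "(\<lambda>n. cutoff n z * h z) \<longlonglongrightarrow> of_real 1 * h z"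
        unfolding cutoff_def by (intro tendsto_intros bump_LIMSEQ)
      then show "(\<lambda>n. cutoff n z * h z) \<longlonglongrightarrow> h z" by simp
    qed
    show "AE z in lborel. norm (cutoff n z * h z) \<le> cmod (h z)" for n
      by (intro AE_I2) (simp add: norm_mult mult_left_le_one_le cutoff_bound)
  qed (use h cutoff_integrable(1)[OF h] in auto)
  have der: "(\<lambda>n. LINT z|lborel. b n z * h z) \<longlonglongrightarrow> 0"
    if b: "\<And>n z. cmod (b n z) \<le> 2 / real (Suc n)" and i: "\<And>n. integrable lborel (\<lambda>z. b n z * h z)"
    for b :: "nat \<Rightarrow> complex^'n \<Rightarrow> complex"
  proof (rule Lim_null_comparison)
    show "(\<lambda>n. 2 * inverse (real (Suc n)) * (LINT z|lborel. cmod (h z))) \<longlonglongrightarrow> 0"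
      using tendsto_mult_left_zero[OF tendsto_mult_right_zero[OF LIMSEQ_inverse_real_of_nat, of 2]] by simp
    show "\<forall>\<^sub>F n in sequentially. norm (LINT z|lborel. b n z * h z) \<le> 2 * inverse (real (Suc n)) * (LINT z|lborel. cmod (h z))"
    proof (intro always_eventually allI)
      fix n
      have "norm (LINT z|lborel. b n z * h z) \<le> (LINT z|lborel. norm (b n z * h z))" by (rule integral_norm_bound)
      also have "\<dots> \<le> (LINT z|lborel. 2 / real (Suc n) * cmod (h z))"
      proof (rule integral_mono)
        show "norm (b n z * h z) \<le> 2 / real (Suc n) * cmod (h z)" for z
          unfolding norm_mult by (intro mult_right_mono b) simp
      qed (use h i in \<open>auto intro: integrable_norm\<close>)
      finally show "norm (LINT z|lborel. b n z * h z) \<le> 2 * inverse (real (Suc n)) * (LINT z|lborel. cmod (h z))"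
        by (simp add: divide_inverse)
    qed
  qed
  show "(\<lambda>n. LINT z|lborel. d_z k (cutoff n) z * h z) \<longlonglongrightarrow> 0"
    "(\<lambda>n. LINT z|lborel. d_zbar k (cutoff n) z * h z) \<longlonglongrightarrow> 0"
    by (intro der cutoff_derivative_bound cutoff_integrable h)+
qed

section \<open>Integration by parts against the weight\<close>

context
  fixes \<phi> :: "complex^'n \<Rightarrow> real"
  assumes smooth: "C_infinity \<phi>"
begin

abbreviation (input) "dphi j \<equiv> d_zbar j (\<lambda>z. complex_of_real (\<phi> z))"
abbreviation (input) "levi j k \<equiv> d_z k (d_zbar j (\<lambda>z. complex_of_real (\<phi> z)))"
abbreviation (input) "weight z \<equiv> complex_of_real (exp (- \<phi> z))"

lemma cnj_dphi: "cnj (dphi k z) = d_z k (\<lambda>z. complex_of_real (\<phi> z)) z"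
  by (rule d_z_of_real[OF C_k_1D(1)[OF smooth_C_k_1[OF smooth]]])

lemma cont_phi: "continuous_on UNIV \<phi>"
  by (rule C_k_1D(4)[OF smooth_C_k_1[OF smooth]])

lemma C_k_1_weight: "C_k 1 weight"
  and d_z_weight: "d_z k weight z = - cnj (dphi k z) * weight z"
  and d_zbar_weight: "d_zbar k weight z = - dphi k z * weight z"
  using weight_derivative[OF smooth_C_k_1[OF smooth]] unfolding cnj_dphi by auto

text \<open>Multiplication by \<open>dphi j\<close> is the formal adjoint of \<open>d_z j\<close>:
  as \<open>d_z j\<close> annihilates \<open>cnj g\<close>, the derivative moved off
  \<open>f\<close> falls on the weight alone. The product with \<open>dphi j\<close> need not be
  entire, which is why the projection appears in \<open>del_adj_eq\<close>.\<close>

lemma inner_w_d_z: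
  assumes f: "f \<in> A2 \<phi>" and f': "d_z j f \<in> L2 \<phi>" and g: "g \<in> A2 \<phi>" and Fg: "(\<lambda>z. dphi j z * g z) \<in> L2 \<phi>"
  shows "inner_w \<phi> (d_z j f) g = inner_w \<phi> f (\<lambda>z. dphi j z * g z)"
proof -
  note fL = A2_L2[OF cont_phi f] and gL = A2_L2[OF cont_phi g]
  note ef = A2_entire[OF cont_phi f] and eg = A2_entire[OF cont_phi g]
  note i1 = L2_integrable_mult[OF cont_phi fL gL] and i2 = L2_integrable_mult[OF cont_phi f' gL]
    and i3 = L2_integrable_mult[OF cont_phi fL Fg]
  let ?A = "\<lambda>n z. cutoff n z * (f z * (cnj (g z) * weight z))"
  have C: "C_k 1 (\<lambda>z. cnj (g z) * weight z)" by (intro C_k_1_mult C_k_1_cnj C_k_1_entire eg C_k_1_weight)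
  have C': "C_k 1 (\<lambda>z. f z * (cnj (g z) * weight z))" by (intro C_k_1_mult C C_k_1_entire ef)
  have CA: "C_k 1 (?A n)" for n by (intro C_k_1_mult C_k_1_cutoff C')
  have dA: "d_z j (?A n) z = d_z j (cutoff n) z * (f z * cnj (g z) * weight z)
      + cutoff n z * (d_z j f z * cnj (g z) * weight z) - cutoff n z * (f z * cnj (dphi j z * g z) * weight z)" for n z
    unfolding d_z_mult(1)[OF C_k_1D(1)[OF C_k_1_cutoff] C_k_1D(1)[OF C']]
      d_z_mult(1)[OF C_k_1D(1)[OF C_k_1_entire[OF ef]] C_k_1D(1)[OF C]]
      d_z_mult(1)[OF C_k_1D(1)[OF C_k_1_cnj[OF C_k_1_entire[OF eg]]] C_k_1D(1)[OF C_k_1_weight]]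
      d_z_cnj(1)[OF C_k_1D(1)[OF C_k_1_entire[OF eg]]] d_zbar_entire[OF eg] d_z_weight
    by (simp add: algebra_simps)
  have "(LINT z|lborel. d_z j (cutoff n) z * (f z * cnj (g z) * weight z))
     + (LINT z|lborel. cutoff n z * (d_z j f z * cnj (g z) * weight z))
     - (LINT z|lborel. cutoff n z * (f z * cnj (dphi j z * g z) * weight z)) = 0" for n
  proof -
    have "(LINT z|lborel. d_z j (?A n) z) = 0"
      by (rule integral_d_z_zero(2)[OF CA, of "real (Suc n)"]) (simp add: cutoff_zero del: of_nat_Suc)
    then show ?thesis unfolding dA
      by (simp only: Bochner_Integration.integral_add Bochner_Integration.integral_diff Bochner_Integration.integrable_add
          cutoff_integrable[OF i1] cutoff_integrable[OF i2] cutoff_integrable[OF i3])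
  qed
  moreover have "(\<lambda>n. (LINT z|lborel. d_z j (cutoff n) z * (f z * cnj (g z) * weight z))
     + (LINT z|lborel. cutoff n z * (d_z j f z * cnj (g z) * weight z))
     - (LINT z|lborel. cutoff n z * (f z * cnj (dphi j z * g z) * weight z)))
     \<longlonglongrightarrow> 0 + inner_w \<phi> (d_z j f) g - inner_w \<phi> f (\<lambda>z. dphi j z * g z)"
    unfolding inner_w_def by (intro tendsto_intros cutoff_LIMSEQ i1 i2 i3)
  ultimately have "(\<lambda>n. 0 :: complex) \<longlonglongrightarrow> 0 + inner_w \<phi> (d_z j f) g - inner_w \<phi> f (\<lambda>z. dphi j z * g z)" by simp
  then have "0 = 0 + inner_w \<phi> (d_z j f) g - inner_w \<phi> f (\<lambda>z. dphi j z * g z)"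
    by (rule LIMSEQ_unique[OF tendsto_const])
  then show ?thesis by simp
qed

lemma continuous_on_levi: "continuous_on S (levi j k)"
  by (rule C_k_1_continuous_d_z(1)[OF d_zbar_C_k_1[OF smooth]])

text \<open>The sum of the \<open>z\<^sub>k\<close>-derivative of \<open>cutoff n * dphi j * f * cnj g * weight\<close> and the \<open>z\<^sub>j\<close>-bar derivative of \<open>cutoff n * d_z k f * cnj g * weight\<close>; the terms containing \<open>dphi j * d_z k f\<close> cancel.\<close>

definition kohn_integrand where
  "kohn_integrand n j k f g z =
     d_z k (cutoff n) z * (dphi j z * f z * cnj (g z) * weight z)
     + cutoff n z * (levi j k z * f z * cnj (g z) * weight z)
     - cutoff n z * (dphi j z * f z * cnj (dphi k z * g z) * weight z)
     + d_zbar j (cutoff n) z * (d_z k f z * cnj (g z) * weight z)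
     + cutoff n z * (d_z k f z * cnj (d_z j g z) * weight z)"

lemma integral_kohn_integrand:
  assumes ef: "entire f" and eg: "entire g"
  shows "integrable lborel (kohn_integrand n j k f g)" "(LINT z|lborel. kohn_integrand n j k f g z) = 0"
proof -
  note d = C_k_1D(1)
  note Cc = C_k_1_cutoff and Cf = C_k_1_entire[OF ef] and Cg = C_k_1_entire[OF eg] and Cf' = C_k_1_entire[OF entire_d_z[OF ef]]
    and CP = d_zbar_C_k_1[OF smooth]
  let ?A = "\<lambda>z. cutoff n z * ((dphi j z * f z) * (cnj (g z) * weight z))"
  let ?B = "\<lambda>z. cutoff n z * (d_z k f z * (cnj (g z) * weight z))"
  have C: "C_k 1 (\<lambda>z. cnj (g z) * weight z)" by (intro C_k_1_mult C_k_1_cnj Cg C_k_1_weight)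
  have C1: "C_k 1 (\<lambda>z. dphi j z * f z)" by (intro C_k_1_mult CP Cf)
  have C2: "C_k 1 (\<lambda>z. (dphi j z * f z) * (cnj (g z) * weight z))" by (intro C_k_1_mult C C1)
  have C3: "C_k 1 (\<lambda>z. d_z k f z * (cnj (g z) * weight z))" by (intro C_k_1_mult C Cf')
  have CA: "C_k 1 ?A" and CB: "C_k 1 ?B" by (intro C_k_1_mult Cc C2 C3)+
  have zA: "norm z > real (Suc n) \<Longrightarrow> ?A z = 0" and zB: "norm z > real (Suc n) \<Longrightarrow> ?B z = 0" for z
    by (simp_all add: cutoff_zero del: of_nat_Suc)
  have dA: "d_z k ?A z = d_z k (cutoff n) z * (dphi j z * f z * cnj (g z) * weight z)
      + cutoff n z * ((levi j k z * f z + dphi j z * d_z k f z) * cnj (g z) * weight z)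
      - cutoff n z * (dphi j z * f z * cnj (dphi k z * g z) * weight z)" for z
    unfolding d_z_mult(1)[OF d[OF Cc] d[OF C2]] d_z_mult(1)[OF d[OF C1] d[OF C]] d_z_mult(1)[OF d[OF CP] d[OF Cf]]
      d_z_mult(1)[OF d[OF C_k_1_cnj[OF Cg]] d[OF C_k_1_weight]] d_z_cnj(1)[OF d[OF Cg]] d_zbar_entire[OF eg] d_z_weight
    by (simp add: algebra_simps)
  have dB: "d_zbar j ?B z = d_zbar j (cutoff n) z * (d_z k f z * cnj (g z) * weight z)
      + cutoff n z * (d_z k f z * cnj (d_z j g z) * weight z)
      - cutoff n z * (dphi j z * d_z k f z * cnj (g z) * weight z)" for z
    unfolding d_z_mult(2)[OF d[OF Cc] d[OF C3]] d_z_mult(2)[OF d[OF Cf'] d[OF C]]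
      d_z_mult(2)[OF d[OF C_k_1_cnj[OF Cg]] d[OF C_k_1_weight]] d_z_cnj(2)[OF d[OF Cg]] d_zbar_entire[OF entire_d_z[OF ef]] d_zbar_weight
    by (simp add: algebra_simps)
  have eq: "kohn_integrand n j k f g = (\<lambda>z. d_z k ?A z + d_zbar j ?B z)"
    unfolding dA dB kohn_integrand_def[abs_def] by (rule ext) (simp add: algebra_simps)
  show "integrable lborel (kohn_integrand n j k f g)" "(LINT z|lborel. kohn_integrand n j k f g z) = 0"
    unfolding eq using integral_d_z_zero(1,2)[where k=k, OF CA zA] integral_d_z_zero(3,4)[where k=j, OF CB zB]
    by (simp_all add: Bochner_Integration.integrable_add Bochner_Integration.integral_add)
qed

text \<open>Since the derivative of a cutoff is at most twice its square root, the error term containing \<open>d_z k f\<close> is absorbed by \<open>cutoff n * (cmod (d_z k f))\<^sup>2\<close>. The other appearance of \<open>d_z k f\<close> is split as \<open>2 Re (a * cnj b) = (cmod a)\<^sup>2 + (cmod b)\<^sup>2 - (cmod (a - b))\<^sup>2\<close>, where the last term is a coefficient of \<open>\<partial>u\<close>.\<close>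

lemma kohn_estimate:
  assumes f: "f \<in> A2 \<phi>" and g: "g \<in> A2 \<phi>"
    and Ff: "(\<lambda>z. dphi j z * f z) \<in> L2 \<phi>" and Fg: "(\<lambda>z. dphi k z * g z) \<in> L2 \<phi>"
    and ab: "(\<lambda>z. d_z k f z - d_z j g z) \<in> L2 \<phi>"
  obtains C where "\<And>n. (LINT z|lborel. bump 2 (real (Suc n)) z * ((cmod (d_z k f z))\<^sup>2 * exp (- \<phi> z)) / 4
      + Re (cutoff n z * (levi j k z * f z * cnj (g z) * weight z))) \<le> C"
    "\<And>n. integrable lborel (\<lambda>z. bump 2 (real (Suc n)) z * ((cmod (d_z k f z))\<^sup>2 * exp (- \<phi> z)))"
    "\<And>n. integrable lborel (\<lambda>z. Re (cutoff n z * (levi j k z * f z * cnj (g z) * weight z)))"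
proof -
  note fL = A2_L2[OF cont_phi f] and gL = A2_L2[OF cont_phi g]
  note ef = A2_entire[OF cont_phi f] and eg = A2_entire[OF cont_phi g]
  \<comment> \<open>The coefficients collect \<open>t1\<close> to \<open>t4\<close> below:
    \<open>3/2 = 1 + 1/2\<close> for \<open>p\<close> and \<open>5 = 1 + 4\<close> for
    \<open>y\<close>. For \<open>a\<close>, \<open>t4\<close> offers \<open>1/2\<close> and the
    absorption in \<open>t2\<close> uses \<open>1/4\<close>; the remaining \<open>1/4\<close> is
    kept on the left.\<close>
  define G where "G z = ((cmod (d_z k f z - d_z j g z))\<^sup>2 * exp (- \<phi> z)) / 2 + 3/2 * ((cmod (dphi j z * f z))\<^sup>2 * exp (- \<phi> z))
    + ((cmod (dphi k z * g z))\<^sup>2 * exp (- \<phi> z)) / 2 + 5 * ((cmod (g z))\<^sup>2 * exp (- \<phi> z))" for z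
  have G: "integrable lborel G" unfolding G_def
    by (intro Bochner_Integration.integrable_add integrable_divide integrable_mult_right L2_D ab Ff Fg gL)
  have int1: "integrable lborel (\<lambda>z. bump 2 (real (Suc n)) z * ((cmod (d_z k f z))\<^sup>2 * exp (- \<phi> z)))" for n
    by (rule integrable_compact_support[where R="real (Suc n)"])
       (auto intro!: continuous_intros continuous_on_bump continuous_on_d_z_entire ef cont_phi simp: bump_zero simp del: of_nat_Suc)
  have "integrable lborel (\<lambda>z. cutoff n z * (levi j k z * f z * cnj (g z) * weight z))" for n
    by (rule integrable_compact_support[where R="real (Suc n)"])
       (auto intro!: continuous_intros C_k_1D(4)[OF C_k_1_cutoff] continuous_on_levi entire_continuous[OF ef] entire_continuous[OF eg] cont_phi
         simp: cutoff_zero simp del: of_nat_Suc)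
  then have int2: "integrable lborel (\<lambda>z. Re (cutoff n z * (levi j k z * f z * cnj (g z) * weight z)))" for n
    by (rule integrable_Re)
  have "(LINT z|lborel. bump 2 (real (Suc n)) z * ((cmod (d_z k f z))\<^sup>2 * exp (- \<phi> z)) / 4
      + Re (cutoff n z * (levi j k z * f z * cnj (g z) * weight z))) \<le> (LINT z|lborel. G z)" for n
  proof -
    let ?I = "kohn_integrand n j k f g"
    note I = integral_kohn_integrand[OF ef eg, of n j k]
    have "(LINT z|lborel. bump 2 (real (Suc n)) z * ((cmod (d_z k f z))\<^sup>2 * exp (- \<phi> z)) / 4
      + Re (cutoff n z * (levi j k z * f z * cnj (g z) * weight z))) \<le> (LINT z|lborel. Re (?I z) + G z)"
    proof (rule integral_mono)
      fix z
      define e where "e = exp (- \<phi> z)"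
      define c where "c = bump 1 (real (Suc n)) z"
      have e: "e > 0" by (simp add: e_def)
      have c: "0 \<le> c" "c \<le> 1" unfolding c_def by (rule bump_range)+
      have c2: "bump 2 (real (Suc n)) z = c\<^sup>2" by (simp add: c_def bump_def)
      have cc: "cutoff n z = of_real (c\<^sup>2)" unfolding cutoff_def c2 ..
      have c21: "0 \<le> c\<^sup>2" "c\<^sup>2 \<le> 1" using c by (auto simp: power_le_one)
      define a b p q y h D D' where "a = d_z k f z" and "b = d_z j g z" and "p = dphi j z * f z" and "q = dphi k z * g z"
        and "y = g z" and "h = levi j k z * f z * cnj (g z)" and "D = d_z k (cutoff n) z" and "D' = d_zbar j (cutoff n) z"
      have D: "cmod D \<le> 2 * c" "cmod D' \<le> 2 * c" unfolding D_def D'_def c_def by (rule cutoff_derivative_bound)+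
      have ReI: "Re (?I z) = (Re (D * (p * cnj y)) + c\<^sup>2 * Re h - c\<^sup>2 * Re (p * cnj q) + Re (D' * (a * cnj y)) + c\<^sup>2 * Re (a * cnj b)) * e"
      proof -
        have "?I z = (D * (p * cnj y) + of_real (c\<^sup>2) * h - of_real (c\<^sup>2) * (p * cnj q) + D' * (a * cnj y) + of_real (c\<^sup>2) * (a * cnj b)) * of_real e"
          unfolding kohn_integrand_def cc a_def b_def p_def q_def y_def h_def D_def D'_def e_def by (simp add: algebra_simps)
        then show ?thesis by (simp only: Re_mult_of_real plus_complex.sel minus_complex.sel)
      qed
      have ReH: "Re (cutoff n z * (levi j k z * f z * cnj (g z) * weight z)) = c\<^sup>2 * Re h * e"
      proof -
        have "cutoff n z * (levi j k z * f z * cnj (g z) * weight z) = of_real (c\<^sup>2) * h * of_real e"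
          unfolding cc h_def e_def by simp
        then show ?thesis by (simp only: Re_mult_of_real)
      qed
      have t1: "- Re (D * (p * cnj y)) \<le> (cmod p)\<^sup>2 + (cmod y)\<^sup>2"
      proof -
        have "- Re (D * (p * cnj y)) \<le> cmod (D * (p * cnj y))" using abs_Re_le_cmod[of "D * (p * cnj y)"] by linarith
        also have "\<dots> = cmod D * (cmod p * cmod y)" by (simp add: norm_mult)
        also have "\<dots> \<le> 2 * (cmod p * cmod y)" using D c by (intro mult_right_mono) auto
        also have "\<dots> \<le> (cmod p)\<^sup>2 + (cmod y)\<^sup>2" using cmod_mult_le[of p y] by simp
        finally show ?thesis .
      qed
      have t2: "- Re (D' * (a * cnj y)) \<le> c\<^sup>2 * (cmod a)\<^sup>2 / 4 + 4 * (cmod y)\<^sup>2"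
      proof -
        have "- Re (D' * (a * cnj y)) \<le> cmod (D' * (a * cnj y))" using abs_Re_le_cmod[of "D' * (a * cnj y)"] by linarith
        also have "\<dots> = cmod D' * (cmod a * cmod y)" by (simp add: norm_mult)
        also have "\<dots> \<le> 2 * c * (cmod a * cmod y)" using D by (intro mult_right_mono) auto
        \<comment> \<open>The product is split so that \<open>c * cmod a\<close> gets weight
          \<open>1/4\<close> after squaring and the large constant falls on
          \<open>y\<close>.\<close>
        also have "\<dots> = 2 * (c * cmod a / 2) * (2 * cmod y)" by simp
        also have "\<dots> \<le> (c * cmod a / 2)\<^sup>2 + (2 * cmod y)\<^sup>2" by (rule sum_squares_bound)
        also have "\<dots> = c\<^sup>2 * (cmod a)\<^sup>2 / 4 + 4 * (cmod y)\<^sup>2" by (simp add: power_mult_distrib power_divide)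
        finally show ?thesis .
      qed
      have t3: "c\<^sup>2 * Re (p * cnj q) \<le> ((cmod p)\<^sup>2 + (cmod q)\<^sup>2) / 2"
      proof -
        have "c\<^sup>2 * Re (p * cnj q) \<le> c\<^sup>2 * cmod (p * cnj q)" by (intro mult_left_mono complex_Re_le_cmod c21)
        also have "\<dots> \<le> 1 * cmod (p * cnj q)" using c21 by (intro mult_right_mono) auto
        also have "\<dots> \<le> ((cmod p)\<^sup>2 + (cmod q)\<^sup>2) / 2" using cmod_mult_le[of p q] by (simp add: norm_mult)
        finally show ?thesis .
      qed
      have t4: "- (c\<^sup>2 * Re (a * cnj b)) \<le> (cmod (a - b))\<^sup>2 / 2 - c\<^sup>2 * (cmod a)\<^sup>2 / 2"
      proof -
        define r where "r = Re (a * cnj b)"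
        have r: "r = ((cmod a)\<^sup>2 + (cmod b)\<^sup>2 - (cmod (a - b))\<^sup>2) / 2"
          unfolding cmod_power2 r_def by (simp add: power2_eq_square algebra_simps)
        \<comment> \<open>The square of \<open>b\<close> enters with a favourable sign and is
          dropped; for \<open>a - b\<close> the factor \<open>c\<^sup>2\<close> is raised to
          1.\<close>
        have "- (c\<^sup>2 * r) = c\<^sup>2 * (cmod (a - b))\<^sup>2 / 2 - c\<^sup>2 * (cmod a)\<^sup>2 / 2 - c\<^sup>2 * (cmod b)\<^sup>2 / 2"
          unfolding r by (simp add: field_simps)
        moreover have "c\<^sup>2 * (cmod (a - b))\<^sup>2 \<le> 1 * (cmod (a - b))\<^sup>2" using c21 by (intro mult_right_mono) auto
        moreover have "c\<^sup>2 * (cmod b)\<^sup>2 \<ge> 0" by simp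
        ultimately show ?thesis unfolding r_def[symmetric] by linarith
      qed
      have "c\<^sup>2 * (cmod a)\<^sup>2 / 4 + c\<^sup>2 * Re h \<le>
         (Re (D * (p * cnj y)) + c\<^sup>2 * Re h - c\<^sup>2 * Re (p * cnj q) + Re (D' * (a * cnj y)) + c\<^sup>2 * Re (a * cnj b))
          + ((cmod (a - b))\<^sup>2 / 2 + 3/2 * (cmod p)\<^sup>2 + (cmod q)\<^sup>2 / 2 + 5 * (cmod y)\<^sup>2)"
        using t1 t2 t3 t4 by (simp add: add_divide_distrib)
      then have "(c\<^sup>2 * (cmod a)\<^sup>2 / 4 + c\<^sup>2 * Re h) * e \<le>
         ((Re (D * (p * cnj y)) + c\<^sup>2 * Re h - c\<^sup>2 * Re (p * cnj q) + Re (D' * (a * cnj y)) + c\<^sup>2 * Re (a * cnj b))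
          + ((cmod (a - b))\<^sup>2 / 2 + 3/2 * (cmod p)\<^sup>2 + (cmod q)\<^sup>2 / 2 + 5 * (cmod y)\<^sup>2)) * e"
        using e by (intro mult_right_mono) auto
      also have "\<dots> = Re (?I z) + G z"
        unfolding ReI G_def e_def[symmetric] a_def[symmetric] b_def[symmetric] p_def[symmetric] q_def[symmetric]
        unfolding y_def[symmetric]
        by (simp add: algebra_simps)
      finally show "bump 2 (real (Suc n)) z * ((cmod (d_z k f z))\<^sup>2 * exp (- \<phi> z)) / 4
          + Re (cutoff n z * (levi j k z * f z * cnj (g z) * weight z)) \<le> Re (?I z) + G z"
        unfolding ReH unfolding c2 a_def[symmetric] e_def[symmetric] by (simp add: algebra_simps)
    qed (intro Bochner_Integration.integrable_add integrable_divide int1 int2 G integrable_Re I)+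
    also have "\<dots> = (LINT z|lborel. G z)"
      using I by (simp add: Bochner_Integration.integral_add G integrable_Re)
    finally show ?thesis .
  qed
  then show thesis using int1 int2 by (rule that)
qed

lemma levi_term_diagonal:
  assumes psh: "plurisubharmonic \<phi>" and f: "f \<in> A2 \<phi>" and Ff: "(\<lambda>z. dphi j z * f z) \<in> L2 \<phi>"
  shows "integrable lborel (\<lambda>z. Re (levi j j z) * (cmod (f z))\<^sup>2 * exp (- \<phi> z))"
proof -
  \<comment> \<open>With \<open>g = f\<close> and \<open>k = j\<close> the difference of derivatives
    in \<open>kohn_estimate\<close> is identically 0.\<close>
  have 0: "(\<lambda>z. d_z j f z - d_z j f z) \<in> L2 \<phi>" using A2_L2[OF cont_phi A2_zero[OF cont_phi]] by simp
  obtain C where C: "\<And>n. (LINT z|lborel. bump 2 (real (Suc n)) z * ((cmod (d_z j f z))\<^sup>2 * exp (- \<phi> z)) / 4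
      + Re (cutoff n z * (levi j j z * f z * cnj (f z) * weight z))) \<le> C"
    "\<And>n. integrable lborel (\<lambda>z. bump 2 (real (Suc n)) z * ((cmod (d_z j f z))\<^sup>2 * exp (- \<phi> z)))"
    "\<And>n. integrable lborel (\<lambda>z. Re (cutoff n z * (levi j j z * f z * cnj (f z) * weight z)))"
    by (rule kohn_estimate[OF f f Ff Ff 0]) (rule that)
  let ?L = "\<lambda>z. Re (levi j j z) * (cmod (f z))\<^sup>2 * exp (- \<phi> z)"
  have eq: "Re (cutoff n z * (levi j j z * f z * cnj (f z) * weight z)) = bump 2 (real (Suc n)) z * ?L z" for n z
  proof -
    have "cutoff n z * (levi j j z * f z * cnj (f z) * weight z) = of_real (bump 2 (real (Suc n)) z) * (levi j j z * of_real ((cmod (f z))\<^sup>2) * weight z)"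
      unfolding cutoff_def complex_norm_square by (simp add: mult.assoc)
    then show ?thesis by (simp only: Re_mult_of_real)
  qed
  have H0: "Re (levi j j z) \<ge> 0" for z
    using levi_form_bound[OF smooth psh, of 1 0 j j z] norm_ge_zero[of "levi j j z"] by simp
  show ?thesis
  proof (rule integral_Fatou(1))
    show "integrable lborel (\<lambda>z. bump 2 (real (Suc n)) z * ?L z)" for n using C(3)[of n] unfolding eq .
    show "0 \<le> bump 2 (real (Suc n)) z * ?L z" for n z using bump_range H0 by (intro mult_nonneg_nonneg) auto
    show "(\<lambda>n. bump 2 (real (Suc n)) z * ?L z) \<longlonglongrightarrow> ?L z" for z
      using tendsto_mult_right[OF bump_LIMSEQ, of 2 z "?L z"] by simp
    show "\<forall>\<^sub>F n in sequentially. (LINT z|lborel. bump 2 (real (Suc n)) z * ?L z) \<le> C"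
    proof (intro always_eventually allI)
      fix n
      have "(LINT z|lborel. bump 2 (real (Suc n)) z * ?L z) \<le> (LINT z|lborel. bump 2 (real (Suc n)) z * ((cmod (d_z j f z))\<^sup>2 * exp (- \<phi> z)) / 4
      + Re (cutoff n z * (levi j j z * f z * cnj (f z) * weight z)))"
      proof (rule integral_mono)
        show "integrable lborel (\<lambda>z. bump 2 (real (Suc n)) z * ?L z)" using C(3)[of n] unfolding eq .
        show "integrable lborel (\<lambda>z. bump 2 (real (Suc n)) z * ((cmod (d_z j f z))\<^sup>2 * exp (- \<phi> z)) / 4
            + Re (cutoff n z * (levi j j z * f z * cnj (f z) * weight z)))"
          by (intro Bochner_Integration.integrable_add integrable_divide C)
        show "bump 2 (real (Suc n)) z * ?L z \<le> bump 2 (real (Suc n)) z * ((cmod (d_z j f z))\<^sup>2 * exp (- \<phi> z)) / 4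
            + Re (cutoff n z * (levi j j z * f z * cnj (f z) * weight z))" for z
          unfolding eq using bump_range[of 2 "real (Suc n)" z] by simp
      qed
      also have "\<dots> \<le> C" by (rule C)
      finally show "(LINT z|lborel. bump 2 (real (Suc n)) z * ?L z) \<le> C" .
    qed
  qed
qed

lemma levi_term_integrable:
  assumes psh: "plurisubharmonic \<phi>" and f: "f \<in> A2 \<phi>" and g: "g \<in> A2 \<phi>"
    and Ff: "(\<lambda>z. dphi j z * f z) \<in> L2 \<phi>" and Fg: "(\<lambda>z. dphi k z * g z) \<in> L2 \<phi>"
  shows "integrable lborel (\<lambda>z. levi j k z * f z * cnj (g z) * weight z)"
proof (rule Bochner_Integration.integrable_bound)
  let ?L = "\<lambda>z. (Re (levi j j z) * (cmod (f z))\<^sup>2 * exp (- \<phi> z) + Re (levi k k z) * (cmod (g z))\<^sup>2 * exp (- \<phi> z)) / 2"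
  show "integrable lborel ?L"
    by (intro integrable_divide Bochner_Integration.integrable_add levi_term_diagonal psh f g Ff Fg)
  have "continuous_on UNIV (\<lambda>z. levi j k z * f z * cnj (g z) * weight z)"
    by (intro continuous_intros continuous_on_levi entire_continuous[OF A2_entire[OF cont_phi f]] entire_continuous[OF A2_entire[OF cont_phi g]] cont_phi)
  then show "(\<lambda>z. levi j k z * f z * cnj (g z) * weight z) \<in> borel_measurable lborel"
    using borel_measurable_continuous_onI by auto
  show "AE z in lborel. norm (levi j k z * f z * cnj (g z) * weight z) \<le> norm (?L z)"
  proof (rule AE_I2)
    fix z
    have "2 * cmod (levi j k z) * cmod (f z) * cmod (g z) \<le> Re (levi j j z) * (cmod (f z))\<^sup>2 + Re (levi k k z) * (cmod (g z))\<^sup>2"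
      by (rule levi_form_bound[OF smooth psh]) auto
    then have "2 * cmod (levi j k z) * cmod (f z) * cmod (g z) * exp (- \<phi> z) \<le> (Re (levi j j z) * (cmod (f z))\<^sup>2 + Re (levi k k z) * (cmod (g z))\<^sup>2) * exp (- \<phi> z)"
      by (rule mult_right_mono) simp
    then have "norm (levi j k z * f z * cnj (g z) * weight z) \<le> ?L z" by (simp add: norm_mult algebra_simps)
    then show "norm (levi j k z * f z * cnj (g z) * weight z) \<le> norm (?L z)" unfolding real_norm_def using abs_ge_self[of "?L z"] by (rule order_trans)
  qed
qed

text \<open>Once the Levi term is integrable, its cut-off integrals are bounded by its L^1 norm. So
  \<open>kohn_estimate\<close> bounds the cut-off norms of \<open>d_z k f\<close> independently of
  \<open>n\<close>, and Fatou applies.\<close>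

lemma d_z_L2:
  assumes psh: "plurisubharmonic \<phi>" and f: "f \<in> A2 \<phi>" and g: "g \<in> A2 \<phi>"
    and Ff: "(\<lambda>z. dphi j z * f z) \<in> L2 \<phi>" and Fg: "(\<lambda>z. dphi k z * g z) \<in> L2 \<phi>"
    and ab: "(\<lambda>z. d_z k f z - d_z j g z) \<in> L2 \<phi>"
  shows "d_z k f \<in> L2 \<phi>"
proof (rule L2_I)
  show "continuous_on UNIV (d_z k f)" by (rule continuous_on_d_z_entire[OF A2_entire[OF cont_phi f]])
  obtain C where C: "\<And>n. (LINT z|lborel. bump 2 (real (Suc n)) z * ((cmod (d_z k f z))\<^sup>2 * exp (- \<phi> z)) / 4
      + Re (cutoff n z * (levi j k z * f z * cnj (g z) * weight z))) \<le> C"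
    "\<And>n. integrable lborel (\<lambda>z. bump 2 (real (Suc n)) z * ((cmod (d_z k f z))\<^sup>2 * exp (- \<phi> z)))"
    "\<And>n. integrable lborel (\<lambda>z. Re (cutoff n z * (levi j k z * f z * cnj (g z) * weight z)))"
    by (rule kohn_estimate[OF f g Ff Fg ab]) (rule that)
  let ?h = "\<lambda>z. levi j k z * f z * cnj (g z) * weight z"
  let ?L = "\<lambda>z. (cmod (d_z k f z))\<^sup>2 * exp (- \<phi> z)"
  have arith: "x \<le> 4 * (c + y)" if "- w \<le> y" "x / 4 + w \<le> c" for x y w c :: real using that by simp
  have h: "integrable lborel ?h" by (rule levi_term_integrable[OF psh f g Ff Fg])
  show "integrable lborel ?L"
  proof (rule integral_Fatou(1))
    show "integrable lborel (\<lambda>z. bump 2 (real (Suc n)) z * ?L z)" for n by (rule C)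
    show "0 \<le> bump 2 (real (Suc n)) z * ?L z" for n z using bump_range by (intro mult_nonneg_nonneg) auto
    show "(\<lambda>n. bump 2 (real (Suc n)) z * ?L z) \<longlonglongrightarrow> ?L z" for z
      using tendsto_mult_right[OF bump_LIMSEQ, of 2 z "?L z"] by simp
    show "\<forall>\<^sub>F n in sequentially. (LINT z|lborel. bump 2 (real (Suc n)) z * ?L z) \<le> 4 * (C + (LINT z|lborel. cmod (?h z)))"
    proof (intro always_eventually allI)
      fix n
      have "- (LINT z|lborel. Re (cutoff n z * ?h z)) \<le> (LINT z|lborel. cmod (?h z))"
      proof -
        have "- (LINT z|lborel. Re (cutoff n z * ?h z)) = (LINT z|lborel. - Re (cutoff n z * ?h z))"
          by (rule Bochner_Integration.integral_minus[symmetric])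
        also have "\<dots> \<le> (LINT z|lborel. cmod (?h z))"
        proof (rule integral_mono)
          fix z
          have "- Re (cutoff n z * ?h z) \<le> cmod (cutoff n z * ?h z)" using abs_Re_le_cmod[of "cutoff n z * ?h z"] by linarith
          also have "\<dots> \<le> cmod (?h z)" unfolding norm_mult[of "cutoff n z"]
            using cutoff_bound[of n z] by (intro mult_left_le_one_le) auto
          finally show "- Re (cutoff n z * ?h z) \<le> cmod (?h z)" .
        qed (rule integrable_minus[OF C(3)] integrable_norm[OF h])+
        finally show ?thesis .
      qed
      moreover have "(LINT z|lborel. bump 2 (real (Suc n)) z * ?L z) / 4 + (LINT z|lborel. Re (cutoff n z * ?h z)) \<le> C"
        using C(1)[of n] by (simp only: Bochner_Integration.integral_add[OF integrable_divide[OF C(2)] C(3)] integral_divide_zero)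
      ultimately show "(LINT z|lborel. bump 2 (real (Suc n)) z * ?L z) \<le> 4 * (C + (LINT z|lborel. cmod (?h z)))"
        by (rule arith)
    qed
  qed
qed

text \<open>With both derivatives in \<open>L2 \<phi>\<close>, every factor standing beside a cutoff
  or its derivative in \<open>kohn_integrand\<close> is integrable, so the error terms tend to 0 and
  the cutoffs to 1.\<close>

lemma kohn_identity:
  assumes psh: "plurisubharmonic \<phi>" and f: "f \<in> A2 \<phi>" and g: "g \<in> A2 \<phi>"
    and Ff: "(\<lambda>z. dphi j z * f z) \<in> L2 \<phi>" and Fg: "(\<lambda>z. dphi k z * g z) \<in> L2 \<phi>"
    and f': "d_z k f \<in> L2 \<phi>" and g': "d_z j g \<in> L2 \<phi>"
  shows "inner_w \<phi> (\<lambda>z. dphi j z * f z) (\<lambda>z. dphi k z * g z) =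
    (LINT z|lborel. levi j k z * f z * cnj (g z) * weight z) + inner_w \<phi> (d_z k f) (d_z j g)"
proof -
  note gL = A2_L2[OF cont_phi g]
  note ef = A2_entire[OF cont_phi f] and eg = A2_entire[OF cont_phi g]
  note i1 = L2_integrable_mult[OF cont_phi Ff gL] and i2 = levi_term_integrable[OF psh f g Ff Fg]
    and i3 = L2_integrable_mult[OF cont_phi Ff Fg] and i4 = L2_integrable_mult[OF cont_phi f' gL]
    and i5 = L2_integrable_mult[OF cont_phi f' g']
  let ?S = "\<lambda>n. (LINT z|lborel. d_z k (cutoff n) z * (dphi j z * f z * cnj (g z) * weight z))
     + (LINT z|lborel. cutoff n z * (levi j k z * f z * cnj (g z) * weight z))
     - (LINT z|lborel. cutoff n z * (dphi j z * f z * cnj (dphi k z * g z) * weight z))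
     + (LINT z|lborel. d_zbar j (cutoff n) z * (d_z k f z * cnj (g z) * weight z))
     + (LINT z|lborel. cutoff n z * (d_z k f z * cnj (d_z j g z) * weight z))"
  have "?S n = 0" for n
    using integral_kohn_integrand(2)[OF ef eg, of n j k] unfolding kohn_integrand_def
    by (simp only: Bochner_Integration.integral_add Bochner_Integration.integral_diff Bochner_Integration.integrable_add
        Bochner_Integration.integrable_diff cutoff_integrable[OF i1] cutoff_integrable[OF i2] cutoff_integrable[OF i3]
        cutoff_integrable[OF i4] cutoff_integrable[OF i5])
  moreover have "?S \<longlonglongrightarrow> 0 + (LINT z|lborel. levi j k z * f z * cnj (g z) * weight z)
     - (LINT z|lborel. dphi j z * f z * cnj (dphi k z * g z) * weight z) + 0 + (LINT z|lborel. d_z k f z * cnj (d_z j g z) * weight z)"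
    by (intro tendsto_intros cutoff_LIMSEQ i1 i2 i3 i4 i5)
  ultimately have "(\<lambda>n. 0 :: complex) \<longlonglongrightarrow> 0 + (LINT z|lborel. levi j k z * f z * cnj (g z) * weight z)
     - (LINT z|lborel. dphi j z * f z * cnj (dphi k z * g z) * weight z) + 0 + (LINT z|lborel. d_z k f z * cnj (d_z j g z) * weight z)" by simp
  then have "0 = 0 + (LINT z|lborel. levi j k z * f z * cnj (g z) * weight z)
     - (LINT z|lborel. dphi j z * f z * cnj (dphi k z * g z) * weight z) + 0 + (LINT z|lborel. d_z k f z * cnj (d_z j g z) * weight z)"
    by (rule LIMSEQ_unique[OF tendsto_const])
  then show ?thesis unfolding inner_w_def by (simp add: algebra_simps)
qed

end

section \<open>The adjoint and the main identity\<close>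

lemma sum_over_singletons:
  fixes g :: "'n::finite set \<Rightarrow> 'b::comm_monoid_add"
  assumes "\<And>J. card J \<noteq> 1 \<Longrightarrow> g J = 0"
  shows "(\<Sum>J\<in>UNIV. g J) = (\<Sum>j\<in>UNIV. g {j})"
proof -
  have "(\<Sum>J\<in>UNIV. g J) = (\<Sum>J\<in>range (\<lambda>j. {j}). g J)"
  proof (rule sum.mono_neutral_right)
    show "\<forall>J\<in>UNIV - range (\<lambda>j. {j}). g J = 0"
    proof
      fix J :: "'n set" assume "J \<in> UNIV - range (\<lambda>j. {j})"
      then have "card J \<noteq> 1" by (metis DiffD2 card_1_singletonE rangeI)
      then show "g J = 0" by (rule assms)
    qed
  qed auto
  also have "\<dots> = (\<Sum>j\<in>UNIV. g {j})"
    by (subst sum.reindex) (auto simp: inj_on_def)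
  finally show ?thesis .
qed

text \<open>A doubleton stands for one increasing pair, whereas the double sum runs over ordered
  pairs; symmetry of \<open>m\<close> produces the factor 2.\<close>

lemma sum_over_doubletons:
  fixes g :: "'n::{finite,linorder} set \<Rightarrow> real"
  assumes g: "\<And>J. card J \<noteq> 2 \<Longrightarrow> g J = 0" and m: "\<And>j k. j < k \<Longrightarrow> g {j, k} = m j k"
    and sym: "\<And>j k. m j k = m k j" and diag: "\<And>j. m j j = 0"
  shows "2 * (\<Sum>J\<in>UNIV. g J) = (\<Sum>j\<in>UNIV. \<Sum>k\<in>UNIV. m j k)"
proof -
  define T where "T = {(j, k). j < (k::'n)}"
  have bij: "bij_betw (\<lambda>(j, k). {j, k}) T {J. card J = 2}"
  proof (rule bij_betwI')
    show "\<And>x y. x \<in> T \<Longrightarrow> y \<in> T \<Longrightarrow> ((case x of (j, k) \<Rightarrow> {j, k}) = (case y of (j, k) \<Rightarrow> {j, k})) = (x = y)"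
      by (auto simp: T_def doubleton_eq_iff)
    show "\<And>x. x \<in> T \<Longrightarrow> (case x of (j, k) \<Rightarrow> {j, k}) \<in> {J. card J = 2}"
      by (auto simp: T_def)
    fix J :: "'n set" assume "J \<in> {J. card J = 2}"
    then obtain x y where "J = {x, y}" "x \<noteq> y" by (auto simp: card_2_iff)
    then consider "(x, y) \<in> T" "J = {x, y}" | "(y, x) \<in> T" "J = {y, x}"
      unfolding T_def by (auto simp: neq_iff)
    then show "\<exists>x\<in>T. J = (case x of (j, k) \<Rightarrow> {j, k})"
    proof cases
      case 1
      then show ?thesis by (intro bexI[of _ "(x, y)"]) simp_all
    next
      case 2
      then show ?thesis by (intro bexI[of _ "(y, x)"]) simp_all
    qed
  qed
  have "(\<Sum>J\<in>UNIV. g J) = (\<Sum>J\<in>{J. card J = 2}. g J)"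
    by (rule sum.mono_neutral_right) (auto simp: g)
  also have "\<dots> = (\<Sum>p\<in>T. g (case p of (j, k) \<Rightarrow> {j, k}))"
    by (rule sum.reindex_bij_betw[OF bij, symmetric])
  also have "\<dots> = (\<Sum>(j, k)\<in>T. m j k)"
    by (rule sum.cong) (auto simp: T_def m)
  finally have 1: "(\<Sum>J\<in>UNIV. g J) = (\<Sum>(j, k)\<in>T. m j k)" .
  have 2: "(\<Sum>(j, k)\<in>T. m j k) = (\<Sum>(j, k)\<in>prod.swap ` T. m j k)"
    by (subst sum.reindex) (auto simp: inj_on_def sym intro!: sum.cong)
  have "(\<Sum>j\<in>UNIV. \<Sum>k\<in>UNIV. m j k) = (\<Sum>(j, k)\<in>UNIV. m j k)"
    by (simp add: sum.cartesian_product)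
  also have "\<dots> = (\<Sum>(j, k)\<in>T \<union> prod.swap ` T. m j k)"
  proof (rule sum.mono_neutral_right)
    have "a = b" if "(a, b) \<notin> T \<union> prod.swap ` T" for a b
      using that by (force simp: T_def image_iff)
    then show "\<forall>p\<in>UNIV - (T \<union> prod.swap ` T). (case p of (j, k) \<Rightarrow> m j k) = 0"
      using diag by fastforce
  qed auto
  also have "\<dots> = (\<Sum>(j, k)\<in>T. m j k) + (\<Sum>(j, k)\<in>prod.swap ` T. m j k)"
    by (rule sum.union_disjoint) (auto simp: T_def)
  finally show ?thesis using 1 2 by simp
qed

section \<open>Coefficients of forms of degree 0, 1 and 2\<close>

lemma del_empty: "del f {j} = d_z j (f {})"
  by (rule ext) (simp add: del_def cong: conj_cong)

lemma del_doubleton: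
  assumes "j < k"
  shows "del f {j, k} = (\<lambda>z. d_z j (f {k}) z - d_z k (f {j}) z)"
proof
  fix z
  \<comment> \<open>No element of \<open>{j, k}\<close> lies below \<open>j\<close> and one lies
    below \<open>k\<close>; hence the opposite signs.\<close>
  have s: "{i. (i = j \<or> i = k) \<and> i < j} = {}" "{i. (i = j \<or> i = k) \<and> i < k} = {j}"
    "{j, k} - {j} = {k}" "{j, k} - {k} = {j}"
    using assms by auto
  show "del f {j, k} z = d_z j (f {k}) z - d_z k (f {j}) z"
    unfolding del_def using assms by (simp add: s less_imp_neq)
qed

lemma inner_w_zero: "inner_w \<phi> (\<lambda>z. 0) g = 0" "inner_w \<phi> f (\<lambda>z. 0) = 0" "norm_w \<phi> (\<lambda>z. 0) = 0"
  by (simp_all add: inner_w_def norm_w_def)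

lemma inner_form_0:
  fixes f :: "('n::finite) form"
  assumes "f \<in> A2_form 0 \<phi>"
  shows "inner_form \<phi> f h = inner_w \<phi> (f {}) (h {})"
proof -
  have "f J = (\<lambda>z. 0)" if "J \<noteq> {}" for J using assms that by (auto simp: A2_form_def split: if_splits)
  then have "inner_form \<phi> f h = (\<Sum>J\<in>(UNIV :: 'n set set). if J = {} then inner_w \<phi> (f {}) (h {}) else 0)"
    unfolding inner_form_def by (intro sum.cong[OF refl]) (simp add: inner_w_zero)
  then show ?thesis by simp
qed

lemma norm_form_0:
  fixes f :: "('n::finite) form"
  assumes "\<And>J. J \<noteq> {} \<Longrightarrow> f J = (\<lambda>z. 0)"
  shows "norm_form \<phi> f = norm_w \<phi> (f {})"
proof -
  have "(\<Sum>J\<in>UNIV. (norm_w \<phi> (f J))\<^sup>2) = (\<Sum>J\<in>(UNIV :: 'n set set). if J = {} then (norm_w \<phi> (f {}))\<^sup>2 else 0)"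
    by (intro sum.cong[OF refl]) (simp add: inner_w_zero assms)
  also have "\<dots> = (norm_w \<phi> (f {}))\<^sup>2" by simp
  finally show ?thesis
    unfolding norm_form_def norm_w_def[of \<phi> "f {}"] by (simp add: real_sqrt_unique)
qed

lemma A2_form_component:
  assumes "u \<in> A2_form p \<phi>"
  shows "card J = p \<Longrightarrow> u J \<in> A2 \<phi>" "card J \<noteq> p \<Longrightarrow> u J = (\<lambda>z. 0)"
  using assms by (auto simp: A2_form_def split: if_splits)

lemma bergman_proj_inner:
  assumes cont: "continuous_on UNIV \<phi>" and F: "F \<in> L2 \<phi>" and g: "g \<in> A2 \<phi>"
  shows "inner_w \<phi> g F = inner_w \<phi> g (bergman_proj \<phi> F)" "inner_w \<phi> F g = inner_w \<phi> (bergman_proj \<phi> F) g"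
proof -
  have "inner_w \<phi> F g - inner_w \<phi> (bergman_proj \<phi> F) g = 0"
    using bergman_proj(2)[OF cont F g]
      inner_w_diff_left[OF cont F A2_L2[OF cont bergman_proj(1)[OF cont F]] A2_L2[OF cont g]] by simp
  then show "inner_w \<phi> F g = inner_w \<phi> (bergman_proj \<phi> F) g" by simp
  then show "inner_w \<phi> g F = inner_w \<phi> g (bergman_proj \<phi> F)"
    using inner_w_cnj[OF cont, of g] by simp
qed

text \<open>\<open>inner_w_d_z\<close> shows that the candidate solves the adjoint equation, the
  projections bringing it into \<open>A2 \<phi>\<close>. The definite description also demands that
  it be the only solution; here density of the domain enters.\<close>

lemma del_adj_eq:
  fixes \<phi> :: "complex^('n::{finite,linorder}) \<Rightarrow> real"
  defines "F \<equiv> \<lambda>u j z. d_zbar j (\<lambda>z. complex_of_real (\<phi> z)) z * u {j} z"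
  assumes smooth: "C_infinity \<phi>" and dense: "densely_defined_del 0 \<phi>" and u: "u \<in> A2_form 1 \<phi>"
    and F: "\<And>j. F u j \<in> L2 \<phi>"
  shows "del_adj 0 \<phi> u = (\<lambda>J. if J = {} then (\<lambda>z. \<Sum>j\<in>UNIV. bergman_proj \<phi> (F u j) z) else (\<lambda>z. 0))"
    (is "_ = ?h")
proof -
  note cont = cont_phi[OF smooth]
  have Pr: "bergman_proj \<phi> (F u j) \<in> A2 \<phi>" for j by (rule bergman_proj(1)[OF cont F])
  have hA: "?h \<in> A2_form 0 \<phi>"
    by (auto simp: A2_form_def intro: A2_sum[OF cont] Pr)
  have h: "inner_form \<phi> (del f) u = inner_form \<phi> f ?h" if f: "f \<in> dom_del 0 \<phi>" for f
  proof -
    have f0: "f \<in> A2_form 0 \<phi>" and df: "del f \<in> A2_form 1 \<phi>" using f by (auto simp: dom_del_def)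
    have fA: "f {} \<in> A2 \<phi>" using A2_form_component(1)[OF f0] by simp
    have term_j: "inner_w \<phi> (del f {j}) (u {j}) = inner_w \<phi> (f {}) (bergman_proj \<phi> (F u j))" for j
    proof -
      have "d_z j (f {}) \<in> L2 \<phi>"
        using A2_form_component(1)[OF df, of "{j}"] A2_L2[OF cont] by (simp add: del_empty)
      then have "inner_w \<phi> (d_z j (f {})) (u {j}) = inner_w \<phi> (f {}) (F u j)"
        unfolding F_def by (rule inner_w_d_z[OF smooth fA _ _ F[unfolded F_def]])
          (use A2_form_component(1)[OF u, of "{j}"] in simp)
      then show ?thesis unfolding del_empty bergman_proj_inner(1)[OF cont F fA] .
    qed
    have "inner_form \<phi> (del f) u = (\<Sum>j\<in>UNIV. inner_w \<phi> (del f {j}) (u {j}))"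
      unfolding inner_form_def
    proof (rule sum_over_singletons)
      show "inner_w \<phi> (del f J) (u J) = 0" if "card J \<noteq> 1" for J
        unfolding A2_form_component(2)[OF u that] by (rule inner_w_zero)
    qed
    also have "\<dots> = (\<Sum>j\<in>UNIV. inner_w \<phi> (f {}) (bergman_proj \<phi> (F u j)))" by (simp only: term_j)
    also have "\<dots> = inner_w \<phi> (f {}) (\<lambda>z. \<Sum>j\<in>UNIV. bergman_proj \<phi> (F u j) z)"
      by (rule inner_w_sum_right[symmetric, OF cont]) (intro A2_L2[OF cont] Pr fA)+
    also have "\<dots> = inner_form \<phi> f ?h" by (simp add: inner_form_0[OF f0])
    finally show ?thesis .
  qed
  show ?thesis
    unfolding del_adj_def
  proof (rule the_equality)
    show "?h \<in> A2_form 0 \<phi> \<and> (\<forall>f\<in>dom_del 0 \<phi>. inner_form \<phi> (del f) u = inner_form \<phi> f ?h)"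
      using hA h by blast
    fix k assume k: "k \<in> A2_form 0 \<phi> \<and> (\<forall>f\<in>dom_del 0 \<phi>. inner_form \<phi> (del f) u = inner_form \<phi> f k)"
    then have kA: "k \<in> A2_form 0 \<phi>"
      and k_eq: "f \<in> dom_del 0 \<phi> \<Longrightarrow> inner_form \<phi> (del f) u = inner_form \<phi> f k" for f by simp_all
    define v where "v = (\<lambda>z. k {} z - ?h {} z)"
    define w where "w = (\<lambda>J z. k J z - ?h J z)"
    have k0: "k {} \<in> A2 \<phi>" and h0: "?h {} \<in> A2 \<phi>"
      using A2_form_component(1)[OF kA, of "{}"] A2_form_component(1)[OF hA, of "{}"] by (simp_all only: card.empty)
    have vA: "v \<in> A2 \<phi>" unfolding v_def by (rule A2_diff[OF cont k0 h0])
    have w0: "w J = (\<lambda>z. 0)" if "J \<noteq> {}" for J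
      using that A2_form_component(2)[OF kA, of J] by (simp add: w_def)
    have wv: "w {} = v" by (simp add: w_def v_def)
    have wA: "w \<in> A2_form 0 \<phi>" using w0 wv vA by (auto simp: A2_form_def)
    have orth: "inner_w \<phi> (g {}) v = 0" if g: "g \<in> dom_del 0 \<phi>" for g
    proof -
      have g0: "g \<in> A2_form 0 \<phi>" using g by (simp add: dom_del_def)
      have "inner_w \<phi> (g {}) (k {}) = inner_w \<phi> (g {}) (?h {})"
        using trans[OF k_eq[OF g, symmetric] h[OF g]] unfolding inner_form_0[OF g0] .
      then show ?thesis unfolding v_def
        using inner_w_diff_right[OF cont A2_L2[OF cont k0] A2_L2[OF cont h0] A2_L2[OF cont A2_form_component(1)[OF g0, of "{}"]]]
        by simp
    qed
    \<comment> \<open>As \<open>v\<close> is orthogonal to \<open>g {}\<close> for every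
      \<open>g\<close> in the domain, Pythagoras bounds its norm by its distance to
      \<open>g {}\<close>, which density makes arbitrarily small.\<close>
    have "norm_w \<phi> v \<le> 0 + e" if e: "e > 0" for e
    proof -
      obtain g where g: "g \<in> dom_del 0 \<phi>" "norm_form \<phi> (\<lambda>J z. w J z - g J z) < e"
        using dense wA e unfolding densely_defined_del_def by blast
      have g0: "g \<in> A2_form 0 \<phi>" using g by (simp add: dom_del_def)
      have gA: "g {} \<in> A2 \<phi>" using A2_form_component(1)[OF g0] by simp
      have "norm_form \<phi> (\<lambda>J z. w J z - g J z) = norm_w \<phi> (\<lambda>z. w {} z - g {} z)"
        by (rule norm_form_0) (use w0 A2_form_component(2)[OF g0] in simp)
      then have lt: "norm_w \<phi> (\<lambda>z. v z - 1 * g {} z) < e" using g(2) unfolding wv by simp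
      have "inner_w \<phi> v (g {}) = 0" using orth[OF g(1)] inner_w_cnj[OF cont, of v "g {}"] by simp
      then have "(norm_w \<phi> (\<lambda>z. v z - 1 * g {} z))\<^sup>2 = (norm_w \<phi> v)\<^sup>2 + (norm_w \<phi> (g {}))\<^sup>2"
        unfolding norm_w_sq_diff[OF cont A2_L2[OF cont vA] A2_L2[OF cont gA]] by simp
      then have "(norm_w \<phi> v)\<^sup>2 \<le> (norm_w \<phi> (\<lambda>z. v z - 1 * g {} z))\<^sup>2" by simp
      then have "norm_w \<phi> v \<le> norm_w \<phi> (\<lambda>z. v z - 1 * g {} z)"
        by (rule power2_le_imp_le) (rule norm_w_nonneg[OF cont])
      then show ?thesis using lt by simp
    qed
    then have "norm_w \<phi> v \<le> 0" by (rule field_le_epsilon)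
    then have "norm_w \<phi> v = 0" using norm_w_nonneg[OF cont, of v] by linarith
    then have "v = (\<lambda>z. 0)" by (rule A2_norm_zero[OF cont vA])
    then have "w = (\<lambda>J z. 0)" using w0 wv by (metis ext)
    then have "k J z - ?h J z = 0" for J z unfolding w_def by meson
    then show "k = ?h" by (intro ext) (simp only: right_minus_eq)
  qed
qed

text \<open>Summing over ordered pairs counts each coefficient of \<open>\<partial>u\<close> twice.
  The mixed terms may be complex individually, but exchanging \<open>j\<close> and \<open>k\<close>
  conjugates them, so their double sum equals the sum of their real parts.\<close>

lemma norm_form_del_1:
  fixes \<phi> :: "complex^('n::{finite,linorder}) \<Rightarrow> real"
  assumes cont: "continuous_on UNIV \<phi>" and du: "del u \<in> A2_form 2 \<phi>"
    and a: "\<And>j k. d_z k (u {j}) \<in> L2 \<phi>"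
  shows "complex_of_real ((norm_form \<phi> (del u))\<^sup>2) =
    of_real (\<Sum>j\<in>UNIV. \<Sum>k\<in>UNIV. (norm_w \<phi> (d_z k (u {j})))\<^sup>2)
    - (\<Sum>j\<in>UNIV. \<Sum>k\<in>UNIV. inner_w \<phi> (d_z k (u {j})) (d_z j (u {k})))"
proof -
  \<comment> \<open>The factor \<open>1\<close> fits the expression to
    \<open>norm_w_sq_diff\<close>.\<close>
  define m where "m j k = (norm_w \<phi> (\<lambda>z. d_z j (u {k}) z - 1 * d_z k (u {j}) z))\<^sup>2" for j k
  define N where "N j k = (norm_w \<phi> (d_z k (u {j})))\<^sup>2" for j k
  define I where "I j k = inner_w \<phi> (d_z k (u {j})) (d_z j (u {k}))" for j k
  have arith: "x = t" if "x = s" "2 * s = y" "y = 2 * t" for x s y t :: real using that by simp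
  have meq: "m j k = N k j + N j k - 2 * Re (I k j)" for j k
    unfolding m_def norm_w_sq_diff[OF cont a a] N_def I_def by simp
  have Icnj: "I k j = cnj (I j k)" for j k unfolding I_def by (rule inner_w_cnj[OF cont])
  have "(norm_form \<phi> (del u))\<^sup>2 = (\<Sum>J\<in>UNIV. (norm_w \<phi> (del u J))\<^sup>2)"
    unfolding norm_form_def by (intro real_sqrt_pow2 sum_nonneg) simp
  moreover have "2 * (\<Sum>J\<in>UNIV. (norm_w \<phi> (del u J))\<^sup>2) = (\<Sum>j\<in>UNIV. \<Sum>k\<in>UNIV. m j k)"
  proof (rule sum_over_doubletons)
    show "(norm_w \<phi> (del u J))\<^sup>2 = 0" if "card J \<noteq> 2" for J
      unfolding A2_form_component(2)[OF du that] by (simp add: inner_w_zero)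
    show "(norm_w \<phi> (del u {j, k}))\<^sup>2 = m j k" if "j < k" for j k
      unfolding del_doubleton[OF that] m_def by simp
    show "m j k = m k j" for j k unfolding meq Icnj[of k j] by simp
    show "m j j = 0" for j unfolding m_def by (simp add: inner_w_zero)
  qed
  moreover have "(\<Sum>j\<in>UNIV. \<Sum>k\<in>UNIV. m j k) = 2 * ((\<Sum>j\<in>UNIV. \<Sum>k\<in>UNIV. N j k) - (\<Sum>j\<in>UNIV. \<Sum>k\<in>UNIV. Re (I j k)))"
  proof -
    have "(\<Sum>j\<in>UNIV. \<Sum>k\<in>UNIV. m j k) = (\<Sum>j\<in>UNIV. \<Sum>k\<in>UNIV. N k j) + (\<Sum>j\<in>UNIV. \<Sum>k\<in>UNIV. N j k) - 2 * (\<Sum>j\<in>UNIV. \<Sum>k\<in>UNIV. Re (I k j))"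
      unfolding meq by (simp add: sum.distrib sum_subtractf sum_distrib_left)
    moreover have "(\<Sum>j\<in>UNIV. \<Sum>k\<in>UNIV. N k j) = (\<Sum>j\<in>UNIV. \<Sum>k\<in>UNIV. N j k)" by (rule sum.swap)
    moreover have "(\<Sum>j\<in>UNIV. \<Sum>k\<in>UNIV. Re (I k j)) = (\<Sum>j\<in>UNIV. \<Sum>k\<in>UNIV. Re (I j k))" by (rule sum.swap)
    ultimately show ?thesis by simp
  qed
  ultimately have main: "(norm_form \<phi> (del u))\<^sup>2 = (\<Sum>j\<in>UNIV. \<Sum>k\<in>UNIV. N j k) - (\<Sum>j\<in>UNIV. \<Sum>k\<in>UNIV. Re (I j k))"
    by (rule arith)
  have "(\<Sum>j\<in>UNIV. \<Sum>k\<in>UNIV. I j k) = of_real (\<Sum>j\<in>UNIV. \<Sum>k\<in>UNIV. Re (I j k))"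
  proof -
    have "cnj (\<Sum>j\<in>UNIV. \<Sum>k\<in>UNIV. I j k) = (\<Sum>j\<in>UNIV. \<Sum>k\<in>UNIV. I k j)"
      by (simp add: cnj_sum Icnj[symmetric])
    also have "\<dots> = (\<Sum>j\<in>UNIV. \<Sum>k\<in>UNIV. I j k)" by (rule sum.swap)
    finally have "(\<Sum>j\<in>UNIV. \<Sum>k\<in>UNIV. I j k) \<in> \<real>" by (simp add: Reals_cnj_iff)
    from of_real_Re[OF this] show ?thesis by (simp only: Re_sum)
  qed
  then show ?thesis unfolding main N_def I_def by simp
qed

text \<open>Integrability is part of the conclusion because the integral of a non-integrable
  function is 0 by convention. The L^2 hypothesis on \<open>F j\<close> gives
  \<open>bergman_proj\<close> its meaning, and density of the domain does so for
  \<open>del_adj\<close>.\<close>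

theorem theorem3p2:
  fixes \<phi> :: "complex^('n::{finite,linorder}) \<Rightarrow> real"
    and u :: "'n form"
  defines "\<phi>c \<equiv> (\<lambda>z. complex_of_real (\<phi> z))"
  defines "F \<equiv> (\<lambda>j z. d_zbar j \<phi>c z * u {j} z)"
  assumes "C_infinity \<phi>"
    and "plurisubharmonic \<phi>"
    and "densely_defined_del 0 \<phi>"
    and "u \<in> A2_form 1 \<phi>"
    and "u \<in> dom_del 1 \<phi> \<inter> dom_del_adj 0 \<phi>"
    and "\<And>j. F j \<in> L2 \<phi>"
  shows "(\<forall>j k. integrable lborel (\<lambda>z. (cmod (d_z k (u {j}) z))\<^sup>2 * exp (- \<phi> z))) \<and>
    (\<forall>j k. integrable lborel
       (\<lambda>z. d_z k (d_zbar j \<phi>c) z * u {j} z * cnj (u {k} z) * of_real (exp (- \<phi> z)))) \<and>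
    complex_of_real ((norm_form \<phi> (del u))\<^sup>2 + (norm_form \<phi> (del_adj 0 \<phi> u))\<^sup>2) =
      complex_of_real
        (\<Sum>j\<in>UNIV. \<Sum>k\<in>UNIV. LINT z|lborel. (cmod (d_z k (u {j}) z))\<^sup>2 * exp (- \<phi> z))
      + (\<Sum>j\<in>UNIV. \<Sum>k\<in>UNIV. LINT z|lborel.
           d_z k (d_zbar j \<phi>c) z * u {j} z * cnj (u {k} z) * of_real (exp (- \<phi> z)))
      - (\<Sum>j\<in>UNIV. \<Sum>k\<in>UNIV. inner_w \<phi> (\<lambda>z. F j z - bergman_proj \<phi> (F j) z) (F k))"
proof -
  note smooth = assms(3) and psh = assms(4) and dense = assms(5) and u = assms(6) and F = assms(8)
  note cont = cont_phi[OF smooth]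
  note F' = F[unfolded F_def \<phi>c_def]
  have uA: "u {j} \<in> A2 \<phi>" for j using A2_form_component(1)[OF u, of "{j}"] by simp
  have du: "del u \<in> A2_form 2 \<phi>" using assms(7) by (simp add: dom_del_def numeral_2_eq_2)
  \<comment> \<open>These are the coefficients of \<open>\<partial>u\<close>, available for
    increasing pairs; \<open>ab\<close> extends them to all pairs by a change of sign.\<close>
  have lt: "(\<lambda>z. d_z j (u {k}) z - d_z k (u {j}) z) \<in> L2 \<phi>" if "j < k" for j k
    using A2_form_component(1)[OF du, of "{j, k}"] A2_L2[OF cont] that del_doubleton[OF that, of u] by simp
  have ab: "(\<lambda>z. d_z k (u {j}) z - d_z j (u {k}) z) \<in> L2 \<phi>" for j k
  proof (cases j k rule: linorder_cases)
    case less
    then show ?thesis using L2_cmult[OF cont lt[OF less], of "-1"] by simp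
  next
    case equal
    then show ?thesis using A2_L2[OF cont A2_zero[OF cont]] by simp
  qed (rule lt)
  have aL: "d_z k (u {j}) \<in> L2 \<phi>" for j k
    by (rule d_z_L2[OF smooth psh uA uA F' F' ab])
  have levi: "integrable lborel (\<lambda>z. d_z k (d_zbar j \<phi>c) z * u {j} z * cnj (u {k} z) * of_real (exp (- \<phi> z)))" for j k
    unfolding \<phi>c_def by (rule levi_term_integrable[OF smooth psh uA uA F' F'])
  define N where "N j k = (LINT z|lborel. (cmod (d_z k (u {j}) z))\<^sup>2 * exp (- \<phi> z))" for j k
  define L where "L j k = (LINT z|lborel. d_z k (d_zbar j \<phi>c) z * u {j} z * cnj (u {k} z) * of_real (exp (- \<phi> z)))" for j k
  define I where "I j k = inner_w \<phi> (d_z k (u {j})) (d_z j (u {k}))" for j k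
  have kohn: "inner_w \<phi> (F j) (F k) = L j k + I j k" for j k
    unfolding F_def L_def I_def \<phi>c_def by (rule kohn_identity[OF smooth psh uA uA F' F' aL aL])
  have del_part: "complex_of_real ((norm_form \<phi> (del u))\<^sup>2) =
      of_real (\<Sum>j\<in>UNIV. \<Sum>k\<in>UNIV. N j k) - (\<Sum>j\<in>UNIV. \<Sum>k\<in>UNIV. I j k)"
    using norm_form_del_1[OF cont du aL] unfolding N_def I_def norm_w_sq[OF cont] .
  let ?P = "\<lambda>j. bergman_proj \<phi> (F j)"
  have PA: "?P j \<in> A2 \<phi>" and PL: "?P j \<in> L2 \<phi>" for j
    using bergman_proj(1)[OF cont F] A2_L2[OF cont] by blast+
  \<comment> \<open>Since \<open>?P j\<close> is in \<open>A2 \<phi>\<close>, the projection in the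
    second slot may be replaced by \<open>F k\<close>.\<close>
  have PP: "inner_w \<phi> (?P j) (?P k) = inner_w \<phi> (F j) (F k) - inner_w \<phi> (\<lambda>z. F j z - ?P j z) (F k)" for j k
    unfolding inner_w_diff_left[OF cont F PL F] bergman_proj_inner(1)[OF cont F PA] by simp
  have "complex_of_real ((norm_form \<phi> (del_adj 0 \<phi> u))\<^sup>2) = inner_w \<phi> (\<lambda>z. \<Sum>j\<in>UNIV. ?P j z) (\<lambda>z. \<Sum>k\<in>UNIV. ?P k z)"
    unfolding F_def \<phi>c_def del_adj_eq[OF smooth dense u F'] inner_w_self[OF cont]
    by (subst norm_form_0) auto
  also have "\<dots> = (\<Sum>j\<in>UNIV. \<Sum>k\<in>UNIV. inner_w \<phi> (?P j) (?P k))"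
    by (simp add: inner_w_sum_left[OF cont] inner_w_sum_right[OF cont] L2_sum[OF cont] PL)
  \<comment> \<open>The sum of the \<open>I j k\<close> produced here cancels the one in
    \<open>del_part\<close>.\<close>
  also have "\<dots> = (\<Sum>j\<in>UNIV. \<Sum>k\<in>UNIV. L j k) + (\<Sum>j\<in>UNIV. \<Sum>k\<in>UNIV. I j k)
      - (\<Sum>j\<in>UNIV. \<Sum>k\<in>UNIV. inner_w \<phi> (\<lambda>z. F j z - ?P j z) (F k))"
    unfolding PP kohn by (simp add: sum.distrib sum_subtractf)
  finally have adj_part: "complex_of_real ((norm_form \<phi> (del_adj 0 \<phi> u))\<^sup>2) = \<dots>" .
  have "complex_of_real ((norm_form \<phi> (del u))\<^sup>2 + (norm_form \<phi> (del_adj 0 \<phi> u))\<^sup>2) =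
      complex_of_real (\<Sum>j\<in>UNIV. \<Sum>k\<in>UNIV. N j k) + (\<Sum>j\<in>UNIV. \<Sum>k\<in>UNIV. L j k)
      - (\<Sum>j\<in>UNIV. \<Sum>k\<in>UNIV. inner_w \<phi> (\<lambda>z. F j z - ?P j z) (F k))"
    unfolding of_real_add del_part adj_part by simp
  then show ?thesis unfolding N_def L_def using levi L2_D(2)[OF aL] by blast
qed

end
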